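(* For every positive integer $n$, $$\begin{aligned} R_7(n)={}&\tfrac{8}{25}\sigma_3(n)-\tfrac{16}{25}\sigma_3\left(\tfrac{n}{2}\right)+\tfrac{128}{25}\sigma_3\left(\tfrac{n}{4}\right)+\tfrac{392}{25}\sigma_3\left(\tfrac{n}{7}\right)-\tfrac{784}{25}\sigma_3\left(\tfrac{n}{14}\right)+\tfrac{6272}{25}\sigma_3\left(\tfrac{n}{28}\right)\\ &-\tfrac{928}{175}c_1(n)-\tfrac{768}{25}c_2(n)+\tfrac{32}{5}c_3(n)+\tfrac{2272}{175}c_4(n)+\tfrac{2304}{25}c_5(n)+\tfrac{768}{5}c_6(n)-\tfrac{1152}{25}c_7(n)\\ &+\tfrac{24576}{25}\left(c_8(n)+c_9(n)\right). \end{aligned}$$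
   Context: For $n\in\mathbb{N}=\{1,2,3,\dots\}$, $R_7(n)$ is the number of $(x_1,\dots,x_8)\in\mathbb{Z}^8$ with $$n=x_1^2+x_2^2+x_3^2+x_4^2+7(x_5^2+x_6^2+x_7^2+x_8^2).$$ $\sigma_3(n)=\sum_{d\mid n}d^3$ (sum over positive divisors) for $n\in\mathbb{N}$, and $\sigma_3(x)=0$ if $x\notin\mathbb{N}$. Let $q=e^{2\pi i z}$ with $\mathrm{Im}(z)>0$ and let $\eta(z)=q^{1/24}\prod_{n\ge1}(1-q^n)$ be the Dedekind eta function. Define $$C_1(q)=\frac{\eta^5(z)\eta^5(7z)}{\eta(2z)\eta(14z)},\quad C_2(q)=\eta^2(z)\eta^2(2z)\eta^2(7z)\eta^2(14z),\quad C_3(q)=\frac{\eta^6(z)\eta^6(14z)}{\eta^2(2z)\eta^2(7z)},$$ $$C_4(q)=\frac{\eta^6(2z)\eta^6(7z)}{\eta^2(z)\eta^2(14z)},\quad C_5(q)=\eta^2(4z)\eta^4(14z)\eta^2(28z),\quad C_6(q)=\frac{\eta^6(2z)\eta^6(28z)}{\eta^2(4z)\eta^2(14z)},$$ $$C_7(q)=\frac{\eta^4(2z)\eta^6(28z)}{\eta^2(4z)},\quad C_8(q)=\frac{\eta(z)\eta(2z)\eta(7z)\eta^8(28z)}{\eta^3(14z)},\quad C_9(q)=\frac{\eta(2z)\eta(4z)\eta^9(28z)}{\eta^3(14z)},$$ and integers $c_r(n)$ ($n\in\mathbb{N}$, $1\le r\le 9$) by $C_r(q)=\sum_{n=1}^\infty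 c_r(n)q^n$. *)

theory Defs
  imports "HOL-Analysis.Analysis"
begin

definition R7 :: "nat \<Rightarrow> nat" where
  "R7 n = card {(x1 :: int, x2 :: int, x3 :: int, x4 :: int, x5 :: int, x6 :: int, x7 :: int, x8 :: int).
     int n = x1^2 + x2^2 + x3^2 + x4^2 + 7 * (x5^2 + x6^2 + x7^2 + x8^2)}"

(* The argument is real so that sigma3 (n / k) makes sense, and vanishes, when k does not divide n. *)
definition sigma3 :: "real \<Rightarrow> nat" where
  "sigma3 x = (if x \<in> \<nat> - {0} then (\<Sum>d | d dvd nat \<lfloor>x\<rfloor>. d ^ 3) else 0)"

definition nome :: "complex \<Rightarrow> complex" where
  "nome z = exp (2 * of_real pi * \<i> * z)"

(* The factor q^(1/24) is exp (2 pi i z / 24), so no branch of a root of q is chosen.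
   Only the values at Im z > 0 are meaningful. *)
definition eta :: "complex \<Rightarrow> complex" where
  "eta z = exp (2 * of_real pi * \<i> * z / 24) * (\<Prod>n. 1 - nome z ^ Suc n)"

definition C1 :: "complex \<Rightarrow> complex" where
  "C1 z = eta z ^ 5 * eta (7*z) ^ 5 / (eta (2*z) * eta (14*z))"

definition C2 :: "complex \<Rightarrow> complex" where
  "C2 z = eta z ^ 2 * eta (2*z) ^ 2 * eta (7*z) ^ 2 * eta (14*z) ^ 2"

definition C3 :: "complex \<Rightarrow> complex" where
  "C3 z = eta z ^ 6 * eta (14*z) ^ 6 / (eta (2*z) ^ 2 * eta (7*z) ^ 2)"

definition C4 :: "complex \<Rightarrow> complex" where
  "C4 z = eta (2*z) ^ 6 * eta (7*z) ^ 6 / (eta z ^ 2 * eta (14*z) ^ 2)"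

definition C5 :: "complex \<Rightarrow> complex" where
  "C5 z = eta (4*z) ^ 2 * eta (14*z) ^ 4 * eta (28*z) ^ 2"

definition C6 :: "complex \<Rightarrow> complex" where
  "C6 z = eta (2*z) ^ 6 * eta (28*z) ^ 6 / (eta (4*z) ^ 2 * eta (14*z) ^ 2)"

definition C7 :: "complex \<Rightarrow> complex" where
  "C7 z = eta (2*z) ^ 4 * eta (28*z) ^ 6 / eta (4*z) ^ 2"

definition C8 :: "complex \<Rightarrow> complex" where
  "C8 z = eta z * eta (2*z) * eta (7*z) * eta (28*z) ^ 8 / eta (14*z) ^ 3"

definition C9 :: "complex \<Rightarrow> complex" where
  "C9 z = eta (2*z) * eta (4*z) * eta (28*z) ^ 9 / eta (14*z) ^ 3"

(* The integers a 1, a 2, ... with F z = (\<Sum>n\<ge>1. a n * q^n), q = nome z, on the upper half-plane.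
   Such expansions start at n = 1; a 0 = 0 expresses this and makes the sequence unique. *)
definition q_coeff :: "(complex \<Rightarrow> complex) \<Rightarrow> nat \<Rightarrow> int" where
  "q_coeff F = (THE a. a 0 = 0 \<and>
     (\<forall>z. Im z > 0 \<longrightarrow> (\<lambda>n. of_int (a n) * nome z ^ n) sums F z))"

end

theory Submission
  imports Defs "HOL-Complex_Analysis.Complex_Analysis"
begin

text \<open>With \<open>\<theta>(q) = \<Sum> q^(n^2)\<close>, the numbers \<open>R7 n\<close> are
  the coefficients of \<open>\<theta>(q)^4 \<theta>(q^7)^4\<close>, and by Jacobi's theorem on eight
  squares the divisor sums are the coefficients of
  \<open>(\<theta>(q)^8 + 49 \<theta>(q^7)^8) / 50\<close>. What remains is an identity between eta
  quotients for real \<open>0 < q < 1\<close>. Let \<open>\<alpha>(q)\<close> be the modular lambda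
  function in the nome \<open>q\<close>, \<open>\<beta>(q) = \<alpha>(q^7)\<close>,
  \<open>t^8 = \<alpha> \<beta>\<close> and \<open>s^8 = (1 - \<alpha>) (1 - \<beta>)\<close>. The
  modular equation of degree seven is \<open>t + s = 1\<close>; it makes \<open>\<alpha>\<close> and
  \<open>\<beta>\<close> conjugate functions on the genus two curve
  \<open>y^2 = (2 - p) (2 - 5 p + 4 p^2)\<close>, \<open>p = t s\<close>. Differentiating it, with
  \<open>q \<alpha>' = \<alpha> (1 - \<alpha>) \<theta>^4\<close>, gives
  \<open>\<theta>(q)^4 / \<theta>(q^7)^4 = 7 (t - \<beta>) / (\<alpha> - t)\<close>. Every term of
  the identity divided by \<open>\<theta>(q)^4 \<theta>(q^7)^4\<close> is thereby a rational
  function on the curve, and the identity becomes a polynomial one.\<close>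

section \<open>The Jacobi triple product\<close>

text \<open>\<open>q_coeff\<close> is a definite description over integer sequences, so each eta
  quotient must be shown to have an integral expansion on the unit disc. Once that is known, its
  coefficients are determined by its values at real nomes \<open>0 < q < 1\<close>, and the identity
  is proved only there. Real nomes also settle every choice of branch. The quantities \<alpha>,
  \<beta>, t, s lie strictly between 0 and 1; differentiation gives only the square of
  \<open>\<theta>(q)^2 / \<theta>(q^7)^2\<close>, another unit on the curve is known only through
  its cube, and positivity or the unique real cube root selects the right function. No space of
  modular forms enters. The modular equation comes from a sign-reversing matching in a lattice sum,
  the differential equation of \<alpha> from Jacobi's series for the cube of the Euler product, and
  the eight squares theorem from Liouville's elementary method. The curve is a model of X_0(28).
  Most terms of the identity are not invariant under \<open>y \<mapsto> -y\<close>, so it cannot be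
  reduced to an identity in t alone: the part linear in y has to vanish as well.\<close>

definition euler :: "'a::{real_normed_field,banach} \<Rightarrow> 'a" where
  "euler q = (\<Prod>n. 1 - q ^ Suc n)"

definition qpoch :: "'a::{real_normed_field,banach} \<Rightarrow> nat \<Rightarrow> 'a" where
  "qpoch q n = (\<Prod>k<n. 1 - q ^ Suc k)"

text \<open>The exponents of the bilateral series. They are nonnegative for every integer i, so
  \<open>nat\<close> loses nothing and ordinary powers of q suffice.\<close>

definition tri :: "int \<Rightarrow> nat" where
  "tri i = nat (i * (i - 1) div 2)"

lemma norm_power_lt1:
  fixes q :: "'a::real_normed_field"
  shows "norm q < 1 \<Longrightarrow> n > 0 \<Longrightarrow> norm (q ^ n) < 1"
  using power_strict_mono[of "norm q" 1 n] by (simp add: norm_power)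

lemma one_minus_power_nz:
  fixes q :: "'a::real_normed_field"
  assumes "norm q < 1" shows "1 - q ^ Suc n \<noteq> 0"
  using norm_power_lt1[OF assms, of "Suc n"] by (metis eq_iff_diff_eq_0 less_irrefl norm_one
      zero_less_Suc)

lemma euler_convergent:
  fixes q :: "'a::{real_normed_field,banach}"
  assumes "norm q < 1" shows "convergent_prod (\<lambda>n. 1 - q ^ Suc n)"
proof -
  have "summable (\<lambda>n. norm (- (q ^ Suc n)))"
    using assms by (simp add: norm_power norm_mult summable_mult summable_geometric)
  then have "summable (\<lambda>n. norm (1 - q ^ Suc n - 1))" by simp
  then show ?thesis
    by (intro abs_convergent_prod_imp_convergent_prod summable_imp_abs_convergent_prod)
qed

lemma qpoch_tendsto:
  fixes q :: "'a::{real_normed_field,banach}"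
  assumes "norm q < 1" shows "qpoch q \<longlonglongrightarrow> euler q"
proof -
  have "(\<lambda>n. \<Prod>k\<le>n. 1 - q ^ Suc k) \<longlonglongrightarrow> euler q"
    unfolding euler_def by (rule convergent_prod_LIMSEQ[OF euler_convergent[OF assms]])
  then have "(\<lambda>n. qpoch q (Suc n)) \<longlonglongrightarrow> euler q"
    by (simp add: qpoch_def lessThan_Suc_atMost)
  then show ?thesis by (simp add: filterlim_sequentially_Suc)
qed

lemma euler_nz:
  fixes q :: "'a::{real_normed_field,banach}"
  assumes "norm q < 1" shows "euler q \<noteq> 0"
  unfolding euler_def by (intro prodinf_nonzero euler_convergent assms one_minus_power_nz)

lemma qpoch_nz:
  fixes q :: "'a::{real_normed_field,banach}"
  assumes "norm q < 1" shows "qpoch q n \<noteq> 0"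
  unfolding qpoch_def using one_minus_power_nz[OF assms] by auto

lemma qpoch_0 [simp]: "qpoch q 0 = 1" by (simp add: qpoch_def)
lemma qpoch_Suc: "qpoch q (Suc n) = qpoch q n * (1 - q ^ Suc n)" by (simp add: qpoch_def)

text \<open>The Gaussian binomial coefficient for \<open>k \<le> n\<close>. The quotient form gives
  both its limit and a uniform bound from the convergence of \<open>qpoch\<close>.\<close>

definition qbin :: "'a::{real_normed_field,banach} \<Rightarrow> nat \<Rightarrow> nat \<Rightarrow> 'a" where
  "qbin q n k = qpoch q n / (qpoch q k * qpoch q (n - k))"

text \<open>The q-Pascal rule: \<open>1 - q^(n+1)\<close> splits as
  \<open>(1 - q^(n-k)) + q^(n-k) * (1 - q^(k+1))\<close>, and each part cancels one factor of the
  denominator.\<close>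

lemma qbin_Suc:
  assumes "norm q < 1" "k < n"
  shows "qbin q (Suc n) (Suc k) = qbin q n (Suc k) + q ^ (n - k) * qbin q n k"
proof -
  obtain d where n: "n = Suc (k + d)" using assms(2) less_imp_Suc_add by blast
  have nz: "qpoch q m \<noteq> 0" for m using qpoch_nz[OF assms(1)] .
  have nz': "1 - q ^ Suc m \<noteq> 0" for m using one_minus_power_nz[OF assms(1)] .
  have d: "n - k = Suc d" "n - Suc k = d" "Suc n - Suc k = Suc d" using n by auto
  have e: "1 - q ^ Suc n = (1 - q ^ Suc d) + q ^ Suc d * (1 - q ^ Suc k)"
    by (simp add: n algebra_simps power_add)
  have "qbin q (Suc n) (Suc k) = qpoch q n * (1 - q ^ Suc n) / (qpoch q k * (1 - q ^ Suc k)
      * (qpoch q d * (1 - q ^ Suc d)))"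
    by (simp only: qbin_def qpoch_Suc d)
  also have "\<dots> = qpoch q n / (qpoch q k * (1 - q ^ Suc k) * qpoch q d) + q ^ Suc d * (qpoch q n
      / (qpoch q k * (qpoch q d * (1 - q ^ Suc d))))"
    unfolding e using nz[of k] nz[of d] nz'[of k] nz'[of d]
    by (simp add: divide_simps del: power_Suc) (simp add: algebra_simps)
  finally show ?thesis by (simp only: qbin_def qpoch_Suc d)
qed

lemma qbin_0: "norm q < 1 \<Longrightarrow> qbin q n 0 = 1" "norm q < 1 \<Longrightarrow> qbin q n n = 1"
  by (auto simp: qbin_def qpoch_nz)

text \<open>Induction on n with the q-Pascal rule: the coefficient of index j + 1 gains
  \<open>z * q ^ n\<close> times the old one of index j, because the growth of the triangular
  exponent supplies the \<open>q ^ j\<close> that \<open>q ^ (n - j)\<close> lacks.\<close>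

lemma qbinomial_theorem:
  assumes q: "norm q < 1"
  shows "(\<Prod>k<n. 1 + z * q ^ k) = (\<Sum>j\<le>n. qbin q n j * q ^ (j * (j - 1) div 2) * z ^ j)"
proof (induction n)
  case 0 then show ?case by (simp add: qbin_0[OF q])
next
  case (Suc n)
  define g where "g n j = qbin q n j * q ^ (j * (j - 1) div 2) * z ^ j" for n j
  have tr: "Suc j * (Suc j - 1) div 2 = j * (j - 1) div 2 + j" for j :: nat
  proof (cases j)
    case (Suc i)
    have "Suc j * (Suc j - 1) = j * (j - 1) + 2 * j" by (simp add: Suc algebra_simps)
    then show ?thesis by simp
  qed simp
  have step: "g (Suc n) (Suc j) = g n (Suc j) + z * q ^ n * g n j" if "j < n" for j
  proof -
    have "q ^ n = q ^ (n - j) * q ^ j" using that by (simp flip: power_add)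
    then show ?thesis
      unfolding g_def qbin_Suc[OF q that] tr power_add by (simp add: algebra_simps)
  qed
  have last: "g (Suc n) (Suc n) = z * q ^ n * g n n"
    unfolding g_def tr power_add by (simp add: qbin_0[OF q] algebra_simps)
  have "(\<Sum>j\<le>Suc n. g (Suc n) j) = g (Suc n) 0 + (\<Sum>j<Suc n. g (Suc n) (Suc j))"
    by (simp only: sum.atMost_shift lessThan_Suc_atMost)
  also have "\<dots> = g (Suc n) 0 + (\<Sum>j<n. g (Suc n) (Suc j)) + g (Suc n) (Suc n)"
      by (simp add: add.assoc)
  also have "(\<Sum>j<n. g (Suc n) (Suc j)) = (\<Sum>j<n. g n (Suc j)) + z * q ^ n * (\<Sum>j<n. g n j)"
    by (simp add: step sum.distrib sum_distrib_left)
  also have "g (Suc n) 0 + ((\<Sum>j<n. g n (Suc j)) + z * q ^ n * (\<Sum>j<n. g n j)) + g (Suc n) (Suc n)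
    = (g n 0 + (\<Sum>j<n. g n (Suc j))) + z * q ^ n * ((\<Sum>j<n. g n j) + g n n)"
    unfolding last by (simp add: g_def qbin_0[OF q] algebra_simps)
  also have "g n 0 + (\<Sum>j<n. g n (Suc j)) = (\<Sum>j\<le>n. g n j)" by (simp only: sum.atMost_shift)
  also have "(\<Sum>j<n. g n j) + g n n = (\<Sum>j\<le>n. g n j)" by (simp flip: lessThan_Suc_atMost)
  finally show ?case using Suc.IH unfolding g_def by (simp add: algebra_simps)
qed

lemma tri_eq: "2 * int (tri i) = i * (i - 1)"
proof -
  have "even (i * (i - 1))" by auto
  moreover have "i * (i - 1) \<ge> 0" by (metis mult_nonneg_nonneg mult_nonpos_nonpos diff_ge_0_iff_ge
      int_one_le_iff_zero_less linorder_not_less order_less_imp_le diff_le_0_iff_le zle_diff1_eq)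
  ultimately show ?thesis unfolding tri_def by simp
qed

text \<open>The factors \<open>1 - q ^ Suc k\<close> of the usual triple product are left out; they
  reappear as the division by \<open>euler q\<close> in the limit.\<close>

definition jfac :: "'a::{real_normed_field,banach} \<Rightarrow> 'a \<Rightarrow> nat \<Rightarrow> 'a" where
  "jfac q x N = (\<Prod>k<N. (1 + x * q ^ k) * (1 + q ^ Suc k / x))"

lemma prod_lessThan_add:
  fixes f :: "nat \<Rightarrow> 'a::comm_monoid_mult"
  shows "(\<Prod>k<n + m. f k) = (\<Prod>k<n. f k) * (\<Prod>k<m. f (n + k))"
  by (induction m) (simp_all add: mult.assoc)

text \<open>The q-binomial theorem of length 2N at \<open>z = x / q ^ N\<close>: the last N factors
  are \<open>1 + x * q ^ k\<close>, and the first N, with \<open>x / q ^ Suc k\<close> pulled out,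
  become \<open>1 + q ^ Suc k / x\<close>. The identity is exact for every N.\<close>

lemma finite_jacobi:
  assumes q: "norm q < 1" "q \<noteq> 0" and x: "x \<noteq> 0"
  shows "jfac q x N = (\<Sum>i\<in>{- int N..int N}. qbin q (2 * N) (nat (int N + i)) * q ^ tri i
      * x powi i)"
proof -
  have tr: "2 * (\<Sum>k<N. Suc k) = N * Suc N" by (induction N) auto
  define T where "T = (\<Sum>k<N. Suc k)"
  have "(\<Prod>k<2*N. 1 + x / q ^ N * q ^ k) = (\<Prod>k<N. 1 + x / q ^ N * q ^ k) * (\<Prod>k<N. 1 + x / q ^ N
      * q ^ (N + k))"
    using prod_lessThan_add[of "\<lambda>k. 1 + x / q ^ N * q ^ k" N N] by (simp only: mult_2)
  also have "(\<Prod>k<N. 1 + x / q ^ N * q ^ (N + k)) = (\<Prod>k<N. 1 + x * q ^ k)"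
    using q by (simp add: power_add)
  also have "(\<Prod>k<N. 1 + x / q ^ N * q ^ k) = (\<Prod>k<N. 1 + x / q ^ Suc k)"
  proof (subst prod.nat_diff_reindex[symmetric], rule prod.cong)
    fix k assume "k \<in> {..<N}"
    then have "q ^ N = q ^ (N - Suc k) * q ^ Suc k" using power_add[of q "N - Suc k" "Suc k"]
        by simp
    then show "1 + x / q ^ N * q ^ (N - Suc k) = 1 + x / q ^ Suc k" using q
        by (simp add: field_simps)
  qed simp
  also have "(\<Prod>k<N. 1 + x / q ^ Suc k) = (\<Prod>k<N. x / q ^ Suc k * (1 + q ^ Suc k / x))"
    using q x by (intro prod.cong) (auto simp: field_simps)
  also have "\<dots> = x ^ N / q ^ T * (\<Prod>k<N. 1 + q ^ Suc k / x)"
    by (simp add: prod.distrib prod_dividef T_def power_sum del: power_Suc)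
  finally have 1: "(\<Prod>k<2*N. 1 + x / q ^ N * q ^ k) = x ^ N / q ^ T * jfac q x N"
    by (simp add: jfac_def prod.distrib mult_ac del: power_Suc)
  have "jfac q x N = q ^ T / x ^ N * (\<Sum>j\<le>2*N. qbin q (2*N) j * q ^ (j * (j - 1) div 2) * (x
      / q ^ N) ^ j)"
    unfolding qbinomial_theorem[OF q(1), symmetric] 1 using q x by (simp add: field_simps)
  also have "\<dots> = (\<Sum>j\<le>2*N. qbin q (2*N) j * q ^ tri (int j - int N) * x powi (int j - int N))"
    unfolding sum_distrib_left
  proof (rule sum.cong)
    fix j assume "j \<in> {..2*N}"
    have "even (j * (j - 1))" by (cases j) auto
    then have "2 * (j * (j - 1) div 2) = j * (j - 1)" by (rule dvd_mult_div_cancel)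
    moreover define h where "h = j * (j - 1) div 2"
    ultimately have "2 * h = j * (j - 1)" by simp
    then have "2 * int h = int j * (int j - 1)"
        by (cases j) (auto simp: algebra_simps simp flip: of_nat_mult of_nat_add)
    moreover have "2 * int T = int N * (int N + 1)" using arg_cong[OF tr, of int]
        by (simp add: T_def algebra_simps)
    \<comment> \<open>Completing the square: centring the index at N absorbs the power
      \<open>q ^ T\<close> pulled out of the first N factors.\<close>
    ultimately have "2 * int (T + h) = 2 * int (tri (int j - int N) + N * j)"
      using tri_eq[of "int j - int N"] by (simp add: algebra_simps)
    then have "T + h = tri (int j - int N) + N * j"
        by (simp only: mult_cancel_left of_nat_eq_iff) simp
    then have a: "q ^ T * q ^ (j * (j - 1) div 2) = q ^ tri (int j - int N) * q ^ (N * j)"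
      unfolding h_def by (metis power_add)
    have b: "x powi (int j - int N) = x ^ j / x ^ N" using x by (simp add: power_int_diff)
    have c: "q ^ (N*j) \<noteq> 0" using q by simp
    have "q ^ T / x ^ N * (qbin q (2*N) j * q ^ (j * (j - 1) div 2) * (x / q ^ N) ^ j)
      = (q ^ T * q ^ (j * (j - 1) div 2)) / q ^ (N * j) * qbin q (2*N) j * (x ^ j / x ^ N)"
      by (simp add: power_divide power_mult mult_ac)
    also have "\<dots> = qbin q (2*N) j * q ^ tri (int j - int N) * x powi (int j - int N)"
      unfolding a b using c by simp
    finally show "q ^ T / x ^ N * (qbin q (2*N) j * q ^ (j * (j - 1) div 2) * (x / q ^ N) ^ j)
        = qbin q (2*N) j * q ^ tri (int j - int N) * x powi (int j - int N)" .
  qed simp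
  also have "\<dots> = (\<Sum>i\<in>{- int N..int N}. qbin q (2 * N) (nat (int N + i)) * q ^ tri i * x powi i)"
    by (rule sum.reindex_bij_witness[of _ "\<lambda>i. nat (int N + i)" "\<lambda>j. int j - int N"]) auto
  finally show ?thesis .
qed

text \<open>Dominated convergence for sums over growing symmetric windows. The enumeration
  \<open>int_decode\<close> reduces it to Tannery's theorem over the naturals; the finite support of
  \<open>f N\<close> makes the order of summation harmless.\<close>

lemma tannery_int:
  fixes f :: "nat \<Rightarrow> int \<Rightarrow> 'a::{real_normed_field,banach}"
  assumes lim: "\<And>i. (\<lambda>N. f N i) \<longlonglongrightarrow> g i"
    and bd: "\<And>N i. norm (f N i) \<le> M i" and M: "M summable_on UNIV"
    and fin: "\<And>N i. int N < \<bar>i\<bar> \<Longrightarrow> f N i = 0"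
  shows "(\<lambda>i. norm (g i)) summable_on UNIV"
    and "(\<lambda>N. \<Sum>i\<in>{- int N..int N}. f N i) \<longlonglongrightarrow> infsum g UNIV"
proof -
  have gM: "norm (g i) \<le> M i" for i
    by (rule LIMSEQ_le_const2[OF tendsto_norm[OF lim]]) (use bd in auto)
  show sg: "(\<lambda>i. norm (g i)) summable_on UNIV"
    by (rule Infinite_Sum.abs_summable_on_comparison_test'[OF M]) (use gM in auto)
  have "(M \<circ> int_decode) summable_on UNIV"
    using M by (subst summable_on_reindex[symmetric]) (auto simp: inj_int_decode surj_int_decode)
  then have sM: "summable (\<lambda>k. M (int_decode k))" by (simp add: summable_on_imp_summable o_def)
  have t: "(\<lambda>N. \<Sum>k. f N (int_decode k)) \<longlonglongrightarrow> (\<Sum>k. g (int_decode k))"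
    using tannerys_theorem[of "\<lambda>k N. f N (int_decode k)" "\<lambda>k. g (int_decode k)" sequentially "\<lambda>k.
        M (int_decode k)"]
      lim bd sM by (simp add: case_prod_unfold)
  have conv: "(\<Sum>k. h (int_decode k)) = infsum h UNIV" if "(h has_sum s) UNIV"
      for h :: "int \<Rightarrow> 'a" and s
  proof -
    have "((\<lambda>k. h (int_decode k)) has_sum s) UNIV"
      using that by (subst has_sum_reindex_bij_betw[OF bij_int_decode])
    from has_sum_imp_sums[OF this] show ?thesis using that by (simp add: infsumI sums_iff)
  qed
  have "(f N has_sum (\<Sum>i\<in>{- int N..int N}. f N i)) UNIV" for N
    by (rule has_sum_finite_neutralI[of "{- int N..int N}"]) (auto intro!: fin)
  then have 1: "(\<Sum>k. f N (int_decode k)) = (\<Sum>i\<in>{- int N..int N}. f N i)" for N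
    using conv[of "f N"] by (metis infsumI)
  have 2: "(\<Sum>k. g (int_decode k)) = infsum g UNIV"
    by (rule conv[OF has_sum_infsum]) (use sg abs_summable_summable in blast)
  show "(\<lambda>N. \<Sum>i\<in>{- int N..int N}. f N i) \<longlonglongrightarrow> infsum g UNIV"
    using t unfolding 1 2 .
qed

text \<open>\<open>qpoch q\<close> converges to a nonzero limit, so it and its inverse are bounded.
  The constant is uniform in n and k and supplies the majorant for Tannery's theorem.\<close>

lemma qbin_bound:
  fixes q :: "'a::{real_normed_field,banach}"
  assumes q: "norm q < 1"
  obtains C where "\<And>n k. norm (qbin q n k) \<le> C" "C > 0"
proof -
  have "Bseq (qpoch q)" using qpoch_tendsto[OF q] by (meson convergentI convergent_imp_Bseq)
  then obtain C where C: "C > 0" "\<And>n. norm (qpoch q n) \<le> C" by (auto simp: Bseq_def)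
  have "Bseq (\<lambda>n. inverse (qpoch q n))"
    using tendsto_inverse[OF qpoch_tendsto[OF q] euler_nz[OF q]]
        by (meson convergentI convergent_imp_Bseq)
  then obtain D where D: "D > 0" "\<And>n. norm (inverse (qpoch q n)) \<le> D" by (auto simp: Bseq_def)
  have "norm (qbin q n k) \<le> C * (D * D)" for n k
  proof -
    have "norm (qbin q n k) = norm (qpoch q n) * (norm (inverse (qpoch q k))
        * norm (inverse (qpoch q (n - k))))"
      by (simp add: qbin_def norm_divide norm_mult norm_inverse divide_inverse)
    also have "\<dots> \<le> C * (D * D)"
      by (intro mult_mono C D) (auto intro!: mult_nonneg_nonneg less_imp_le[OF C(1)]
          less_imp_le[OF D(1)])
    finally show ?thesis .
  qed
  then show ?thesis using that[of "C * (D * D)"] C D by simp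
qed

lemma qbin_tendsto:
  fixes q :: "'a::{real_normed_field,banach}"
  assumes q: "norm q < 1"
  shows "(\<lambda>N. qbin q (2 * N) (nat (int N + i))) \<longlonglongrightarrow> 1 / euler q"
proof -
  have a: "filterlim (\<lambda>N. nat (int N + j)) at_top sequentially" for j
    unfolding filterlim_at_top
  proof
    fix Z show "\<forall>\<^sub>F N in sequentially. Z \<le> nat (int N + j)"
      using eventually_ge_at_top[of "Z + nat (- j)"] by eventually_elim auto
  qed
  have b: "filterlim (\<lambda>N::nat. 2 * N) at_top sequentially"
    by (rule filterlim_subseq) (simp add: strict_mono_def)
  have "(\<lambda>N. qpoch q (2 * N) / (qpoch q (nat (int N + i)) * qpoch q (nat (int N + (- i)))))
      \<longlonglongrightarrow> euler q / (euler q * euler q)"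
    by (intro tendsto_intros filterlim_compose[OF qpoch_tendsto[OF q]] a b)
        (use euler_nz[OF q] in auto)
  moreover have "\<forall>\<^sub>F N in sequentially. qpoch q (2 * N) / (qpoch q (nat (int N + i))
      * qpoch q (nat (int N + (- i)))) = qbin q (2 * N) (nat (int N + i))"
    using eventually_ge_at_top[of "nat \<bar>i\<bar>"]
  proof eventually_elim
    case (elim N)
    then have "2 * N - nat (int N + i) = nat (int N + (- i))" by linarith
    then show ?case by (simp add: qbin_def)
  qed
  ultimately show ?thesis using euler_nz[OF q] by (simp add: filterlim_cong)
qed

section \<open>Bilateral theta series: summability and passage to the limit\<close>

lemma summable_on_int_split:
  fixes h :: "int \<Rightarrow> real"
  assumes "(\<lambda>n. h (int n)) summable_on UNIV" "(\<lambda>n. h (- int n)) summable_on UNIV"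
  shows "h summable_on UNIV"
proof -
  have "h summable_on range int" using assms(1) by (subst summable_on_reindex) (auto simp: o_def)
  moreover have "h summable_on range (\<lambda>n. - int n)" using assms(2)
      by (subst summable_on_reindex) (auto simp: o_def inj_def)
  moreover have "UNIV = range int \<union> range (\<lambda>n. - int n)"
  proof -
    have "i \<in> range int \<union> range (\<lambda>n. - int n)" for i by (cases i rule: int_cases2) auto
    then show ?thesis by auto
  qed
  ultimately show ?thesis using summable_on_union by metis
qed

text \<open>The weight \<open>Suc n\<close> is carried along for the derivative series in
  \<open>jacobi_cube\<close>. Consecutive terms have quotient at most
  \<open>2 * (r ^ n * y)\<close>, which tends to 0.\<close>

lemma summable_theta_nat:
  fixes r y :: real
  assumes "0 < r" "r < 1" "0 < y"
  shows "(\<lambda>n. real (Suc n) * (r ^ tri (int n) * y ^ n)) summable_on UNIV"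
proof (rule norm_summable_imp_summable_on)
  let ?f = "\<lambda>n. real (Suc n) * (r ^ tri (int n) * y ^ n)"
  have tr: "tri (int (Suc n)) = tri (int n) + n" for n
    using tri_eq[of "int n"] tri_eq[of "int (Suc n)"] by (simp add: algebra_simps)
  have "(\<lambda>n. 2 * (r ^ n * y)) \<longlonglongrightarrow> 2 * (0 * y)"
    by (intro tendsto_intros LIMSEQ_realpow_zero) (use assms in auto)
  then have "\<forall>\<^sub>F n in sequentially. 2 * (r ^ n * y) < 1/2"
      by (intro order_tendstoD(2)[where y = "2 * (0 * y)"]) auto
  then obtain N where N: "\<And>n. n \<ge> N \<Longrightarrow> 2 * (r ^ n * y) < 1/2" by (auto simp: eventually_sequentially)
  show "summable (\<lambda>n. norm (?f n))"
  proof (rule summable_ratio_test[of "1/2" N])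
    fix n assume "n \<ge> N"
    have "?f (Suc n) = real (Suc (Suc n)) * (r ^ tri (int n) * y ^ n) * (r ^ n * y)"
      unfolding tr by (simp add: power_add)
    also have "\<dots> \<le> (2 * real (Suc n)) * (r ^ tri (int n) * y ^ n) * (r ^ n * y)"
      by (intro mult_right_mono) (use assms in auto)
    also have "\<dots> = (2 * (r ^ n * y)) * ?f n" by simp
    also have "\<dots> \<le> 1/2 * ?f n"
      by (intro mult_right_mono less_imp_le[OF N]) (use assms \<open>n \<ge> N\<close> in auto)
    finally have "?f (Suc n) \<le> 1/2 * ?f n" .
    moreover have "?f n \<ge> 0" for n using assms by auto
    ultimately show "norm (norm (?f (Suc n))) \<le> 1/2 * norm (norm (?f n))"
        by (simp only: norm_of_real real_norm_def abs_of_nonneg)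
  qed simp
qed

lemma summable_theta_int:
  fixes r y :: real
  assumes "0 < r" "r < 1" "0 < y"
  shows "(\<lambda>i. (1 + \<bar>real_of_int i\<bar>) * (r ^ tri i * y powi i)) summable_on UNIV"
proof (rule summable_on_int_split)
  show "(\<lambda>n. (1 + \<bar>real_of_int (int n)\<bar>) * (r ^ tri (int n) * y powi int n)) summable_on UNIV"
    using summable_theta_nat[OF assms] by (simp add: add.commute)
  \<comment> \<open>The negative half is the positive half with y replaced by
    \<open>r / y\<close>.\<close>
  have tr: "tri (- int n) = tri (int n) + n" for n
    using tri_eq[of "int n"] tri_eq[of "- int n"] by (simp add: algebra_simps)
  have "(\<lambda>n. real (Suc n) * (r ^ tri (int n) * (r / y) ^ n)) summable_on UNIV"
    by (rule summable_theta_nat) (use assms in auto)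
  then show "(\<lambda>n. (1 + \<bar>real_of_int (- int n)\<bar>) * (r ^ tri (- int n)
      * y powi (- int n))) summable_on UNIV"
    by (simp add: tr power_add power_divide power_int_minus field_simps)
qed

text \<open>Each Gaussian binomial weight tends to \<open>1 / euler q\<close>. The lemma serves
  twice: for the triple product itself, and for its derivative at \<open>x = -1\<close> in
  \<open>jacobi_cube\<close>.\<close>

lemma qbin_sum_tendsto:
  fixes q :: "'a::{real_normed_field,banach}"
  assumes q: "norm q < 1" and t: "(\<lambda>i. norm (t i)) summable_on UNIV"
  shows "(\<lambda>N. \<Sum>i\<in>{- int N..int N}. qbin q (2 * N) (nat (int N + i)) * t i) \<longlonglongrightarrow> infsum t UNIV
      / euler q"
proof -
  obtain C where C: "\<And>n k. norm (qbin q n k) \<le> C" "C > 0" using qbin_bound[OF q] by metis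
  define f where "f N i = (if \<bar>i\<bar> \<le> int N then qbin q (2*N) (nat (int N + i)) * t i else 0)" for N i
  have "(\<lambda>N. \<Sum>i\<in>{- int N..int N}. f N i) \<longlonglongrightarrow> infsum (\<lambda>i. 1 / euler q * t i) UNIV"
  proof (rule tannery_int(2)[where M = "\<lambda>i. C * norm (t i)"])
    show "(\<lambda>N. f N i) \<longlonglongrightarrow> 1 / euler q * t i" for i
    proof (rule Lim_transform_eventually)
      show "(\<lambda>N. qbin q (2*N) (nat (int N + i)) * t i) \<longlonglongrightarrow> 1 / euler q * t i"
        by (intro tendsto_intros qbin_tendsto q)
      show "\<forall>\<^sub>F N in sequentially. qbin q (2*N) (nat (int N + i)) * t i = f N i"
        using eventually_ge_at_top[of "nat \<bar>i\<bar>"] by eventually_elim (auto simp: f_def)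
    qed
    show "norm (f N i) \<le> C * norm (t i)" for N i
      using C(1)[of "2*N" "nat (int N + i)"] C(2)
          by (auto simp: f_def norm_mult intro!: mult_right_mono)
    show "(\<lambda>i. C * norm (t i)) summable_on UNIV"
      by (intro summable_on_cmult_right t)
    show "int N < \<bar>i\<bar> \<Longrightarrow> f N i = 0" for N i by (auto simp: f_def)
  qed
  also have "(\<lambda>N. \<Sum>i\<in>{- int N..int N}. f N i) = (\<lambda>N. \<Sum>i\<in>{- int N..int N}. qbin q (2
      * N) (nat (int N + i)) * t i)"
    by (intro ext sum.cong) (auto simp: f_def)
  also have "infsum (\<lambda>i. 1 / euler q * t i) UNIV = infsum t UNIV / euler q"
    by (subst infsum_cmult_right') simp
  finally show ?thesis .
qed

theorem jacobi_triple_product: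
  fixes q x :: "'a::{real_normed_field,banach}"
  assumes q: "norm q < 1" "q \<noteq> 0" and x: "x \<noteq> 0"
  shows "(\<lambda>i. norm (q ^ tri i * x powi i)) summable_on UNIV"
    and "jfac q x \<longlonglongrightarrow> infsum (\<lambda>i. q ^ tri i * x powi i) UNIV / euler q"
proof -
  have s: "(\<lambda>i. (1 + \<bar>real_of_int i\<bar>) * (norm q ^ tri i * norm x powi i)) summable_on UNIV"
    by (rule summable_theta_int) (use q x in auto)
  show s': "(\<lambda>i. norm (q ^ tri i * x powi i)) summable_on UNIV"
    by (rule Infinite_Sum.abs_summable_on_comparison_test'[OF s])
       (auto simp: norm_mult norm_power norm_power_int algebra_simps intro!: mult_nonneg_nonneg)
  show "jfac q x \<longlonglongrightarrow> infsum (\<lambda>i. q ^ tri i * x powi i) UNIV / euler q"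
    using qbin_sum_tendsto[OF q(1) s'] by (simp add: finite_jacobi[OF q x, abs_def] mult.assoc)
qed

text \<open>Both sides of the finite triple product vanish at \<open>x = -1\<close>; comparing
  derivatives there gives Jacobi's series for the cube.\<close>

lemma jacobi_cube:
  fixes q :: real
  assumes q: "\<bar>q\<bar> < 1" "q \<noteq> 0"
  shows "((\<lambda>i. (real_of_int i * (-1) powi (i - 1)) * q ^ tri i) has_sum euler q ^ 3) UNIV"
proof -
  have q': "norm q < 1" using q by simp
  let ?t = "\<lambda>i. (real_of_int i * (-1) powi (i - 1)) * q ^ tri i"
  let ?S = "\<lambda>N. \<Sum>i\<in>{- int N..int N}. qbin q (2 * N) (nat (int N + i)) * ?t i"
  have s: "(\<lambda>i. (1 + \<bar>real_of_int i\<bar>) * (norm q ^ tri i * 1 powi i)) summable_on UNIV"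
    by (rule summable_theta_int) (use q in auto)
  have s': "(\<lambda>i. norm (?t i)) summable_on UNIV"
    by (rule Infinite_Sum.abs_summable_on_comparison_test'[OF s])
       (auto simp: norm_mult norm_power abs_mult power_abs power_int_abs intro!: mult_right_mono)
  have 1: "(\<lambda>N. ?S (Suc N)) \<longlonglongrightarrow> infsum ?t UNIV / euler q"
    by (rule LIMSEQ_Suc[OF qbin_sum_tendsto[OF q' s']])
  have 2: "?S (Suc N) = qpoch q N * qpoch q (Suc N)" for N
  proof -
    \<comment> \<open>Only the factor \<open>1 + x\<close>, from k = 0, vanishes at -1.
      \<open>G\<close> is the product without it, so the derivative there is \<open>G (-1)\<close>;
      the length \<open>Suc N\<close> guarantees that this factor is present.\<close>
    define G where "G x = (\<Prod>k<N. 1 + x * q ^ Suc k) * (\<Prod>k<Suc N. 1 + q ^ Suc k / x)" for x :: real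
    have J: "jfac q x (Suc N) = G x * (x - (-1))" for x
      unfolding jfac_def G_def prod.distrib by (subst prod.lessThan_Suc_shift, cases "x
          = 0") (simp_all add: field_simps)
    have "isCont G (-1)" unfolding G_def by (intro continuous_intros) auto
    then have "((\<lambda>x. jfac q x (Suc N)) has_real_derivative G (-1)) (at (-1))"
      unfolding CARAT_DERIV by (intro exI[of _ G]) (simp add: J)
    moreover have "((\<lambda>x. jfac q x (Suc N)) has_real_derivative ?S (Suc N)) (at (-1))"
    proof (rule has_field_derivative_transform_within_open[where S = "- {0}"])
      show "((\<lambda>x. \<Sum>i\<in>{- int (Suc N)..int (Suc N)}. qbin q (2 * Suc N) (nat (int (Suc N) + i))
          * q ^ tri i * x powi i) has_real_derivative
         ?S (Suc N)) (at (-1))"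
        by (rule derivative_eq_intros refl | simp)+ (auto intro!: sum.cong)
    qed (use finite_jacobi[OF q' q(2)] in \<open>auto simp del: of_nat_Suc\<close>)
    ultimately have "?S (Suc N) = G (-1)" by (rule DERIV_unique[symmetric])
    then show ?thesis by (simp add: G_def qpoch_def)
  qed
  have "(\<lambda>N. qpoch q N * qpoch q (Suc N)) \<longlonglongrightarrow> euler q * euler q"
    by (intro tendsto_intros qpoch_tendsto q' LIMSEQ_Suc)
  then have "infsum ?t UNIV / euler q = euler q * euler q"
    using 1 unfolding 2 using LIMSEQ_unique by blast
  then have "infsum ?t UNIV = euler q ^ 3" using euler_nz[OF q']
      by (simp add: field_simps power3_eq_cube)
  moreover have "?t summable_on UNIV" by (rule Infinite_Sum.abs_summable_summable[OF s'])
  ultimately show ?thesis using has_sum_infsum by metis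
qed

section \<open>Theta functions and their products\<close>

text \<open>Dissection along two injections whose ranges partition the index set. The parity
  dissections of lattice sums below are instances of it.\<close>

lemma has_sum_split2:
  fixes f :: "'b \<Rightarrow> 'a::{real_normed_field,banach}" and g1 g2 :: "'c \<Rightarrow> 'b"
  assumes f: "(f has_sum S) UNIV" and g: "inj g1" "inj g2" "\<And>x y. g1 x \<noteq> g2 y" "\<And>y. (\<exists>x. y
      = g1 x) \<or> (\<exists>x. y = g2 x)"
  obtains S1 S2 where "((\<lambda>x. f (g1 x)) has_sum S1) UNIV" "((\<lambda>x. f (g2 x)) has_sum S2) UNIV" "S
      = S1 + S2"
proof -
  have sm: "f summable_on A" for A
    using summable_on_subset_banach[OF has_sum_imp_summable[OF f]] by simp
  obtain S1 S2 where s: "(f has_sum S1) (range g1)" "(f has_sum S2) (range g2)"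
    using sm unfolding summable_on_def by blast
  have "range g1 \<inter> range g2 = {}" using g(3) by auto
  moreover have "range g1 \<union> range g2 = UNIV" using g(4) by (simp add: set_eq_iff image_iff)
  ultimately have "S = S1 + S2" using has_sum_Un_disjoint[OF s] f has_sum_unique by metis
  moreover have "((\<lambda>x. f (g1 x)) has_sum S1) UNIV" "((\<lambda>x. f (g2 x)) has_sum S2) UNIV"
    using s has_sum_reindex[OF g(1), of f] has_sum_reindex[OF g(2), of f] by (simp_all add: o_def)
  ultimately show ?thesis using that by blast
qed

text \<open>The form in which the triple product is applied: the limit \<open>L\<close> of the
  product side is found by hand as an expression in \<open>euler\<close>, and the series
  follows.\<close>

lemma theta_sum:
  fixes q x :: "'a::{real_normed_field,banach}"
  assumes q: "norm q < 1" "q \<noteq> 0" and x: "x \<noteq> 0" and L: "jfac q x \<longlonglongrightarrow> L"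
  shows "((\<lambda>i. q ^ tri i * x powi i) has_sum (L * euler q)) UNIV"
proof -
  have "L = infsum (\<lambda>i. q ^ tri i * x powi i) UNIV / euler q"
    using jacobi_triple_product(2)[OF q x] L LIMSEQ_unique by blast
  then have "L * euler q = infsum (\<lambda>i. q ^ tri i * x powi i) UNIV" using euler_nz[OF q(1)] by simp
  then show ?thesis using jacobi_triple_product(1)[OF q x] abs_summable_summable has_sum_infsum
      by metis
qed

section \<open>Products over residue classes, theta constants, pentagonal numbers\<close>

lemma qpoch_even: "qpoch q (2 * n) = (\<Prod>k<n. 1 - q ^ (2 * k + 1)) * qpoch (q\<^sup>2) n"
proof (induction n)
  case (Suc n)
  have "2 * Suc n = Suc (Suc (2 * n))" by simp
  then have "qpoch q (2 * Suc n) = qpoch q (2 * n) * (1 - q ^ (2 * n + 1)) * (1 - q ^ (2 * Suc n))"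
    by (simp only: qpoch_Suc) simp
  then show ?case unfolding Suc.IH by (simp add: qpoch_Suc power_mult[symmetric] mult_ac del:
      power_Suc mult_Suc_right)
qed simp

lemma qpoch_triple: "qpoch q (3 * n) = (\<Prod>k<n. (1 - q ^ (3 * k + 1)) * (1 - q ^ (3 * k + 2)))
    * qpoch (q ^ 3) n"
proof (induction n)
  case (Suc n)
  have "3 * Suc n = Suc (Suc (Suc (3 * n)))" by simp
  then have "qpoch q (3 * Suc n) = qpoch q (3 * n) * ((1 - q ^ (3 * n + 1)) * (1 - q ^ (3 * n
      + 2))) * (1 - q ^ (3 * Suc n))"
    by (simp only: qpoch_Suc) (simp add: mult_ac)
  then show ?case unfolding Suc.IH by (simp add: qpoch_Suc power_mult[symmetric] mult_ac del:
      power_Suc mult_Suc_right)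
qed simp

lemma powi_of_power: "q \<noteq> 0 \<Longrightarrow> (q ^ n) ^ t = q powi (int n * int t)" for q :: "'a::field"
  by (simp add: power_int_mult)

lemma odd_prod_tendsto:
  fixes q :: "'a::{real_normed_field,banach}"
  assumes q: "norm q < 1"
  shows "(\<lambda>n. \<Prod>k<n. 1 - q ^ (2 * k + 1)) \<longlonglongrightarrow> euler q / euler (q\<^sup>2)"
proof -
  have q2: "norm (q\<^sup>2) < 1" using norm_power_lt1[OF q] by simp
  have "(\<lambda>n. qpoch q (2 * n) / qpoch (q\<^sup>2) n) \<longlonglongrightarrow> euler q / euler (q\<^sup>2)"
    by (intro tendsto_intros qpoch_tendsto[OF q2] euler_nz[OF q2] filterlim_compose[OF
        qpoch_tendsto[OF q]] filterlim_subseq)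
       (simp add: strict_mono_def)
  then show ?thesis using qpoch_nz[OF q2] by (simp add: qpoch_even)
qed

lemma even_prod_tendsto:
  fixes q :: "'a::{real_normed_field,banach}"
  assumes q: "norm q < 1"
  shows "(\<lambda>n. \<Prod>k<n. 1 + q ^ Suc k) \<longlonglongrightarrow> euler (q\<^sup>2) / euler q"
proof -
  have q2: "norm (q\<^sup>2) < 1" using norm_power_lt1[OF q] by simp
  have *: "(\<Prod>k<n. 1 + q ^ Suc k) * qpoch q n = qpoch (q\<^sup>2) n" for n
  proof (induction n)
    case (Suc n)
    have "(1 + q ^ Suc n) * (1 - q ^ Suc n) = 1 - (q\<^sup>2) ^ Suc n"
      by (simp only: power_mult[symmetric] mult_2 power_add) (simp add: algebra_simps)
    then show ?case by (simp add: qpoch_Suc mult_ac flip: Suc.IH del: power_Suc)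
  qed simp
  have "(\<lambda>n. qpoch (q\<^sup>2) n / qpoch q n) \<longlonglongrightarrow> euler (q\<^sup>2) / euler q"
    by (intro tendsto_intros qpoch_tendsto q q2 euler_nz)
  then show ?thesis using qpoch_nz[OF q] by (simp flip: *)
qed

text \<open>The odd-exponent products at q and -q multiply to the odd-exponent product at
  \<open>q ^ 2\<close>; the limits of both sides are compared. This lets theta constants at -q be
  written through \<open>euler\<close> at q, \<open>q ^ 2\<close> and \<open>q ^ 4\<close>.\<close>

lemma euler_minus:
  fixes q :: real
  assumes q: "\<bar>q\<bar> < 1"
  shows "euler (- q) = euler (q\<^sup>2) ^ 3 / (euler q * euler (q ^ 4))"
proof -
  have q2: "norm (q\<^sup>2) < 1" and q4: "norm (q ^ 4) < 1"
      using norm_power_lt1[of q 2] norm_power_lt1[of q 4] q by simp_all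
  have "(\<lambda>n. (\<Prod>k<n. 1 - q ^ (2 * k + 1)) * (\<Prod>k<n. 1 - (- q) ^ (2 * k + 1))) \<longlonglongrightarrow> euler q
      / euler (q\<^sup>2) * (euler (- q) / euler ((- q)\<^sup>2))"
    by (intro tendsto_intros odd_prod_tendsto) (use q in auto)
  also have "(\<lambda>n. (\<Prod>k<n. 1 - q ^ (2 * k + 1)) * (\<Prod>k<n. 1 - (- q) ^ (2 * k + 1))) = (\<lambda>n. \<Prod>k<n. 1
      - (q\<^sup>2) ^ (2 * k + 1))"
    by (intro ext, subst prod.distrib[symmetric]) (simp add: algebra_simps power_add[symmetric]
        power_mult[symmetric] power2_eq_square mult_2_right mult_2)
  finally have "euler q / euler (q\<^sup>2) * (euler (- q) / euler ((- q)\<^sup>2)) = euler (q\<^sup>2)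
      / euler ((q\<^sup>2)\<^sup>2)"
    using odd_prod_tendsto[OF q2] LIMSEQ_unique by blast
  moreover have "(q\<^sup>2)\<^sup>2 = q ^ 4" by simp
  ultimately show ?thesis using euler_nz[of q] euler_nz[OF q2] euler_nz[OF q4] q
    by (simp add: field_simps power3_eq_cube power2_eq_square)
qed

text \<open>\<open>thA\<close> is \<open>\<Sum> q^(n^2)\<close> and \<open>thB\<close> is
  \<open>\<Sum> q^(n^2 + n)\<close> over all integers, i.e. \<open>q^(-1/4)\<close> times the theta
  constant \<open>\<theta>\<^sub>2\<close>.\<close>

definition thA :: "real \<Rightarrow> real" where "thA q = euler (- q) ^ 2 / euler (q\<^sup>2)"
definition thB :: "real \<Rightarrow> real" where "thB q = 2 * euler (q ^ 4) ^ 2 / euler (q\<^sup>2)"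

text \<open>The triple product with base \<open>q ^ 2\<close> at \<open>x = q\<close>: both families
  of factors coincide, and \<open>2 * tri i + i\<close> is the square of i.\<close>

lemma thA_has_sum:
  assumes q: "\<bar>q\<bar> < 1" "q \<noteq> 0"
  shows "((\<lambda>i. q ^ nat (i\<^sup>2)) has_sum thA q) UNIV"
proof -
  have q2: "norm (q\<^sup>2) < 1" using norm_power_lt1[of q 2] q by simp
  have "jfac (q\<^sup>2) q = (\<lambda>N. (\<Prod>k<N. 1 - (- q) ^ (2 * k + 1)) * (\<Prod>k<N. 1 - (- q) ^ (2 * k + 1)))"
    unfolding jfac_def prod.distrib[symmetric]
    by (intro ext prod.cong) (use q in \<open>auto simp: power_mult power2_eq_square\<close>)
  moreover have "\<dots> \<longlonglongrightarrow> euler (- q) / euler ((- q)\<^sup>2) * (euler (- q) / euler ((- q)\<^sup>2))"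
    by (intro tendsto_intros odd_prod_tendsto) (use q in auto)
  ultimately have "((\<lambda>i. (q\<^sup>2) ^ tri i * q powi i) has_sum (euler (- q) / euler ((- q)\<^sup>2)
      * (euler (- q) / euler ((- q)\<^sup>2)) * euler (q\<^sup>2))) UNIV"
    by (intro theta_sum q2) (use q in auto)
  moreover have "(q\<^sup>2) ^ tri i * q powi i = q ^ nat (i\<^sup>2)" for i
  proof -
    have "(q\<^sup>2) ^ tri i * q powi i = q powi (2 * int (tri i) + i)"
      using q by (simp add: powi_of_power power_int_add)
    also have "2 * int (tri i) + i = int (nat (i\<^sup>2))" using tri_eq[of i]
        by (simp add: algebra_simps power2_eq_square)
    finally show ?thesis by (simp only: power_int_of_nat)
  qed
  ultimately show ?thesis using euler_nz[OF q2] by (simp add: thA_def power2_eq_square)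
qed

lemma thB_has_sum:
  assumes q: "\<bar>q\<bar> < 1" "q \<noteq> 0"
  shows "((\<lambda>i. q ^ nat (i\<^sup>2 + i)) has_sum thB q) UNIV"
proof -
  have q2: "norm (q\<^sup>2) < 1" using norm_power_lt1[of q 2] q by simp
  let ?E = "euler ((q\<^sup>2)\<^sup>2) / euler (q\<^sup>2)"
  have "(\<lambda>N. 2 * (\<Prod>k<N. 1 + (q\<^sup>2) ^ Suc k)) \<longlonglongrightarrow> 2 * ?E"
    by (intro tendsto_intros even_prod_tendsto q2)
  \<comment> \<open>At \<open>x = q ^ 2\<close> the second family of factors starts with
    \<open>1 + 1\<close>; this is the 2 in \<open>thB\<close>.\<close>
  moreover have "2 * (\<Prod>k<N. 1 + (q\<^sup>2) ^ Suc k) = (\<Prod>k<Suc N. 1 + (q\<^sup>2) ^ k)" for N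
    by (subst prod.lessThan_Suc_shift) simp
  ultimately have "(\<lambda>N. \<Prod>k<Suc N. 1 + (q\<^sup>2) ^ k) \<longlonglongrightarrow> 2 * ?E" by simp
  then have 1: "(\<lambda>N. \<Prod>k<N. 1 + (q\<^sup>2) ^ k) \<longlonglongrightarrow> 2 * ?E" by (subst (asm) filterlim_sequentially_Suc)
  have "jfac (q\<^sup>2) (q\<^sup>2) = (\<lambda>N. (\<Prod>k<N. 1 + (q\<^sup>2) ^ Suc k) * (\<Prod>k<N. 1 + (q\<^sup>2) ^ k))"
    unfolding jfac_def prod.distrib[symmetric]
    by (intro ext prod.cong) (use q in auto)
  moreover have "\<dots> \<longlonglongrightarrow> ?E * (2 * ?E)"
    by (intro tendsto_intros even_prod_tendsto q2 1)
  ultimately have "((\<lambda>i. (q\<^sup>2) ^ tri i * (q\<^sup>2) powi i) has_sum (?E * (2 * ?E) * euler (q\<^sup>2))) UNIV"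
    by (intro theta_sum q2) (use q in auto)
  moreover have "(q\<^sup>2) ^ tri i * (q\<^sup>2) powi i = q ^ nat (i\<^sup>2 + i)" for i
  proof -
    have "(q\<^sup>2) ^ tri i * (q\<^sup>2) powi i = q powi (2 * int (tri i) + 2 * i)"
      using q powi_of_power[of q 2 "tri i"] by (simp add: power_int_add power_int_mult)
    also have "2 * int (tri i) + 2 * i = i\<^sup>2 + i" using tri_eq[of i]
        by (simp add: algebra_simps power2_eq_square)
    also have "\<dots> = int (nat (i\<^sup>2 + i))" using tri_eq[of "-i"]
        by (simp add: power2_eq_square algebra_simps)
    finally show ?thesis by (simp only: power_int_of_nat)
  qed
  moreover have "(q\<^sup>2)\<^sup>2 = q ^ 4" by simp
  moreover have "?E * (2 * ?E) * euler (q\<^sup>2) = thB q"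
    using euler_nz[OF q2] by (simp add: thB_def power2_eq_square[of "euler x" for x])
  ultimately show ?thesis by simp
qed

definition pent :: "int \<Rightarrow> nat" where "pent i = nat (i * (3 * i + 1) div 2)"

lemma pent_eq: "2 * int (pent i) = i * (3 * i + 1)"
proof -
  have "even (i * (3 * i + 1))" by auto
  moreover have "i * (3 * i + 1) = 2 * int (tri (- i)) + 2 * i\<^sup>2" using tri_eq[of "-i"]
      by (simp add: algebra_simps power2_eq_square)
  then have "i * (3 * i + 1) \<ge> 0" by simp
  ultimately show ?thesis unfolding pent_def by simp
qed

lemma euler_0 [simp]: "euler 0 = 1" by (simp add: euler_def)

text \<open>The triple product with base \<open>q ^ 3\<close> at \<open>x = -q\<close> has the
  exponents 1 and 2 modulo 3; multiplying by \<open>euler (q ^ 3)\<close> supplies the multiples of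
  3. The general field serves both the real lattice sums and the complex expansions; the point 0 is
  included for the latter.\<close>

lemma pentagonal:
  fixes q :: "'a::{real_normed_field,banach}"
  assumes q: "norm q < 1"
  shows "((\<lambda>i. (-1) ^ nat \<bar>i\<bar> * q ^ pent i) has_sum euler q) UNIV"
proof (cases "q = 0")
  case True
  have "pent i = 0 \<longleftrightarrow> i = 0" for i
  proof
    assume "pent i = 0"
    then have "i * (3 * i + 1) = 0" using pent_eq[of i] by simp
    then show "i = 0" unfolding mult_eq_0_iff by presburger
  qed (simp add: pent_def)
  then have "(0::'a) ^ pent i = (if i = 0 then 1 else 0)" for i by (simp add: power_0_left)
  then show ?thesis unfolding True
    by (intro has_sum_finite_neutralI[of "{0}"]) (auto simp: pent_def)
next
  case nz: False
  have q3: "norm (q ^ 3) < 1" using norm_power_lt1[of q 3] q by simp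
  have "jfac (q ^ 3) (- q) = (\<lambda>N. qpoch q (3 * N) / qpoch (q ^ 3) N)"
  proof
    fix N
    have "jfac (q ^ 3) (- q) N = (\<Prod>k<N. (1 - q ^ (3 * k + 1)) * (1 - q ^ (3 * k + 2)))"
      unfolding jfac_def
      by (intro prod.cong) (use nz in \<open>auto simp: power_mult power_add power3_eq_cube
          power2_eq_square\<close>)
    then show "jfac (q ^ 3) (- q) N = qpoch q (3 * N) / qpoch (q ^ 3) N"
      using qpoch_nz[OF q3] by (simp add: qpoch_triple)
  qed
  moreover have "(\<lambda>N. qpoch q (3 * N) / qpoch (q ^ 3) N) \<longlonglongrightarrow> euler q / euler (q ^ 3)"
    by (intro tendsto_intros qpoch_tendsto q3 euler_nz filterlim_compose[OF qpoch_tendsto[OF q]]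
        filterlim_subseq)
       (simp add: strict_mono_def)
  ultimately have "((\<lambda>i. (q ^ 3) ^ tri i * (- q) powi i) has_sum (euler q / euler (q ^ 3)
      * euler (q ^ 3))) UNIV"
    by (intro theta_sum q3) (use nz in auto)
  then have 1: "((\<lambda>i. (q ^ 3) ^ tri i * (- q) powi i) has_sum euler q) UNIV" using euler_nz[OF q3]
      by simp
  have "(q ^ 3) ^ tri (- i) * (- q) powi (- i) = (-1) ^ nat \<bar>i\<bar> * q ^ pent i" for i
  proof -
    have "(- q) powi (- i) = (-1) powi (- i) * q powi (- i)"
      using power_int_mult_distrib[of "-1" q "-i"] by simp
    moreover have "(-1::'a) powi (- i) = (-1) ^ nat \<bar>i\<bar>"
    proof -
      have "inverse ((-1::'a) ^ n) = (-1) ^ n" for n by (cases "even n") auto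
      then show ?thesis by (cases i rule: int_cases2) (auto simp: power_int_minus)
    qed
    moreover have "(q ^ 3) ^ tri (- i) * q powi (- i) = q powi (3 * int (tri (- i)) - i)"
      using nz by (simp add: powi_of_power power_int_diff power_int_minus divide_inverse)
    moreover have "3 * int (tri (- i)) - i = int (pent i)"
      using tri_eq[of "-i"] pent_eq[of i] by (simp add: algebra_simps)
    ultimately show ?thesis by (simp add: mult_ac)
  qed
  then show ?thesis
    using has_sum_reindex_bij_betw[OF bij_uminus, THEN iffD2, OF 1] by (simp only:)
qed

text \<open>The indices \<open>2 * j + 1\<close> and \<open>- 2 * j\<close> have the same triangular
  number, and their signed coefficients \<open>2 * j + 1\<close> and \<open>2 * j\<close> add up to
  \<open>4 * j + 1\<close>.\<close>

lemma jacobi_cube':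
  fixes q :: real
  assumes q: "\<bar>q\<bar> < 1" "q \<noteq> 0"
  shows "((\<lambda>i. (4 * real_of_int i + 1) * q ^ nat (2 * i\<^sup>2 + i)) has_sum euler q ^ 3) UNIV"
proof -
  let ?f = "\<lambda>i. (real_of_int i * (-1) powi (i - 1)) * q ^ tri i"
  obtain S1 S2 where s: "((\<lambda>j. ?f (2 * j + 1)) has_sum S1) UNIV" "((\<lambda>j. ?f (- 2 * j))
      has_sum S2) UNIV" "euler q ^ 3 = S1 + S2"
  proof (rule has_sum_split2[OF jacobi_cube[OF q], of "\<lambda>j. 2 * j + 1" "\<lambda>j. - 2 * j"])
    show "2 * x + 1 \<noteq> - 2 * y" for x y :: int by presburger
    show "(\<exists>x. y = 2 * x + 1) \<or> (\<exists>x. y = - 2 * x)" for y :: int by presburger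
  qed (auto simp: inj_def)
  have m: "(-1::real) powi (2 * j) = 1" "(-1::real) powi (- 2 * j - 1) = - 1" for j :: int
    by (simp_all add: power_int_mult power_int_diff)
  have "nat (2 * j\<^sup>2 + j) = tri (2 * j + 1)" "nat (2 * j\<^sup>2 + j) = tri (- 2 * j)" for j
    using tri_eq[of "2 * j + 1"] tri_eq[of "- 2 * j"]
        by (simp_all add: algebra_simps power2_eq_square)
  then have "?f (2 * j + 1) + ?f (- 2 * j) = (4 * real_of_int j + 1) * q ^ nat (2 * j\<^sup>2 + j)" for j
    using m[of j] by (simp add: algebra_simps)
  then show ?thesis using has_sum_add[OF s(1,2)] s(3) by simp
qed

section \<open>Products, grouping and differentiation of unconditional sums\<close>

lemma has_sum_times:
  fixes f :: "'i \<Rightarrow> real" and g :: "'j \<Rightarrow> real"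
  assumes f: "(f has_sum a) A" and g: "(g has_sum b) B"
  shows "((\<lambda>(x, y). f x * g y) has_sum (a * b)) (A \<times> B)"
proof (rule has_sum_SigmaI[where g = "\<lambda>x. f x * b"])
  show "((\<lambda>y. case (x, y) of (x, y) \<Rightarrow> f x * g y) has_sum f x * b) B" for x
    using has_sum_cmult_right[OF g] by simp
  show "((\<lambda>x. f x * b) has_sum a * b) A" by (rule has_sum_cmult_left[OF f])
  have f': "(\<lambda>x. norm (f x)) summable_on A" and g': "(\<lambda>x. norm (g x)) summable_on B"
    using has_sum_imp_summable[OF f] has_sum_imp_summable[OF g]
        summable_on_iff_abs_summable_on_real by blast+
  have "(\<lambda>z. norm (case z of (x, y) \<Rightarrow> f x * g y)) summable_on A \<times> B"
    unfolding Infinite_Sum.abs_summable_on_Sigma_iff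
  proof (intro conjI ballI)
    show "(\<lambda>y. norm (case (x, y) of (x, y) \<Rightarrow> f x * g y)) summable_on B" for x
      using summable_on_cmult_right[OF g'] by (simp add: abs_mult)
    have "(\<lambda>x. norm (f x) * infsum (\<lambda>y. norm (g y)) B) summable_on A"
      by (rule summable_on_cmult_left[OF f'])
    then show "(\<lambda>x. norm (\<Sum>\<^sub>\<infinity>y\<in>B. norm (case (x, y) of (x, y) \<Rightarrow> f x * g y))) summable_on A"
      using infsum_nonneg[of B "\<lambda>y. norm (g y)"] by (simp add: abs_mult infsum_cmult_right')
  qed
  then show "(\<lambda>(x, y). f x * g y) summable_on A \<times> B"
      by (rule summable_on_iff_abs_summable_on_real[THEN iffD2])
qed

text \<open>The passage from lattice sums to power series: terms of equal exponent are collected,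
  each fibre being finite.\<close>

lemma has_sum_group_power:
  fixes c :: "'i \<Rightarrow> 'a::{real_normed_field,banach}" and f :: "'i \<Rightarrow> nat"
  assumes s: "((\<lambda>i. c i * q ^ f i) has_sum S) I" and fin: "\<And>n. finite {i \<in> I. f i = n}"
  shows "(\<lambda>n. (\<Sum>i | i \<in> I \<and> f i = n. c i) * q ^ n) sums S"
proof (rule has_sum_imp_sums, rule has_sum_SigmaD)
  let ?B = "\<lambda>n. {i \<in> I. f i = n}"
  have "bij_betw snd (Sigma UNIV ?B) I" by (rule bij_betwI[where g = "\<lambda>i. (f i, i)"]) auto
  from has_sum_reindex_bij_betw[OF this, THEN iffD2, OF s]
  show "((\<lambda>z. c (snd z) * q ^ f (snd z)) has_sum S) (Sigma UNIV ?B)" .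
  show "((\<lambda>i. c (snd (n, i)) * q ^ f (snd (n, i))) has_sum (\<Sum>i | i \<in> I \<and> f i = n. c i)
      * q ^ n) (?B n)" for n
    by (rule has_sum_finiteI[OF fin]) (auto simp: sum_distrib_right intro!: sum.cong)
qed

text \<open>Grouping by exponent gives a power series, which is differentiated termwise. To return
  to the ungrouped sum, choose K between q and 1: since \<open>n * (q / K) ^ n\<close> is bounded,
  the weighted terms at q are dominated by the terms at K.\<close>

lemma has_sum_deriv:
  fixes c :: "'i \<Rightarrow> real" and f :: "'i \<Rightarrow> nat" and F :: "real \<Rightarrow> real"
  assumes F: "\<And>q. 0 < q \<Longrightarrow> q < 1 \<Longrightarrow> ((\<lambda>i. c i * q ^ f i) has_sum F q) I"
    and fin: "\<And>n. finite {i \<in> I. f i = n}" and q: "0 < q" "q < 1"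
  obtains F' where "(F has_real_derivative F') (at q)" "((\<lambda>i. c i * real (f i) * q ^ f i)
      has_sum q * F') I"
proof -
  define a where "a n = (\<Sum>i | i \<in> I \<and> f i = n. c i)" for n
  have sums: "(\<lambda>n. a n * x ^ n) sums F x" if "0 < x" "x < 1" for x
    unfolding a_def by (rule has_sum_group_power[OF F[OF that] fin])
  obtain K where K: "q < K" "K < 1" using q(2) dense by blast
  have "((\<lambda>x. \<Sum>n. a n * x ^ n) has_real_derivative (\<Sum>n. diffs a n * q ^ n)) (at q)"
    by (rule termdiffs_strong[of a K]) (use sums[of K] K q in \<open>auto simp: sums_iff\<close>)
  then have d: "(F has_real_derivative (\<Sum>n. diffs a n * q ^ n)) (at q)"
  proof (rule has_field_derivative_transform_within_open[where S = "{0<..<1}"])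
    show "\<And>x. x \<in> {0<..<1} \<Longrightarrow> (\<Sum>n. a n * x ^ n) = F x" using sums by (auto simp: sums_iff)
  qed (use q in auto)
  have sd: "summable (\<lambda>n. diffs a n * q ^ n)"
    by (rule termdiff_converges[of q K]) (use K q sums[of K] in \<open>auto simp: sums_iff intro:
        powser_inside[of a K]\<close>)
  have "(\<lambda>n. of_nat n * a n * q ^ (n - Suc 0)) sums (\<Sum>n. diffs a n * q ^ n)"
    using diffs_equiv[OF sd] .
  then have "(\<lambda>n. q * (of_nat n * a n * q ^ (n - Suc 0))) sums (q * (\<Sum>n. diffs a n * q ^ n))"
    by (rule sums_mult)
  moreover have "q * (of_nat n * a n * q ^ (n - Suc 0)) = real n * a n * q ^ n" for n
      by (cases n) auto
  ultimately have s1: "(\<lambda>n. real n * a n * q ^ n) sums (q * (\<Sum>n. diffs a n * q ^ n))" by simp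
  have "(\<lambda>n. real n * (q / K) ^ n) \<longlonglongrightarrow> 0"
    by (rule powser_times_n_limit_0) (use K q in auto)
  then have "Bseq (\<lambda>n. real n * (q / K) ^ n)" by (meson convergentI convergent_imp_Bseq)
  then obtain C where C: "C > 0" "\<And>n. \<bar>real n * (q / K) ^ n\<bar> \<le> C" by (auto simp: Bseq_def)
  have K0: "K > 0" using K q by simp
  have "((\<lambda>i. c i * K ^ f i)) summable_on I" using F[OF K0 K(2)] by (rule has_sum_imp_summable)
  then have "(\<lambda>i. norm (c i * K ^ f i)) summable_on I"
      by (rule summable_on_iff_abs_summable_on_real[THEN iffD1])
  then have sK: "(\<lambda>i. C * norm (c i * K ^ f i)) summable_on I" by (rule summable_on_cmult_right)
  have "(\<lambda>i. norm (c i * real (f i) * q ^ f i)) summable_on I"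
  proof (rule Infinite_Sum.abs_summable_on_comparison_test'[OF sK])
    fix i
    have "\<bar>c i\<bar> * K ^ f i * \<bar>real (f i) * (q / K) ^ f i\<bar> \<le> \<bar>c i\<bar> * K ^ f i * C"
      by (rule mult_left_mono[OF C(2)]) (use K0 in auto)
    then show "norm (c i * real (f i) * q ^ f i) \<le> C * norm (c i * K ^ f i)"
      using K0 q by (simp add: abs_mult power_divide field_simps)
  qed
  then have "(\<lambda>i. c i * real (f i) * q ^ f i) summable_on I"
      by (rule Infinite_Sum.abs_summable_summable)
  then obtain S where S: "((\<lambda>i. c i * real (f i) * q ^ f i) has_sum S) I"
      unfolding summable_on_def by blast
  from has_sum_group_power[OF this fin]
  have "(\<lambda>n. (\<Sum>i | i \<in> I \<and> f i = n. c i * real (f i)) * q ^ n) sums S" .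
  moreover have "(\<Sum>i | i \<in> I \<and> f i = n. c i * real (f i)) = real n * a n" for n
    unfolding a_def sum_distrib_left by (intro sum.cong) auto
  ultimately have "S = q * (\<Sum>n. diffs a n * q ^ n)" using s1 sums_unique2 by auto
  then show ?thesis using that d S by blast
qed

lemma int_abs_le_square: "\<bar>i\<bar> \<le> i\<^sup>2" for i :: int
proof (cases "i = 0")
  case False
  then have "1 * \<bar>i\<bar> \<le> \<bar>i\<bar> * \<bar>i\<bar>" by (intro mult_right_mono) auto
  then show ?thesis by (simp add: power2_eq_square)
qed simp

lemma finite_square_fibre: "finite {i::int. nat (i\<^sup>2) = n}"
proof (rule finite_subset)
  show "{i. nat (i\<^sup>2) = n} \<subseteq> {- int n..int n}"
  proof
    fix i assume "i \<in> {i. nat (i\<^sup>2) = n}"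
    then have "int n = i\<^sup>2" by auto
    then show "i \<in> {- int n..int n}" using int_abs_le_square[of i] by auto
  qed
qed simp

text \<open>The index lattice splits by the parity of \<open>m + n\<close>; each half is
  parametrised by half sum and half difference.\<close>

lemma thA_square:
  assumes q: "\<bar>q\<bar> < 1" "q \<noteq> 0"
  shows "thA q ^ 2 = thA (q\<^sup>2) ^ 2 + q * thB (q\<^sup>2) ^ 2"
proof -
  have q2: "\<bar>q\<^sup>2\<bar> < 1" "q\<^sup>2 \<noteq> 0" using norm_power_lt1[of q 2] q by auto
  have "((\<lambda>(m, n). q ^ nat (m\<^sup>2) * q ^ nat (n\<^sup>2)) has_sum thA q * thA q) (UNIV \<times> UNIV)"
    by (intro has_sum_times thA_has_sum q)
  then have 0: "((\<lambda>(m, n). q ^ nat (m\<^sup>2) * q ^ nat (n\<^sup>2)) has_sum thA q * thA q) UNIV" by simp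
  obtain S1 S2 where s: "((\<lambda>z. case (case z of (u, v) \<Rightarrow> (u + v, u - v)) of (m, n) \<Rightarrow> q ^ nat (m\<^sup>2)
      * q ^ nat (n\<^sup>2)) has_sum S1) UNIV"
     "((\<lambda>z. case (case z of (u, v) \<Rightarrow> (u + v + 1, u - v)) of (m, n) \<Rightarrow> q ^ nat (m\<^sup>2)
         * q ^ nat (n\<^sup>2)) has_sum S2) UNIV"
     "thA q * thA q = S1 + S2"
  proof (rule has_sum_split2[OF 0, of "\<lambda>(u, v). (u + v, u - v)" "\<lambda>(u, v). (u + v + 1, u
      - v)"], goal_cases)
    case (3 x y) then show ?case by (cases x, cases y) (simp, presburger)
  next
    case (4 y)
    obtain m n where y: "y = (m, n)" by (cases y)
    show ?case
    proof (cases "even (m + n)")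
      case True
      then have "y = (case ((m + n) div 2, (m - n) div 2) of (u, v) \<Rightarrow> (u + v, u - v))" unfolding y
          by simp presburger
      then show ?thesis by blast
    next
      case False
      then have "y = (case ((m + n - 1) div 2, (m - n - 1) div 2) of (u, v) \<Rightarrow> (u + v + 1, u - v))"
          unfolding y by simp presburger
      then show ?thesis by blast
    qed
  qed (auto simp: inj_def)
  have e: "nat ((u + v)\<^sup>2) + nat ((u - v)\<^sup>2) = 2 * nat (u\<^sup>2) + 2 * nat (v\<^sup>2)" for u v :: int
    by (simp flip: of_nat_eq_iff[where 'a = int]) (simp add: power2_eq_square algebra_simps)
  have B0: "u\<^sup>2 + u \<ge> 0" for u :: int using tri_eq[of "-u"]
      by (simp add: power2_eq_square algebra_simps)
  have e': "nat ((u + v + 1)\<^sup>2) + nat ((u - v)\<^sup>2) = 1 + 2 * nat (u\<^sup>2 + u) + 2 * nat (v\<^sup>2 + v)"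
      for u v :: int
    using B0[of u] B0[of v] by (simp flip: of_nat_eq_iff[where 'a
        = int]) (simp add: power2_eq_square algebra_simps)
  have a1: "((\<lambda>(u, v). (q\<^sup>2) ^ nat (u\<^sup>2) * (q\<^sup>2) ^ nat (v\<^sup>2)) has_sum thA (q\<^sup>2)
      * thA (q\<^sup>2)) (UNIV \<times> UNIV)"
    by (intro has_sum_times thA_has_sum q2)
  have b1: "(\<lambda>(u, v). (q\<^sup>2) ^ nat (u\<^sup>2) * (q\<^sup>2) ^ nat (v\<^sup>2)) = (\<lambda>z. case (case z of (u, v) \<Rightarrow> (u
      + v, u - v)) of (m, n) \<Rightarrow> q ^ nat (m\<^sup>2) * q ^ nat (n\<^sup>2))"
    by (auto simp: fun_eq_iff power_add[symmetric] power_mult[symmetric] e)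
  have "S1 = thA (q\<^sup>2) * thA (q\<^sup>2)" by (rule has_sum_unique[OF s(1) a1[unfolded b1
      UNIV_Times_UNIV]])
  have "((\<lambda>(u, v). (q\<^sup>2) ^ nat (u\<^sup>2 + u) * (q\<^sup>2) ^ nat (v\<^sup>2 + v)) has_sum thB (q\<^sup>2)
      * thB (q\<^sup>2)) (UNIV \<times> UNIV)"
    by (intro has_sum_times thB_has_sum q2)
  then have a2: "((\<lambda>z. q * (case z of (u, v) \<Rightarrow> (q\<^sup>2) ^ nat (u\<^sup>2 + u) * (q\<^sup>2) ^ nat (v\<^sup>2 + v)))
      has_sum q * (thB (q\<^sup>2) * thB (q\<^sup>2))) (UNIV \<times> UNIV)"
    by (rule has_sum_cmult_right)
  have b2: "(\<lambda>z. q * (case z of (u, v) \<Rightarrow> (q\<^sup>2) ^ nat (u\<^sup>2 + u) * (q\<^sup>2) ^ nat (v\<^sup>2 + v)))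
      = (\<lambda>z. case (case z of (u, v) \<Rightarrow> (u + v + 1, u - v)) of (m, n) \<Rightarrow> q ^ nat (m\<^sup>2)
      * q ^ nat (n\<^sup>2))"
    by (auto simp: fun_eq_iff power_add[symmetric] power_mult[symmetric] e' simp flip: power_Suc)
  have "S2 = q * (thB (q\<^sup>2) * thB (q\<^sup>2))" by (rule has_sum_unique[OF s(2) a2[unfolded b2
      UNIV_Times_UNIV]])
  with \<open>S1 = _\<close> show ?thesis using s(3) by (simp add: power2_eq_square)
qed

text \<open>The double series on the left has coefficients
  \<open>(2m + 1)^2 - (2n)^2 = U V\<close> with \<open>U\<close>, \<open>V\<close> odd and congruent
  modulo \<open>4\<close>, so it factors into two copies of the square of Jacobi's series for the
  cube.\<close>

lemma wronskian:
  assumes q: "0 < q" "q < 1"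
  obtains A' B' where "(thA has_real_derivative A') (at q)" "(thB has_real_derivative B') (at q)"
    "thA q * thB q + 4 * (thA q * (q * B') - thB q * (q * A')) = 2 * euler q ^ 6"
proof -
  have q': "\<bar>q\<bar> < 1" "q \<noteq> 0" using q by auto
  have B0: "u\<^sup>2 + u \<ge> 0" for u :: int using tri_eq[of "-u"]
      by (simp add: power2_eq_square algebra_simps)
  have finB: "finite {i \<in> UNIV. nat (i\<^sup>2 + i) = n}" for n
  proof (rule finite_subset)
    show "{i \<in> UNIV. nat (i\<^sup>2 + i) = n} \<subseteq> {- int n - 1..int n}"
    proof
      fix i assume "i \<in> {i \<in> UNIV. nat (i\<^sup>2 + i) = n}"
      then have n: "int n = i * (i + 1)" using B0[of i]
          by (auto simp: power2_eq_square algebra_simps)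
      consider "i \<ge> 0" | "i = - 1" | "i < - 1" by linarith
      then show "i \<in> {- int n - 1..int n}"
      proof cases
        case 1 then have "i * 1 \<le> i * (i + 1)" by (intro mult_left_mono) auto
        then show ?thesis using 1 n by auto
      next
        case 3 then have "(- i - 1) * 1 \<le> (- i - 1) * (- i)" by (intro mult_left_mono) auto
        then show ?thesis using 3 n by (auto simp: algebra_simps)
      qed auto
    qed
  qed simp
  obtain A' where A': "(thA has_real_derivative A') (at q)" "((\<lambda>i::int. 1 * real (nat (i\<^sup>2))
      * q ^ nat (i\<^sup>2)) has_sum q * A') UNIV"
  proof (rule has_sum_deriv[where c = "\<lambda>_. 1" and f = "\<lambda>i. nat (i\<^sup>2)" and F = thA and I = UNIV
      and q = q])
    show "((\<lambda>i. 1 * q ^ nat (i\<^sup>2)) has_sum thA q) UNIV" if "0 < q" "q < 1" for q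
      using thA_has_sum[of q] that by simp
  qed (use finite_square_fibre q in auto)
  obtain B' where B': "(thB has_real_derivative B') (at q)" "((\<lambda>i::int. 1 * real (nat (i\<^sup>2 + i))
      * q ^ nat (i\<^sup>2 + i)) has_sum q * B') UNIV"
  proof (rule has_sum_deriv[where c = "\<lambda>_. 1" and f = "\<lambda>i. nat (i\<^sup>2 + i)" and F = thB and I = UNIV
      and q = q])
    show "((\<lambda>i. 1 * q ^ nat (i\<^sup>2 + i)) has_sum thB q) UNIV" if "0 < q" "q < 1" for q
      using thB_has_sum[of q] that by simp
  qed (use finB q in auto)
  define h where "h = (\<lambda>(n::int, m::int). (real_of_int (2 * m + 1 - 2 * n) * real_of_int (2 * m
      + 1 + 2 * n)) * (q ^ nat (n\<^sup>2) * q ^ nat (m\<^sup>2 + m)))"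
  have "((\<lambda>z. (case z of (n, m) \<Rightarrow> q ^ nat (n\<^sup>2) * q ^ nat (m\<^sup>2 + m)) +
     (4 * (case z of (n, m) \<Rightarrow> q ^ nat (n\<^sup>2) * (1 * real (nat (m\<^sup>2 + m)) * q ^ nat (m\<^sup>2 + m))) +
      (-4) * (case z of (n, m) \<Rightarrow> (1 * real (nat (n\<^sup>2)) * q ^ nat (n\<^sup>2)) * q ^ nat (m\<^sup>2 + m))))
    has_sum (thA q * thB q + (4 * (thA q * (q * B')) + (-4) * (q * A' * thB q)))) (UNIV \<times> UNIV)"
    by (intro has_sum_add has_sum_cmult_right has_sum_times thA_has_sum thB_has_sum A'(2) B'(2) q')
  moreover have "(\<lambda>z. (case z of (n, m) \<Rightarrow> q ^ nat (n\<^sup>2) * q ^ nat (m\<^sup>2 + m)) +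
     (4 * (case z of (n, m) \<Rightarrow> q ^ nat (n\<^sup>2) * (1 * real (nat (m\<^sup>2 + m)) * q ^ nat (m\<^sup>2 + m))) +
      (-4) * (case z of (n, m) \<Rightarrow> (1 * real (nat (n\<^sup>2)) * q ^ nat (n\<^sup>2)) * q ^ nat (m\<^sup>2 + m)))) = h"
  proof
    fix z :: "int \<times> int"
    obtain n m where z: "z = (n, m)" by (cases z)
    have "real (nat (m\<^sup>2 + m)) = of_int (m\<^sup>2 + m)" "real (nat (n\<^sup>2)) = of_int (n\<^sup>2)"
        using B0[of m] by (simp_all only: of_nat_nat zero_le_power2)
    then show "(case z of (n, m) \<Rightarrow> q ^ nat (n\<^sup>2) * q ^ nat (m\<^sup>2 + m)) +
     (4 * (case z of (n, m) \<Rightarrow> q ^ nat (n\<^sup>2) * (1 * real (nat (m\<^sup>2 + m)) * q ^ nat (m\<^sup>2 + m))) +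
      (-4) * (case z of (n, m) \<Rightarrow> (1 * real (nat (n\<^sup>2)) * q ^ nat (n\<^sup>2)) * q ^ nat (m\<^sup>2 + m))) = h z"
      unfolding h_def z by (simp only: prod.case) (simp add: power2_eq_square[of "real_of_int x"
          for x] algebra_simps)
  qed
  ultimately have 0: "(h has_sum (thA q * thB q + (4 * (thA q * (q * B')) + (-4) * (q * A'
      * thB q)))) UNIV" by simp
  \<comment> \<open>In the first half the two linear factors of \<open>h\<close> are
    \<open>4 * j + 1\<close> and \<open>4 * i + 1\<close>. The parametrisation of the second half is
    chosen so that both merely change sign, and the halves become equal.\<close>
  obtain S1 S2 where s: "((\<lambda>z. h (case z of (i, j) \<Rightarrow> (i - j, i + j))) has_sum S1) UNIV"
     "((\<lambda>z. h (case z of (i, j) \<Rightarrow> (j - i, - i - j - 1))) has_sum S2) UNIV"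
     "thA q * thB q + (4 * (thA q * (q * B')) + (-4) * (q * A' * thB q)) = S1 + S2"
  proof (rule has_sum_split2[OF 0, of "\<lambda>(i, j). (i - j, i + j)" "\<lambda>(i, j). (j - i, - i - j
      - 1)"], goal_cases)
    case (3 x y) then show ?case by (cases x, cases y) (simp, presburger)
  next
    case (4 y)
    obtain n m where y: "y = (n, m)" by (cases y)
    show ?case
    proof (cases "even (m + n)")
      case True
      then have "y = (case ((m + n) div 2, (m - n) div 2) of (i, j) \<Rightarrow> (i - j, i + j))" unfolding y
          by simp presburger
      then show ?thesis by blast
    next
      case False
      then have "y = (case ((- m - 1 - n) div 2, (- m - 1 + n) div 2) of (i, j) \<Rightarrow> (j - i, - i - j
          - 1))" unfolding y by simp presburger
      then show ?thesis by blast
    qed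
  qed (auto simp: inj_def)
  let ?k = "\<lambda>(i::int, j::int). ((4 * real_of_int i + 1) * q ^ nat (2 * i\<^sup>2 + i)) * ((4
      * real_of_int j + 1) * q ^ nat (2 * j\<^sup>2 + j))"
  have J: "(?k has_sum (euler q ^ 3 * euler q ^ 3)) (UNIV \<times> UNIV)"
    by (intro has_sum_times jacobi_cube' q')
  have J0: "2 * i\<^sup>2 + i \<ge> 0" for i :: int using B0[of i] zero_le_power2[of i] by linarith
  have e1: "nat ((i - j)\<^sup>2) + nat ((i + j)\<^sup>2 + (i + j)) = nat (2 * i\<^sup>2 + i) + nat (2 * j\<^sup>2 + j)"
      for i j
    using J0[of i] J0[of j] B0[of "i + j"]
    by (simp flip: of_nat_eq_iff[where 'a = int]) (simp add: power2_eq_square algebra_simps)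
  have e2: "nat ((j - i)\<^sup>2) + nat ((- i - j - 1)\<^sup>2 + (- i - j - 1)) = nat (2 * i\<^sup>2 + i) + nat (2
      * j\<^sup>2 + j)" for i j
    using J0[of i] J0[of j] B0[of "- i - j - 1"]
    by (simp flip: of_nat_eq_iff[where 'a = int]) (simp add: power2_eq_square algebra_simps)
  have k1: "(\<lambda>z. h (case z of (i, j) \<Rightarrow> (i - j, i + j))) = ?k"
  proof
    fix z :: "int \<times> int"
    obtain i j where z: "z = (i, j)" by (cases z)
    have "h (i - j, i + j) = ((4 * real_of_int i + 1) * (4 * real_of_int j + 1)) * (q ^ (nat ((i
        - j)\<^sup>2) + nat ((i + j)\<^sup>2 + (i + j))))"
      by (simp add: h_def power_add)
    then show "h (case z of (i, j) \<Rightarrow> (i - j, i + j)) = ?k z" unfolding z e1 by (simp add: power_add)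
  qed
  have k2: "(\<lambda>z. h (case z of (i, j) \<Rightarrow> (j - i, - i - j - 1))) = ?k"
  proof
    fix z :: "int \<times> int"
    obtain i j where z: "z = (i, j)" by (cases z)
    have "h (j - i, - i - j - 1) = ((4 * real_of_int i + 1) * (4 * real_of_int j + 1))
        * (q ^ (nat ((j - i)\<^sup>2) + nat ((- i - j - 1)\<^sup>2 + (- i - j - 1))))"
      by (simp add: h_def power_add algebra_simps)
    then show "h (case z of (i, j) \<Rightarrow> (j - i, - i - j - 1)) = ?k z" unfolding z e2
        by (simp add: power_add)
  qed
  have "S1 = euler q ^ 3 * euler q ^ 3" "S2 = euler q ^ 3 * euler q ^ 3"
    using s(1,2) J unfolding k1 k2 by (auto dest: has_sum_unique)
  then have "thA q * thB q + 4 * (thA q * (q * B') - thB q * (q * A')) = 2 * euler q ^ 6"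
    using s(3) by (simp add: algebra_simps power_add[symmetric])
  then show ?thesis using that A'(1) B'(1) by blast
qed

section \<open>Eta quotients for theta constants and the lambda function\<close>

lemma unit_pow:
  fixes q :: real
  assumes "0 < q" "q < 1" "0 < n" shows "0 < q ^ n" "q ^ n < 1" "\<bar>q ^ n\<bar> < 1" "q ^ n \<noteq> 0"
  using assms power_strict_mono[of q 1 n] by auto

lemma euler_pos:
  fixes q :: real
  assumes "\<bar>q\<bar> < 1" shows "euler q > 0"
  unfolding euler_def
proof (rule less_0_prodinf[OF euler_convergent])
  show "0 < 1 - q ^ Suc n" for n
  proof -
    have "\<bar>q ^ Suc n\<bar> < 1" using norm_power_lt1[of q "Suc n"] assms by simp
    then show ?thesis by linarith
  qed
qed (use assms in auto)

lemma thA_minus: "thA (- q) = euler q ^ 2 / euler (q\<^sup>2)" by (simp add: thA_def)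

lemma thA_eta:
  assumes "\<bar>q\<bar> < 1" shows "thA q = euler (q\<^sup>2) ^ 5 / (euler q ^ 2 * euler (q ^ 4) ^ 2)"
proof -
  have "euler (q\<^sup>2) > 0" using euler_pos[of "q\<^sup>2"] norm_power_lt1[of q 2] assms by simp
  then show ?thesis unfolding thA_def euler_minus[OF assms]
      by (simp add: field_simps power_numeral_reduce)
qed

lemma thA_pos: "\<bar>q\<bar> < 1 \<Longrightarrow> thA q > 0"
  unfolding thA_def using euler_pos[of "- q"] euler_pos[of "q\<^sup>2"] norm_power_lt1[of q 2] by simp

lemma thB_pos: "\<bar>q\<bar> < 1 \<Longrightarrow> thB q > 0"
  unfolding thB_def using euler_pos[of "q ^ 4"] euler_pos[of "q\<^sup>2"] norm_power_lt1[of q 2]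
      norm_power_lt1[of q 4] by simp

lemma thB_square:
  assumes q: "0 < q" "q < 1"
  shows "thB q ^ 2 = 2 * thA (q\<^sup>2) * thB (q\<^sup>2)"
proof -
  have q2: "\<bar>q\<^sup>2\<bar> < 1" and q4: "\<bar>q ^ 4\<bar> < 1" and q8: "\<bar>q ^ 8\<bar> < 1" using unit_pow[OF q] by simp_all
  have pw: "(q\<^sup>2)\<^sup>2 = q ^ 4" "(q\<^sup>2) ^ 4 = q ^ 8" by (simp_all flip: power_mult)
  show ?thesis
    unfolding thA_eta[OF q2] thB_def pw using euler_pos[OF q2] euler_pos[OF q4] euler_pos[OF q8]
    by (simp add: field_simps power_numeral_reduce)
qed

text \<open>\<open>thA_square\<close> holds at -q too, where only the sign of its \<open>thB\<close>
  term changes. The difference of the squares of the two instances is a product that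
  \<open>thB_square\<close> recognises as \<open>thB q ^ 4\<close>.\<close>

lemma jacobi_quartic:
  assumes q: "0 < q" "q < 1"
  shows "thA q ^ 4 = thA (- q) ^ 4 + q * thB q ^ 4"
proof -
  have 1: "thA q ^ 2 = thA (q\<^sup>2) ^ 2 + q * thB (q\<^sup>2) ^ 2" using thA_square[of q] q by simp
  have 2: "thA (- q) ^ 2 = thA (q\<^sup>2) ^ 2 - q * thB (q\<^sup>2) ^ 2" using thA_square[of "- q"] q by simp
  have "thA q ^ 4 - thA (- q) ^ 4 = (thA q ^ 2) ^ 2 - (thA (- q) ^ 2) ^ 2" by simp
  also have "\<dots> = q * (2 * thA (q\<^sup>2) * thB (q\<^sup>2)) ^ 2" unfolding 1 2
      by (simp add: power2_eq_square algebra_simps)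
  also have "\<dots> = q * (thB q ^ 2) ^ 2" by (simp only: thB_square[OF q])
  finally show ?thesis by simp
qed

text \<open>The modular lambda function as a function of the nome.\<close>

definition lamb :: "real \<Rightarrow> real" where "lamb q = q * thB q ^ 4 / thA q ^ 4"

lemma lamb_bounds:
  assumes q: "0 < q" "q < 1"
  shows "0 < lamb q" "lamb q < 1" "1 - lamb q = thA (- q) ^ 4 / thA q ^ 4"
proof -
  have A: "thA q > 0" "thA (- q) > 0" "thB q > 0"
      using thA_pos[of q] thA_pos[of "- q"] thB_pos[of q] q by auto
  then show "0 < lamb q" using q by (simp add: lamb_def)
  have "thA (- q) ^ 4 = thA q ^ 4 - q * thB q ^ 4" using jacobi_quartic[OF q] by simp
  then show 1: "1 - lamb q = thA (- q) ^ 4 / thA q ^ 4"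
    unfolding lamb_def using A by (simp add: diff_divide_distrib)
  have "0 < 1 - lamb q" unfolding 1 using A by simp
  then show "lamb q < 1" by simp
qed

text \<open>The quotient rule produces exactly the Wronskian combination of \<open>thA\<close> and
  \<open>thB\<close>; the value \<open>2 * euler q ^ 6\<close> found above equals
  \<open>thA q * thB q * thA (- q) ^ 4\<close>.\<close>

lemma lamb_deriv:
  assumes q: "0 < q" "q < 1"
  shows "(lamb has_real_derivative (lamb q * thA (- q) ^ 4 / q)) (at q)"
proof -
  obtain A' B' where d: "(thA has_real_derivative A') (at q)" "(thB has_real_derivative B') (at q)"
    and w: "thA q * thB q + 4 * (thA q * (q * B') - thB q * (q * A')) = 2 * euler q ^ 6"
    by (rule wronskian[OF q])
  have A: "thA q > 0" "thB q > 0" using thA_pos[of q] thB_pos[of q] q by auto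
  have e: "euler q > 0" "euler (q\<^sup>2) > 0" "euler (q ^ 4) > 0" using q unit_pow[OF q]
      by (simp_all add: euler_pos)
  have th: "2 * euler q ^ 6 = thA q * thB q * thA (- q) ^ 4"
    unfolding thA_minus thB_def thA_eta[of q, simplified abs_of_pos[OF q(1)], OF q(2)] using e
    by (simp add: field_simps power_numeral_reduce)
  have "(lamb has_real_derivative ((1 * thB q ^ 4 + q * (4 * thB q ^ 3 * B')) * thA q ^ 4 - q
      * thB q ^ 4 * (4 * thA q ^ 3 * A')) / (thA q ^ 4 * thA q ^ 4)) (at q)"
    unfolding lamb_def[abs_def] using A by (auto intro!: derivative_eq_intros d simp: algebra_simps)
  also have "((1 * thB q ^ 4 + q * (4 * thB q ^ 3 * B')) * thA q ^ 4 - q * thB q ^ 4 * (4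
      * thA q ^ 3 * A')) / (thA q ^ 4 * thA q ^ 4)
     = thB q ^ 3 * (thA q * thB q + 4 * (thA q * (q * B') - thB q * (q * A'))) / thA q ^ 5"
    using A by (simp add: field_simps power_numeral_reduce)
  also have "\<dots> = lamb q * thA (- q) ^ 4 / q"
    unfolding w th lamb_def using A q by (simp add: field_simps power_numeral_reduce)
  finally show ?thesis .
qed

text \<open>Monotonicity gives \<open>lamb (q ^ 7) < lamb q\<close>, which fixes the sign of y on
  the curve.\<close>

lemma lamb_mono:
  assumes "0 < a" "a < b" "b < 1" shows "lamb a < lamb b"
proof (rule DERIV_pos_imp_increasing_open[OF assms(2)])
  fix x assume x: "a < x" "x < b"
  then have "lamb x * thA (- x) ^ 4 / x > 0"
    using lamb_bounds(1)[of x] thA_pos[of "- x"] assms by simp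
  then show "\<exists>y. DERIV lamb x :> y \<and> y > 0" using lamb_deriv[of x] x assms by auto
next
  show "continuous_on {a..b} lamb"
    by (intro continuous_at_imp_continuous_on ballI DERIV_isCont[OF lamb_deriv]) (use assms in auto)
qed

section \<open>The modular equation of degree seven\<close>

definition pform :: "int \<times> int \<Rightarrow> nat" where "pform = (\<lambda>(k, l). pent k + 7 * pent l)"

lemma pform_eq: "2 * int (pform (k, l)) = k * (3 * k + 1) + 7 * (l * (3 * l + 1))"
  using pent_eq[of k] pent_eq[of l] by (simp add: pform_def)

definition psgn :: "int \<times> int \<Rightarrow> real" where "psgn = (\<lambda>(k, l). (if even (k + l) then 1 else -1))"

lemma euler_pair_sum:
  fixes q :: real
  assumes q: "\<bar>q\<bar> < 1"
  shows "((\<lambda>z. psgn z * q ^ pform z) has_sum (euler q * euler (q ^ 7))) UNIV"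
proof -
  have q7: "\<bar>q ^ 7\<bar> < 1" using norm_power_lt1[of q 7] q by simp
  have "((\<lambda>(k, l). ((-1) ^ nat \<bar>k\<bar> * q ^ pent k) * ((-1) ^ nat \<bar>l\<bar> * (q ^ 7) ^ pent l))
      has_sum (euler q * euler (q ^ 7))) (UNIV \<times> UNIV)"
    by (intro has_sum_times pentagonal) (use q q7 in auto)
  moreover have "(\<lambda>(k, l). ((-1) ^ nat \<bar>k\<bar> * q ^ pent k) * ((-1) ^ nat \<bar>l\<bar> * (q ^ 7) ^ pent l))
      = (\<lambda>z. psgn z * q ^ pform z)"
    by (auto simp: fun_eq_iff psgn_def pform_def power_add power_mult even_nat_iff
        minus_one_power_iff)
  ultimately show ?thesis by simp
qed

text \<open>Put \<open>x = (6k + 1) + (6l + 1) \<surd>(-7)\<close>, so that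
  \<open>pform (k, l) = (|x|^2 - 8) / 24\<close>, and \<open>\<pi> = (1 + \<surd>(-7)) / 2\<close>.
  If \<open>pform (k, l)\<close> is odd, then \<open>x / 2\<close> is divisible by exactly two or by
  at least three factors \<open>\<pi>\<close>, or likewise by their conjugates. The maps
  \<open>p1\<close>, \<open>p2\<close> parametrise the latter case by division by
  \<open>\<pi>^2\<close> (or its conjugate), which quarters the norm; \<open>p3\<close>,
  \<open>p4\<close> parametrise the former, where \<open>tau\<close> exchanges the two conjugate
  cases, keeps the norm and reverses the sign.\<close>

lemma modular_equation_7:
  fixes q :: real
  assumes q: "0 < q" "q < 1"
  shows "euler (- q) * euler (- (q ^ 7)) = euler q * euler (q ^ 7) + 2 * q * (euler (q ^ 4)
      * euler (q ^ 28))"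
proof -
  define f where "f z = (if odd (pform z) then psgn z * q ^ pform z else 0)" for z
  have "((\<lambda>z. 1/2 * (psgn z * q ^ pform z) + (-1/2) * (psgn z * (- q) ^ pform z)) has_sum
       (1/2 * (euler q * euler (q ^ 7)) + (-1/2) * (euler (- q) * euler ((- q) ^ 7)))) UNIV"
    by (intro has_sum_add has_sum_cmult_right euler_pair_sum) (use q in auto)
  moreover have "1/2 * (psgn z * q ^ pform z) + (-1/2) * (psgn z * (- q) ^ pform z) = f z" for z
    by (auto simp: f_def)
  ultimately have "(f has_sum (1/2 * (euler q * euler (q ^ 7)) + (-1/2) * (euler (- q)
      * euler ((- q) ^ 7)))) UNIV"
    by (simp only:)
  then have f: "(f has_sum (1/2 * (euler q * euler (q ^ 7) - euler (- q)
      * euler (- (q ^ 7))))) UNIV"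
    by (simp add: right_diff_distrib)
  \<comment> \<open>The four images are residue classes modulo 8: \<open>k + 3 * l\<close> is 6 on
    \<open>p1\<close> and 2 on \<open>p3\<close>, \<open>k - 3 * l\<close> is 7 on \<open>p2\<close>
    and 3 on \<open>p4\<close>. The ranges of \<open>g1\<close> and \<open>g2\<close> are the pairs
    with \<open>k + l\<close> odd and even respectively, so together they exhaust the full lattice
    sum at \<open>q ^ 4\<close>.\<close>
  define p1 where "p1 = (\<lambda>(r::int, l::int). (8 * r - 2 - 3 * l, l))"
  define p2 where "p2 = (\<lambda>(r::int, l::int). (8 * r - 1 + 3 * l, l))"
  define p3 where "p3 = (\<lambda>(r::int, l::int). (8 * r + 2 - 3 * l, l))"
  define p4 where "p4 = (\<lambda>(r::int, l::int). (8 * r + 3 + 3 * l, l))"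
  define g1 where "g1 = (\<lambda>(r::int, l::int). (3 * r - 2 * l - 1, - r))"
  define g2 where "g2 = (\<lambda>(r::int, l::int). (- 3 * r - 2 * l, - r))"
  define tau where "tau = (\<lambda>(r::int, l::int). (r, l - 3 * r - 1))"
  note defs = p1_def p2_def p3_def p4_def g1_def g2_def tau_def
  have inj: "inj p1" "inj p2" "inj p3" "inj p4" "inj g1" "inj g2" by (auto simp: inj_def defs)
  have off: "f z = 0" if "z \<notin> range p1 \<union> range p2 \<union> range p3 \<union> range p4" for z
  proof (rule ccontr)
    assume "f z \<noteq> 0"
    obtain k l where z: "z = (k, l)" by (cases z)
    from \<open>f z \<noteq> 0\<close> have "odd (pform (k, l))" by (auto simp: f_def z split: if_splits)
    \<comment> \<open>The parity of \<open>pform (k, l)\<close> depends only on k and l modulo 4,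
      which leaves a check of sixteen residue pairs.\<close>
    define a x b y where ab: "a = k div 4" "x = k mod 4" "b = l div 4" "y = l mod 4"
    have k: "k = 4 * a + x" "l = 4 * b + y" by (simp_all add: ab)
    have xy: "x \<in> {0, 1, 2, 3}" "y \<in> {0, 1, 2, 3}" unfolding ab by auto
    define c where "c = 12 * a * a + 6 * a * x + a + 7 * (12 * b * b + 6 * b * y + b)"
    have "2 * int (pform (k, l)) = 4 * c + (x * (3 * x + 1) + 7 * (y * (3 * y + 1))) + 0 * a"
      unfolding pform_eq k c_def by (simp add: algebra_simps)
    moreover define P X where "P = int (pform (k, l))" and "X = x * (3 * x + 1) + 7 * (y * (3 * y
        + 1))"
    ultimately have "2 * P = 4 * c + X" by simp
    moreover have "odd P" using \<open>odd (pform (k, l))\<close> by (simp add: P_def)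
    ultimately have X: "X mod 4 = 2" by presburger
    have "k + 3 * l = (x + 3 * y) + (a + 3 * b) * 4" "k - 3 * l = (x - 3 * y) + (a - 3 * b) * 4"
      by (simp_all add: k algebra_simps)
    then have kl: "(k + 3 * l) mod 4 = (x + 3 * y) mod 4" "(k - 3 * l) mod 4 = (x - 3 * y) mod 4"
      by (simp_all only: mod_mult_self1)
    have m8: "w mod 4 = 2 \<Longrightarrow> w mod 8 = 6 \<or> w mod 8 = 2" "w mod 4 = 3 \<Longrightarrow> w mod 8 = 7 \<or> w mod 8 = 3"
        for w :: int
      by presburger+
    have "(k + 3 * l) mod 4 = 2 \<or> (k - 3 * l) mod 4 = 3"
      unfolding kl using xy X by (auto simp: X_def)
    then have "(k + 3 * l) mod 8 = 6 \<or> (k + 3 * l) mod 8 = 2 \<or> (k - 3 * l) mod 8 = 7 \<or> (k - 3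
        * l) mod 8 = 3"
      using m8 by blast
    then consider "(k + 3 * l) mod 8 = 6" | "(k + 3 * l) mod 8 = 2" | "(k - 3 * l) mod 8
        = 7" | "(k - 3 * l) mod 8 = 3"
      by blast
    then have "\<exists>r. z = p1 (r, l) \<or> z = p2 (r, l) \<or> z = p3 (r, l) \<or> z = p4 (r, l)"
    proof cases
      case 1 then have "z = p1 ((k + 3 * l) div 8 + 1, l)"
        using div_mult_mod_eq[of "k + 3 * l" 8] by (simp add: z p1_def)
      then show ?thesis by blast
    next
      case 2 then have "z = p3 ((k + 3 * l) div 8, l)"
        using div_mult_mod_eq[of "k + 3 * l" 8] by (simp add: z p3_def)
      then show ?thesis by blast
    next
      case 3 then have "z = p2 ((k - 3 * l) div 8 + 1, l)"
        using div_mult_mod_eq[of "k - 3 * l" 8] by (simp add: z p2_def)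
      then show ?thesis by blast
    next
      case 4 then have "z = p4 ((k - 3 * l) div 8, l)"
        using div_mult_mod_eq[of "k - 3 * l" 8] by (simp add: z p4_def)
      then show ?thesis by blast
    qed
    then show False using that by auto
  qed
  have sm: "f summable_on X" for X using summable_on_subset_banach[OF has_sum_imp_summable[OF f]]
      by simp
  obtain S1 S2 S3 S4 where s: "(f has_sum S1) (range p1)" "(f has_sum S2) (range p2)" "(f
      has_sum S3) (range p3)" "(f has_sum S4) (range p4)"
    using sm unfolding summable_on_def by metis
  have disj: "range p1 \<inter> range p2 = {}" "(range p1 \<union> range p2) \<inter> range p3
      = {}" "(range p1 \<union> range p2 \<union> range p3) \<inter> range p4 = {}"
    unfolding defs by (auto; presburger)+
  have "(f has_sum (S1 + S2 + S3 + S4)) (range p1 \<union> range p2 \<union> range p3 \<union> range p4)"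
    by (intro has_sum_Un_disjoint s disj)
  moreover have "(f has_sum v) (range p1 \<union> range p2 \<union> range p3 \<union> range p4) \<longleftrightarrow> (f has_sum v) UNIV"
      for v
    by (rule has_sum_cong_neutral) (use off in blast)+
  ultimately have "(f has_sum (S1 + S2 + S3 + S4)) UNIV" by blast
  then have total: "1/2 * (euler q * euler (q ^ 7) - euler (- q) * euler (- (q ^ 7))) = S1 + S2
      + S3 + S4"
    using f has_sum_unique by blast
  have s': "((\<lambda>x. f (p1 x)) has_sum S1) UNIV" "((\<lambda>x. f (p2 x)) has_sum S2) UNIV" "((\<lambda>x. f (p3 x))
      has_sum S3) UNIV" "((\<lambda>x. f (p4 x)) has_sum S4) UNIV"
    using s inj by (simp_all add: has_sum_reindex o_def)
  have pf1: "pform (p1 z) = 4 * pform (g1 z) + 1" and pf2: "pform (p2 z) = 4 * pform (g2 z) + 1"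
    and pf4: "pform (p4 (tau z)) = pform (p3 z)" for z
  proof -
    obtain r l where z: "z = (r, l)" by (cases z)
    have "2 * int (pform (p1 z)) = 2 * int (4 * pform (g1 z) + 1)"
      unfolding z defs prod.case of_nat_add of_nat_mult distrib_left mult.left_commute[of 2 "int
          4"] pform_eq by (simp add: algebra_simps)
    then show "pform (p1 z) = 4 * pform (g1 z) + 1"
        by (simp only: mult_cancel_left of_nat_eq_iff) simp
    have "2 * int (pform (p2 z)) = 2 * int (4 * pform (g2 z) + 1)"
      unfolding z defs prod.case of_nat_add of_nat_mult distrib_left mult.left_commute[of 2 "int
          4"] pform_eq by (simp add: algebra_simps)
    then show "pform (p2 z) = 4 * pform (g2 z) + 1"
        by (simp only: mult_cancel_left of_nat_eq_iff) simp
    have "2 * int (pform (p4 (tau z))) = 2 * int (pform (p3 z))"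
      unfolding z defs prod.case pform_eq by (simp add: algebra_simps)
    then show "pform (p4 (tau z)) = pform (p3 z)"
        by (simp only: mult_cancel_left of_nat_eq_iff) simp
  qed
  have sg: "psgn (p1 z) = 1" "psgn (g1 z) = -1" "psgn (p2 z) = -1" "psgn (g2 z) = 1" "psgn (p3 z)
      = 1" "psgn (p4 (tau z)) = -1" for z
    by (cases z; simp add: psgn_def defs; presburger?)+
  have "bij tau" by (rule bij_betwI[where g = "\<lambda>(r, l). (r, l + 3 * r + 1)"]) (auto simp: tau_def)
  from has_sum_reindex_bij_betw[OF this, THEN iffD2, OF s'(4)]
  have "((\<lambda>x. f (p4 (tau x))) has_sum S4) UNIV" .
  moreover have "f (p4 (tau x)) = - f (p3 x)" for x by (simp add: f_def pf4 sg)
  ultimately have "((\<lambda>x. - f (p3 x)) has_sum S4) UNIV" by simp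
  moreover have "((\<lambda>x. - f (p3 x)) has_sum - S3) UNIV" using s'(3) by (rule has_sum_uminusI)
  ultimately have S34: "S4 = - S3" by (rule has_sum_unique)
  let ?G = "\<lambda>z. psgn z * (q ^ 4) ^ pform z"
  have "(?G has_sum (euler (q ^ 4) * euler ((q ^ 4) ^ 7))) UNIV"
    by (rule euler_pair_sum) (use unit_pow[OF q] in auto)
  then have G: "(?G has_sum (euler (q ^ 4) * euler (q ^ 28))) UNIV" by (simp flip: power_mult)
  obtain T1 T2 where t: "((\<lambda>x. ?G (g1 x)) has_sum T1) UNIV" "((\<lambda>x. ?G (g2 x))
      has_sum T2) UNIV" "euler (q ^ 4) * euler (q ^ 28) = T1 + T2"
  proof (rule has_sum_split2[OF G inj(5,6)], goal_cases)
    case (1 x y) then show ?case by (cases x, cases y) (simp add: g1_def g2_def, presburger)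
  next
    case (2 y)
    obtain k l where y: "y = (k, l)" by (cases y)
    show ?case
    proof (cases "even (k + l)")
      case True
      then have "y = g2 (- l, (3 * l - k) div 2)" unfolding y g2_def by simp
      then show ?thesis by blast
    next
      case False
      then have "y = g1 (- l, (- 3 * l - 1 - k) div 2)" unfolding y g1_def by (simp, presburger?)
      then show ?thesis by blast
    qed
  qed auto
  have fg: "f (p1 x) = - q * ?G (g1 x)" "f (p2 x) = - q * ?G (g2 x)" for x
    by (simp_all add: f_def pf1 pf2 sg power_mult)
  have "((\<lambda>x. f (p1 x)) has_sum - q * T1) UNIV" "((\<lambda>x. f (p2 x)) has_sum - q * T2) UNIV"
    unfolding fg by (intro has_sum_cmult_right t)+
  then have "S1 = - q * T1" "S2 = - q * T2" using has_sum_unique[OF s'(1)] has_sum_unique[OF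
      s'(2)] by auto
  then show ?thesis using total t(3) S34 by (simp add: algebra_simps)
qed

section \<open>Power series\<close>

text \<open>With values at positive q only, the least nonzero coefficient of the difference is
  isolated by dividing out its power of q and letting q tend to 0 from the right.\<close>

lemma powser_unique:
  fixes a b :: "nat \<Rightarrow> real"
  assumes a: "\<And>q. 0 < q \<Longrightarrow> q < 1 \<Longrightarrow> (\<lambda>n. a n * q ^ n) sums F q"
    and b: "\<And>q. 0 < q \<Longrightarrow> q < 1 \<Longrightarrow> (\<lambda>n. b n * q ^ n) sums F q"
  shows "a = b"
proof (rule ccontr)
  assume "a \<noteq> b"
  define c where "c n = a n - b n" for n
  have c: "(\<lambda>n. c n * q ^ n) sums 0" if "0 < q" "q < 1" for q
    using sums_diff[OF a[OF that] b[OF that]] by (simp add: c_def algebra_simps)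
  define m where "m = (LEAST m. c m \<noteq> 0)"
  have ex: "\<exists>m. c m \<noteq> 0" using \<open>a \<noteq> b\<close> by (auto simp: c_def fun_eq_iff)
  have m: "c m \<noteq> 0" unfolding m_def using LeastI_ex[OF ex] .
  have lt: "c n = 0" if "n < m" for n using not_less_Least[of n "\<lambda>m. c m \<noteq> 0"] that
      unfolding m_def by blast
  have s0: "(\<lambda>n. c (n + m) * q ^ n) sums 0" if q: "0 < q" "q < 1" for q
  proof -
    have "(\<lambda>n. c (n + m) * q ^ (n + m)) sums (0 - (\<Sum>n<m. c n * q ^ n))"
      using c[OF q] by (subst sums_iff_shift) (simp add: lt)
    then have "(\<lambda>n. c (n + m) * q ^ n * q ^ m) sums 0" by (simp add: lt power_add mult.assoc)
    then have "(\<lambda>n. c (n + m) * q ^ n * q ^ m * (1 / q ^ m)) sums (0 * (1 / q ^ m))"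
        by (rule sums_mult2)
    then show ?thesis using q by simp
  qed
  define f where "f x = (\<Sum>n. c (n + m) * x ^ n)" for x
  have "(f \<longlongrightarrow> c (0 + m)) (at 0)"
  proof (rule powser_limit_0[of "1/2" "\<lambda>n. c (n + m)" f])
    fix x :: real assume "norm x < 1/2"
    then have "summable (\<lambda>n. c (n + m) * x ^ n)"
      using powser_inside[of "\<lambda>n. c (n + m)" "1/2" x] s0[of "1/2"] by (auto simp: sums_iff)
    then show "(\<lambda>n. c (n + m) * x ^ n) sums f x" by (simp add: f_def summable_sums)
  qed simp
  then have "(f \<longlongrightarrow> c m) (at_right 0)" by (simp add: filterlim_at_split)
  moreover have "eventually (\<lambda>x. f x = 0) (at_right 0)"
  proof (rule eventually_mono[OF eventually_at_right_real[of 0 1]])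
    show "f x = 0" if "x \<in> {0<..<1}" for x using sums_unique[OF s0[of x]] that by (simp add: f_def)
  qed simp
  then have "(f \<longlongrightarrow> 0) (at_right 0)" by (rule tendsto_eventually)
  ultimately have "c m = 0" using tendsto_unique trivial_limit_at_right_real by blast
  then show False using m by contradiction
qed

text \<open>Negative arguments are included so that q may be replaced by -q. The point 0 is excluded
  because the theta series are stated for nonzero q.\<close>

definition pseries :: "(real \<Rightarrow> real) \<Rightarrow> (nat \<Rightarrow> real) \<Rightarrow> bool" where
  "pseries F a \<longleftrightarrow> (\<forall>q. \<bar>q\<bar> < 1 \<longrightarrow> q \<noteq> 0 \<longrightarrow> (\<lambda>n. a n * q ^ n) sums F q)"

lemma pseries_summable:
  assumes "pseries F a" "\<bar>q\<bar> < 1" shows "summable (\<lambda>n. norm (a n * q ^ n))"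
proof -
  obtain K where K: "\<bar>q\<bar> < K" "K < 1" using assms(2) dense by blast
  then have "summable (\<lambda>n. a n * K ^ n)" using assms(1) by (auto simp: pseries_def sums_iff)
  then show ?thesis using powser_insidea[of a K q] K by simp
qed

lemma pseries_mult:
  assumes F: "pseries F a" and G: "pseries G b"
  shows "pseries (\<lambda>q. F q * G q) (\<lambda>n. \<Sum>i\<le>n. a i * b (n - i))"
  unfolding pseries_def
proof (intro allI impI)
  fix q :: real assume q: "\<bar>q\<bar> < 1" "q \<noteq> 0"
  have "(\<lambda>n. \<Sum>i\<le>n. (a i * q ^ i) * (b (n - i) * q ^ (n - i))) sums ((\<Sum>n. a n * q ^ n) * (\<Sum>n. b n
      * q ^ n))"
    by (rule Cauchy_product_sums[OF pseries_summable[OF F q(1)] pseries_summable[OF G q(1)]])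
  moreover have "(\<Sum>i\<le>n. (a i * q ^ i) * (b (n - i) * q ^ (n - i))) = (\<Sum>i\<le>n. a i * b (n - i))
      * q ^ n" for n
    unfolding sum_distrib_right by (intro sum.cong) (auto simp: mult_ac simp flip: power_add)
  moreover have "(\<Sum>n. a n * q ^ n) = F q" "(\<Sum>n. b n * q ^ n) = G q"
    using F G q by (auto simp: pseries_def sums_iff)
  ultimately show "(\<lambda>n. (\<Sum>i\<le>n. a i * b (n - i)) * q ^ n) sums (F q * G q)" by simp
qed

lemma pseries_ex_mult:
  assumes "\<exists>a. pseries F a" "\<exists>b. pseries G b"
  shows "\<exists>c. pseries (\<lambda>q. F q * G q) c"
proof -
  obtain a b where *: "pseries F a" "pseries G b" using assms by blast
  show ?thesis by (rule exI, rule pseries_mult, rule *, rule *)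
qed

lemma pseries_ex_power:
  assumes "\<exists>a. pseries F a" shows "\<exists>c. pseries (\<lambda>q. F q ^ Suc n) c"
proof (induction n)
  case (Suc n) then show ?case using pseries_ex_mult[OF assms Suc] by simp
qed (use assms in simp)

lemma pseries_minus: "pseries F a \<Longrightarrow> pseries (\<lambda>q. F (- q)) (\<lambda>n. (-1) ^ n * a n)"
  unfolding pseries_def
proof (intro allI impI)
  fix q :: real assume F: "\<forall>q. \<bar>q\<bar> < 1 \<longrightarrow> q \<noteq> 0 \<longrightarrow> (\<lambda>n. a n * q ^ n) sums F q"
      and q: "\<bar>q\<bar> < 1" "q \<noteq> 0"
  then have "(\<lambda>n. a n * (- q) ^ n) sums F (- q)" by simp
  moreover have "a n * (- q) ^ n = (-1) ^ n * a n * q ^ n" for n using power_minus[of q n] by simp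
  ultimately show "(\<lambda>n. (-1) ^ n * a n * q ^ n) sums F (- q)" by simp
qed

lemma sums_subst_power:
  fixes a :: "nat \<Rightarrow> 'a::real_normed_field"
  assumes "(\<lambda>n. a n * (q ^ m) ^ n) sums S" "m > 0"
  shows "(\<lambda>n. (if m dvd n then a (n div m) else 0) * q ^ n) sums S"
proof -
  have "(\<lambda>n. (\<lambda>n. (if m dvd n then a (n div m) else 0) * q ^ n) (m * n)) sums S"
    using assms by (simp add: power_mult)
  moreover have "strict_mono (\<lambda>n. m * n)" using assms(2) by (simp add: strict_mono_def)
  ultimately show ?thesis
    by (subst (asm) sums_mono_reindex) (auto simp: dvd_def)
qed

lemma thA_pseries: "\<exists>a. pseries thA a"
proof -
  have "pseries thA (\<lambda>n. \<Sum>i | i \<in> UNIV \<and> nat (i\<^sup>2) = n. 1)"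
    unfolding pseries_def
    by (intro allI impI has_sum_group_power) (use thA_has_sum finite_square_fibre in auto)
  then show ?thesis by blast
qed

section \<open>The logarithmic derivative of the Euler product\<close>

definition sig :: "nat \<Rightarrow> nat \<Rightarrow> nat" where "sig k n = (\<Sum>d | d dvd n. d ^ k)"

lemma has_sum_ln:
  fixes y :: real
  assumes y: "0 < y" "y < 1"
  shows "((\<lambda>k. 1 / real (Suc k) * y ^ Suc k) has_sum - ln (1 - y)) UNIV"
proof (rule sums_nonneg_imp_has_sum)
  have "summable (\<lambda>k. y ^ Suc k)" using y by (simp add: summable_mult)
  then have "summable (\<lambda>k. 1 / real (Suc k) * y ^ Suc k)"
    by (rule summable_comparison_test'[where N = 0])
        (use y in \<open>auto simp: field_simps mult_le_cancel_left1\<close>)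
  moreover have "ln (1 - y) = (\<Sum>n. (-1) ^ n * (1 / real (n + 1)) * (1 - y - 1) ^ Suc n)"
    by (rule ln_series) (use y in auto)
  moreover have "(-1) ^ n * (1 / real (n + 1)) * (1 - y - 1) ^ Suc n = - (1 / real (Suc n)
      * y ^ Suc n)" for n
  proof -
    have "(1 - y - 1) ^ Suc n = (-1) ^ Suc n * y ^ Suc n" using power_minus[of y "Suc n"] by simp
    moreover have "(-1::real) ^ n * (-1) ^ Suc n = - 1" by (cases "even n") auto
    moreover have "(-1) ^ n * (1 / real (n + 1)) * ((-1) ^ Suc n * y ^ Suc n) = ((-1) ^ n
        * (-1) ^ Suc n) * (1 / real (Suc n) * y ^ Suc n)"
      by (simp only: mult_ac Suc_eq_plus1)
    ultimately show ?thesis by (simp only: mult_minus1)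
  qed
  ultimately have sm: "summable (\<lambda>k. 1 / real (Suc k) * y ^ Suc k)"
    and l: "ln (1 - y) = (\<Sum>n. - (1 / real (Suc n) * y ^ Suc n))" by (simp_all only:)
  show "(\<lambda>k. 1 / real (Suc k) * y ^ Suc k) sums - ln (1 - y)"
    unfolding l suminf_minus[OF sm] minus_minus by (rule summable_sums[OF sm])
qed (use y in auto)

text \<open>Expansion of each logarithm in \<open>- ln\<close> of the product. All terms are
  nonnegative, so the iterated sum is an unconditional double sum that may be regrouped.\<close>

lemma euler_log_has_sum:
  fixes q :: real
  assumes q: "0 < q" "q < 1"
  shows "((\<lambda>z. (case z of (n, k) \<Rightarrow> 1 / real (Suc k)) * q ^ (case z of (n, k) \<Rightarrow> Suc n * Suc k))
      has_sum - ln (euler q)) UNIV"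
proof -
  let ?h = "\<lambda>z. (case z of (n, k) \<Rightarrow> 1 / real (Suc k)) * q ^ (case z of (n, k) \<Rightarrow> Suc n * Suc k)"
  have i: "((\<lambda>k. ?h (n, k)) has_sum - ln (1 - q ^ Suc n)) UNIV" for n
    using has_sum_ln[of "q ^ Suc n"] unit_pow[OF q, of "Suc n"]
        by (simp add: power_mult[symmetric] del: power_Suc mult_Suc mult_Suc_right)
  have "(\<lambda>n. ln (1 - q ^ Suc n)) sums ln (euler q)"
  proof (rule has_prod_imp_sums_ln_real)
    show "raw_has_prod (\<lambda>n. 1 - q ^ Suc n) 0 (euler q)"
    proof -
      have "(\<lambda>n. 1 - q ^ Suc n) has_prod euler q"
        unfolding euler_def by (rule convergent_prod_has_prod[OF euler_convergent]) (use q in auto)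
      then show ?thesis using euler_pos[of q] q by (auto simp: has_prod_def)
    qed
  qed (use unit_pow[OF q] in \<open>auto simp del: power_Suc\<close>)
  then have "(\<lambda>n. - ln (1 - q ^ Suc n)) sums - ln (euler q)" by (rule sums_minus)
  then have o: "((\<lambda>n. - ln (1 - q ^ Suc n)) has_sum - ln (euler q)) UNIV"
  proof (rule sums_nonneg_imp_has_sum)
    show "0 \<le> - ln (1 - q ^ Suc n)" for n using unit_pow[OF q, of "Suc n"] by simp
  qed
  have nn: "?h z \<ge> 0" for z using q by (auto split: prod.split)
  have "(\<lambda>z. norm (?h z)) summable_on (UNIV \<times> UNIV)"
    unfolding Infinite_Sum.abs_summable_on_Sigma_iff
  proof (intro conjI ballI)
    show "(\<lambda>k. norm (?h (n, k))) summable_on UNIV" for n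
      using summable_on_iff_abs_summable_on_real[THEN iffD1, OF has_sum_imp_summable[OF i]] by simp
    have "infsum (\<lambda>k. norm (?h (n, k))) UNIV = - ln (1 - q ^ Suc n)" for n
    proof -
      have "(\<lambda>k. norm (?h (n, k))) = (\<lambda>k. ?h (n, k))" using nn
          by (intro ext) (simp only: real_norm_def abs_of_nonneg)
      then show ?thesis using infsumI[OF i[of n]] by (simp only:)
    qed
    then show "(\<lambda>n. norm (infsum (\<lambda>k. norm (?h (n, k))) UNIV)) summable_on UNIV"
      using summable_on_iff_abs_summable_on_real[THEN iffD1, OF has_sum_imp_summable[OF o]] by simp
  qed
  then have "?h summable_on (UNIV \<times> UNIV)" by (rule summable_on_iff_abs_summable_on_real[THEN
      iffD2])
  from has_sum_SigmaI[OF i o this] show ?thesis by simp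
qed

text \<open>Differentiation multiplies \<open>q ^ (d * k) / k\<close> by \<open>d * k\<close> and
  leaves the coefficient d; collecting the pairs with \<open>d * k = n\<close> gives the divisor
  sum.\<close>

lemma euler_log_deriv:
  fixes q :: real
  assumes q: "0 < q" "q < 1"
  obtains E' where "(euler has_real_derivative E') (at q)"
    "(\<lambda>n. (if n = 0 then 0 else real (sig 1 n)) * q ^ n) sums (- (q * E' / euler q))"
proof -
  let ?c = "\<lambda>z::nat \<times> nat. case z of (n, k) \<Rightarrow> 1 / real (Suc k)" and ?f
      = "\<lambda>z. case z of (n, k) \<Rightarrow> Suc n * Suc k"
  have fin: "finite {z \<in> UNIV. ?f z = N}" for N
  proof (rule finite_subset)
    show "{z \<in> UNIV. ?f z = N} \<subseteq> {..N} \<times> {..N}" by (auto simp: le_SucI)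
  qed simp
  obtain F' where F': "((\<lambda>q. - ln (euler q)) has_real_derivative F') (at q)"
     "((\<lambda>z. ?c z * real (?f z) * q ^ ?f z) has_sum q * F') UNIV"
    by (rule has_sum_deriv[where c = ?c and f = ?f and I = UNIV and F = "\<lambda>q. - ln (euler q)" and q
        = q, OF euler_log_has_sum fin q])
  have e: "euler q > 0" using euler_pos[of q] q by simp
  define G where "G = (\<lambda>q::real. - ln (euler q))"
  have "(G has_real_derivative F') (at q)" using F'(1) by (simp add: G_def)
  then have "((\<lambda>q. exp (- G q)) has_real_derivative (exp (- G q) * (- F'))) (at q)"
    by (auto intro!: derivative_eq_intros)
  then have "((\<lambda>q. exp (- G q)) has_real_derivative (euler q * - F')) (at q)" using e
      by (simp add: G_def)
  then have dE: "(euler has_real_derivative (euler q * - F')) (at q)"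
    by (rule has_field_derivative_transform_within_open[where S = "{0<..<1}"])
        (use q euler_pos in \<open>auto simp: G_def\<close>)
  have grp: "(\<lambda>n. (\<Sum>z | z \<in> UNIV \<and> ?f z = n. ?c z * real (?f z)) * q ^ n) sums (q * F')"
    by (rule has_sum_group_power[OF F'(2) fin])
  have coef: "(\<Sum>z | z \<in> UNIV \<and> ?f z = n. ?c z * real (?f z)) = (if n
      = 0 then 0 else real (sig 1 n))" for n
  proof (cases "n = 0")
    case False
    have "(\<Sum>z | z \<in> UNIV \<and> ?f z = n. ?c z * real (?f z)) = (\<Sum>d | d dvd n. real d)"
    proof (rule sum.reindex_bij_witness[of _ "\<lambda>d. (d - 1, n div d - 1)" "\<lambda>z. Suc (fst z)"])
      fix d assume "d \<in> {d. d dvd n}"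
      then obtain k where k: "n = d * k" by auto
      then have "d > 0" "k > 0" "n div d = k" using False by auto
      then show "(d - 1, n div d - 1) \<in> {z \<in> UNIV. ?f z = n}" using k by (cases d; cases k) auto
      show "Suc (fst (d - 1, n div d - 1)) = d" using \<open>d > 0\<close> by simp
    next
      fix z assume "z \<in> {z \<in> UNIV. ?f z = n}"
      then have z: "n = Suc (fst z) * Suc (snd z)" by (auto split: prod.splits)
      show "(Suc (fst z) - 1, n div Suc (fst z) - 1) = z"
          unfolding z nonzero_mult_div_cancel_left[OF Suc_not_Zero] by simp
      show "Suc (fst z) \<in> {d. d dvd n}" unfolding z mem_Collect_eq by (rule dvd_triv_left)
      show "real (Suc (fst z)) = ?c z * real (?f z)"
        by (cases z) (simp only: prod.case fst_conv of_nat_mult, simp del: of_nat_Suc)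
    qed
    then show ?thesis using False by (simp add: sig_def)
  next
    case True
    then have "{z \<in> UNIV. ?f z = n} = {}" by (auto simp: case_prod_unfold)
    then have "(\<Sum>z | z \<in> UNIV \<and> ?f z = n. ?c z * real (?f z)) = 0" by (simp only: sum.empty)
    then show ?thesis using True by (simp only: simp_thms if_True)
  qed
  have "- (q * (euler q * - F') / euler q) = q * F'" using e by simp
  then have "(\<lambda>n. (if n = 0 then 0 else real (sig 1 n)) * q ^ n) sums (- (q * (euler q * - F')
      / euler q))"
    using grp unfolding coef by (simp only:)
  then show ?thesis by (rule that[OF dE])
qed

section \<open>Liouville's identity for odd quadruples\<close>

text \<open>Liouville's method: the quadruples \<open>ax + by = 2N\<close> with odd entries are
  regrouped by \<open>c = |a - b|\<close> and by \<open>c = a + b\<close>. Both groupings lead to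
  solutions of \<open>cx + bz = 2N\<close> with \<open>c\<close>, \<open>z\<close> even, restricted
  by \<open>x < z\<close> and by \<open>b < c\<close> respectively; reducing \<open>b\<close> modulo
  \<open>c\<close> matches the two restrictions.\<close>

definition LQ :: "nat \<Rightarrow> (nat \<times> nat \<times> nat \<times> nat) set" where
  "LQ N = {(a, x, b, y). odd a \<and> odd x \<and> odd b \<and> odd y \<and> a * x + b * y = 2 * N}"

definition LW :: "nat \<Rightarrow> (nat \<times> nat \<times> nat \<times> nat) set" where
  "LW N = {(c, x, b, z). even c \<and> c > 0 \<and> even z \<and> z > 0 \<and> odd x \<and> odd b \<and> c * x + b * z = 2 * N}"

lemma le_of_prod_sum:
  fixes a x r n :: nat
  assumes "a * x + r = n" "a > 0" "x > 0" shows "a \<le> n" "x \<le> n"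
proof -
  have "a \<le> a * x" "x \<le> a * x" using assms by simp_all
  then show "a \<le> n" "x \<le> n" unfolding assms(1)[symmetric] by (simp_all add: trans_le_add1)
qed

lemma finite_LQ: "finite (LQ N)"
proof (rule finite_subset)
  show "LQ N \<subseteq> {..2*N} \<times> {..2*N} \<times> {..2*N} \<times> {..2*N}"
    unfolding LQ_def using le_of_prod_sum odd_pos by (clarsimp) (metis add.commute)
qed auto

text \<open>For \<open>b < a\<close> one has \<open>a x + b y = (a - b) x + b (x + y)\<close>, so
  \<open>c = a - b\<close> and \<open>z = x + y\<close> are even and \<open>x < z\<close>. The case
  \<open>a < b\<close> is its mirror image, and \<open>a = b\<close> contributes nothing.\<close>

lemma liouville_diff:
  "(\<Sum>(a, x, b, y)\<in>LQ N. (int a - int b)\<^sup>2) = 2 * (\<Sum>(c, x, b, z)\<in>{(c, x, b, z)\<in>LW N. x < z}. (int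
      c)\<^sup>2)"
proof -
  let ?f = "\<lambda>(a, x, b, y). (int a - int b)\<^sup>2"
  let ?G = "{(a, x, b, y)\<in>LQ N. b < a}" and ?E = "{(a, x, b, y)\<in>LQ N. a = b}" and ?L
      = "{(a, x, b, y)\<in>LQ N. a < b}"
  have U: "LQ N = ?E \<union> (?G \<union> ?L)" by auto
  have "sum ?f (LQ N) = sum ?f ?E + (sum ?f ?G + sum ?f ?L)"
    apply (subst U, subst sum.union_disjoint)
    using finite_LQ[of N] apply (auto intro: finite_subset[rotated])[3]
    apply (subst sum.union_disjoint)
    using finite_LQ[of N] by (auto intro: finite_subset[rotated])
  moreover have "sum ?f ?E = 0" by (rule sum.neutral) auto
  moreover have "sum ?f ?L = sum ?f ?G"
    by (rule sum.reindex_bij_witness[of _ "\<lambda>(a, x, b, y). (b, y, a, x)" "\<lambda>(a, x, b, y). (b, y, a,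
        x)"])
       (auto simp: LQ_def add.commute power2_commute)
  moreover have "sum ?f ?G = (\<Sum>(c, x, b, z)\<in>{(c, x, b, z)\<in>LW N. x < z}. (int c)\<^sup>2)"
  proof (rule sum.reindex_bij_witness[of _ "\<lambda>(c, x, b, z). (b + c, x, b, z
      - x)" "\<lambda>(a, x, b, y). (a - b, x, b, x + y)"], goal_cases)
    case (1 w) then show ?case by auto
  next
    case (2 w)
    obtain a x b y where w: "w = (a, x, b, y)" by (cases w)
    from 2 have h: "odd a" "odd x" "odd b" "odd y" "a * x + b * y = 2 * N" "b < a"
        by (auto simp: w LQ_def)
    obtain d where d: "a = b + d" "d > 0" using h(6) less_imp_add_positive by blast
    have "d * x + b * (x + y) = 2 * N" using h(5) by (simp add: d algebra_simps)
    then show ?case using h d odd_pos[of y] by (auto simp: w LW_def)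
  next
    case (3 w) then show ?case by auto
  next
    case (4 w)
    obtain c x b z where w: "w = (c, x, b, z)" by (cases w)
    from 4 have h: "even c" "c > 0" "even z" "odd x" "odd b" "c * x + b * z = 2 * N" "x < z"
        by (auto simp: w LW_def)
    obtain d where d: "z = x + d" "d > 0" using h(7) less_imp_add_positive by blast
    have "(b + c) * x + b * d = 2 * N" using h(6) by (simp add: d algebra_simps)
    then show ?case using h d by (auto simp: w LQ_def)
  next
    case (5 w) then show ?case by (auto simp: of_nat_diff)
  qed
  ultimately show ?thesis by simp
qed

text \<open>Here \<open>a x + b y = (a + b) y + a (x - y)\<close> for \<open>y < x\<close>, so
  \<open>c = a + b\<close> exceeds the new third entry a. The diagonal \<open>x = y\<close> survives
  and yields the final value.\<close>

lemma liouville_sum: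
  "(\<Sum>(a, x, b, y)\<in>LQ N. (int a + int b)\<^sup>2) = (\<Sum>(a, x, b, y)\<in>{(a, x, b, y)\<in>LQ N. x = y}. (int a
      + int b)\<^sup>2)
     + 2 * (\<Sum>(c, x, b, z)\<in>{(c, x, b, z)\<in>LW N. b < c}. (int c)\<^sup>2)"
proof -
  let ?f = "\<lambda>(a, x, b, y). (int a + int b)\<^sup>2"
  let ?G = "{(a, x, b, y)\<in>LQ N. y < x}" and ?E = "{(a, x, b, y)\<in>LQ N. x = y}" and ?L
      = "{(a, x, b, y)\<in>LQ N. x < y}"
  have U: "LQ N = ?E \<union> (?G \<union> ?L)" by auto
  have "sum ?f (LQ N) = sum ?f ?E + (sum ?f ?G + sum ?f ?L)"
    apply (subst U, subst sum.union_disjoint)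
    using finite_LQ[of N] apply (auto intro: finite_subset[rotated])[3]
    apply (subst sum.union_disjoint)
    using finite_LQ[of N] by (auto intro: finite_subset[rotated])
  moreover have "sum ?f ?L = sum ?f ?G"
    by (rule sum.reindex_bij_witness[of _ "\<lambda>(a, x, b, y). (b, y, a, x)" "\<lambda>(a, x, b, y). (b, y, a,
        x)"])
       (auto simp: LQ_def add.commute)
  moreover have "sum ?f ?G = (\<Sum>(c, x, b, z)\<in>{(c, x, b, z)\<in>LW N. b < c}. (int c)\<^sup>2)"
  proof (rule sum.reindex_bij_witness[of _ "\<lambda>(c, x, b, z). (b, x + z, c
      - b, x)" "\<lambda>(a, x, b, y). (a + b, y, a, x - y)"], goal_cases)
    case (1 w) then show ?case by auto
  next
    case (2 w)
    obtain a x b y where w: "w = (a, x, b, y)" by (cases w)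
    from 2 have h: "odd a" "odd x" "odd b" "odd y" "a * x + b * y = 2 * N" "y < x"
        by (auto simp: w LQ_def)
    obtain d where d: "x = y + d" "d > 0" using h(6) less_imp_add_positive by blast
    have "(a + b) * y + a * d = 2 * N" using h(5) by (simp add: d algebra_simps)
    then show ?case using h d odd_pos[of b] by (auto simp: w LW_def)
  next
    case (3 w) then show ?case by auto
  next
    case (4 w)
    obtain c x b z where w: "w = (c, x, b, z)" by (cases w)
    from 4 have h: "even c" "c > 0" "even z" "odd x" "odd b" "c * x + b * z = 2
        * N" "b < c" "z > 0" by (auto simp: w LW_def)
    obtain d where d: "c = b + d" "d > 0" using h(7) less_imp_add_positive by blast
    have "b * (x + z) + d * x = 2 * N" using h(6) by (simp add: d algebra_simps)
    then show ?case using h d by (auto simp: w LQ_def)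
  next
    case (5 w) then show ?case by auto
  qed
  ultimately show ?thesis by simp
qed

text \<open>Multiples of c are moved from b into x, by
  \<open>c x + b z = c (x + (b div c) z) + (b mod c) z\<close>. The entry c is unchanged, and since
  c and z are even the parities of x and b are preserved; the inverse reduces x modulo z.\<close>

lemma liouville_exchange:
  "(\<Sum>(c, x, b, z)\<in>{(c, x, b, z)\<in>LW N. x < z}. (int c)\<^sup>2)
      = (\<Sum>(c, x, b, z)\<in>{(c, x, b, z)\<in>LW N. b < c}. (int c)\<^sup>2)"
proof (rule sum.reindex_bij_witness[of _ "\<lambda>(c, x, b, z). (c, x mod z, b + x div z
    * c, z)" "\<lambda>(c, x, b, z). (c, x + b div c * z, b mod c, z)"], goal_cases)
  case (1 w)
  then show ?case by (auto simp: LW_def)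
next
  case (2 w)
  obtain c x b z where w: "w = (c, x, b, z)" by (cases w)
  from 2 have h: "even c" "c > 0" "even z" "z > 0" "odd x" "odd b" "c * x + b * z = 2 * N" "x < z"
      by (auto simp: w LW_def)
  have "c * (x + b div c * z) + b mod c * z = c * x + (b div c * c + b mod c) * z"
      by (simp only: algebra_simps)
  then have "c * (x + b div c * z) + b mod c * z = 2 * N" using h(7) by simp
  moreover have "odd (b mod c)" using h(1,6) by (metis dvd_mod_iff)
  ultimately show ?case using h by (auto simp: w LW_def)
next
  case (3 w)
  then show ?case by (auto simp: LW_def)
next
  case (4 w)
  obtain c x b z where w: "w = (c, x, b, z)" by (cases w)
  from 4 have h: "even c" "c > 0" "even z" "z > 0" "odd x" "odd b" "c * x + b * z = 2 * N" "b < c"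
      by (auto simp: w LW_def)
  have "c * (x mod z) + (b + x div z * c) * z = c * (x div z * z + x mod z) + b * z"
      by (simp only: algebra_simps)
  then have "c * (x mod z) + (b + x div z * c) * z = 2 * N" using h(7) by simp
  moreover have "odd (x mod z)" using h(3,5) by (metis dvd_mod_iff)
  ultimately show ?case using h by (auto simp: w LW_def)
next
  case (5 w) then show ?case by auto
qed

definition tcub :: "nat \<Rightarrow> nat" where "tcub N = (\<Sum>d | d dvd N \<and> odd (N div d). d ^ 3)"

text \<open>If \<open>x = y\<close>, then \<open>d = (a + b) / 2\<close> divides N with odd cofactor
  x. There are d choices of the odd number a below \<open>2 * d\<close>, each contributing
  \<open>4 * d ^ 2\<close>.\<close>

lemma liouville_diag:
  "(\<Sum>(a, x, b, y)\<in>{(a, x, b, y)\<in>LQ N. x = y}. (int a + int b)\<^sup>2) = 4 * int (tcub N)"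
proof -
  let ?D = "{d. d dvd N \<and> odd (N div d)}"
  have D: "finite ?D"
  proof (cases "N = 0")
    case False then show ?thesis by (intro finite_subset[OF _ finite_atMost[of N]]) (auto dest:
        dvd_imp_le)
  qed simp
  have "(\<Sum>(a, x, b, y)\<in>{(a, x, b, y)\<in>LQ N. x = y}. (int a + int b)\<^sup>2)
      = (\<Sum>(d, j)\<in>Sigma ?D (\<lambda>d. {..<d}). 4 * (int d)\<^sup>2)"
  proof (rule sum.reindex_bij_witness[of _ "\<lambda>(d, j). (2 * j + 1, N div d, 2 * (d - j)
      - 1, N div d)" "\<lambda>(a, x, b, y). ((a + b) div 2, a div 2)"], goal_cases)
    case (1 w)
    obtain a x b y where w: "w = (a, x, b, y)" by (cases w)
    from 1 have h: "odd a" "odd x" "odd b" "a * x + b * x = 2 * N" "x = y" by (auto simp: w LQ_def)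
    obtain i j where ij: "a = 2 * i + 1" "b = 2 * j + 1" using h by (auto elim!: oddE)
    have N: "N = (i + j + 1) * x" using h(4) by (simp add: ij algebra_simps)
    have "(a + b) div 2 = i + j + 1" "a div 2 = i" by (simp_all add: ij)
    moreover have "N div (i + j + 1) = x" unfolding N by (rule nonzero_mult_div_cancel_left) simp
    ultimately show ?case using h(5) ij by (simp add: w)
  next
    case (2 w)
    obtain a x b y where w: "w = (a, x, b, y)" by (cases w)
    from 2 have h: "odd a" "odd x" "odd b" "a * x + b * x = 2 * N" "x = y" by (auto simp: w LQ_def)
    obtain i j where ij: "a = 2 * i + 1" "b = 2 * j + 1" using h by (auto elim!: oddE)
    have N: "N = (i + j + 1) * x" using h(4) by (simp add: ij algebra_simps)
    have "(a + b) div 2 = i + j + 1" "a div 2 = i" by (simp_all add: ij)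
    moreover have "N div (i + j + 1) = x" unfolding N by (rule nonzero_mult_div_cancel_left) simp
    moreover have "i + j + 1 dvd N" unfolding N by (rule dvd_triv_left)
    ultimately show ?case using h(2) by (simp add: w)
  next
    case (3 w)
    obtain d j where w: "w = (d, j)" by (cases w)
    from 3 have "j < d" by (simp add: w)
    then show ?case by (simp add: w)
  next
    case (4 w)
    obtain d j where w: "w = (d, j)" by (cases w)
    from 4 have h: "j < d" "d dvd N" "odd (N div d)" by (simp_all add: w)
    define x where "x = N div d"
    have N: "N = d * x" using h(2) by (simp add: x_def)
    obtain i where i: "d = j + 1 + i" using h(1) by (metis Suc_eq_plus1 less_iff_Suc_add add_Suc)
    have "(2 * j + 1) * x + (2 * (d - j) - 1) * x = 2 * N" unfolding N
        by (simp add: i algebra_simps)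
    then show ?case using h by (simp add: w LQ_def x_def[symmetric])
  next
    case (5 w)
    obtain a x b y where w: "w = (a, x, b, y)" by (cases w)
    from 5 have h: "odd a" "odd b" by (auto simp: w LQ_def)
    then obtain i j where ij: "a = 2 * i + 1" "b = 2 * j + 1" by (auto elim!: oddE)
    have "(a + b) div 2 = i + j + 1" by (simp add: ij)
    then show ?case by (simp add: w ij power2_eq_square algebra_simps)
  qed
  also have "\<dots> = (\<Sum>d\<in>?D. \<Sum>j<d. 4 * (int d)\<^sup>2)" by (rule sum.Sigma[symmetric]) (use D in auto)
  also have "\<dots> = 4 * int (tcub N)" by (simp add: tcub_def sum_distrib_left power3_eq_cube
      power2_eq_square algebra_simps)
  finally show ?thesis .
qed

text \<open>Polarisation: \<open>4 a b = (a + b)^2 - (a - b)^2\<close>. The off-diagonal sums cancel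
  by \<open>liouville_exchange\<close>.\<close>

theorem liouville_odd: "(\<Sum>(a, x, b, y)\<in>LQ N. a * b) = tcub N"
proof -
  have "4 * (\<Sum>(a, x, b, y)\<in>LQ N. int a * int b) = (\<Sum>(a, x, b, y)\<in>LQ N. (int a + int b)\<^sup>2)
      - (\<Sum>(a, x, b, y)\<in>LQ N. (int a - int b)\<^sup>2)"
    unfolding sum_distrib_left sum_subtractf[symmetric]
        by (intro sum.cong) (auto simp: power2_eq_square algebra_simps)
  also have "\<dots> = 4 * int (tcub N)" unfolding liouville_diff liouville_sum liouville_diag
      liouville_exchange by simp
  finally have "(\<Sum>(a, x, b, y)\<in>LQ N. int a * int b) = int (tcub N)" by simp
  moreover have "(\<Sum>(a, x, b, y)\<in>LQ N. int a * int b) = int (\<Sum>(a, x, b, y)\<in>LQ N. a * b)"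
    by (simp add: case_prod_unfold)
  ultimately show ?thesis by (simp only: of_nat_eq_iff)
qed

definition oddsig :: "nat \<Rightarrow> nat" where "oddsig n = (if odd n then sig 1 n else 0)"

text \<open>Expanding both divisor sums turns the convolution into a sum of \<open>a * b\<close>
  over \<open>LQ\<close>, with \<open>i = a x\<close> and \<open>n - i = b y\<close>. For odd n one
  of i and \<open>n - i\<close> is even and the product vanishes.\<close>

lemma oddsig_conv: "(\<Sum>i\<le>n. oddsig i * oddsig (n - i)) = (if even n then tcub (n div 2) else 0)"
proof (cases "even n")
  case False
  then have "oddsig i * oddsig (n - i) = 0" if "i \<le> n" for i using that by (auto simp: oddsig_def)
  then show ?thesis using False by simp
next
  case True
  then obtain N where N: "n = 2 * N" by auto
  let ?I = "{i. i \<le> n \<and> odd i}"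
  have fin: "finite {a. a dvd i}" if "odd i" for i :: nat using odd_pos[OF that] by simp
  have odd': "odd (n - i)" if "i \<in> ?I" for i using that N by auto
  have "(\<Sum>i\<le>n. oddsig i * oddsig (n - i)) = (\<Sum>i\<in>?I. oddsig i * oddsig (n - i))"
    by (rule sum.mono_neutral_right) (auto simp: oddsig_def)
  also have "\<dots> = (\<Sum>i\<in>?I. \<Sum>(a, b)\<in>{a. a dvd i} \<times> {b. b dvd (n - i)}. a * b)"
    by (intro sum.cong) (use odd' in \<open>auto simp: oddsig_def sig_def sum_product
        sum.cartesian_product\<close>)
  also have "\<dots> = (\<Sum>(i, a, b)\<in>Sigma ?I (\<lambda>i. {a. a dvd i} \<times> {b. b dvd (n - i)}). a * b)"
    by (subst sum.Sigma) (use fin odd' in auto)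
  also have "\<dots> = (\<Sum>(a, x, b, y)\<in>LQ N. a * b)"
  proof (rule sum.reindex_bij_witness[of _ "\<lambda>(a, x, b, y). (a
      * x, a, b)" "\<lambda>(i, a, b). (a, i div a, b, (n - i) div b)"], goal_cases)
    case (1 w) then show ?case by auto
  next
    case (2 w)
    obtain i a b where w: "w = (i, a, b)" by (cases w)
    from 2 have h: "i \<le> n" "odd i" "a dvd i" "b dvd (n - i)" by (auto simp: w)
    obtain x y where xy: "i = a * x" "n - i = b * y" using h by (auto elim!: dvdE)
    have o: "odd (n - i)" using h N by auto
    have "odd a" "odd x" using h(2) xy(1) by auto
    moreover have "odd b" "odd y" using o unfolding xy(2) by auto
    moreover have "a * x + b * y = 2 * N" using xy h(1) N by simp
    moreover have "i div a = x" "(n - i) div b = y" using xy \<open>odd a\<close> \<open>odd b\<close> odd_pos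
        by (metis nonzero_mult_div_cancel_left less_numeral_extra(3))+
    ultimately show ?case by (simp add: w LQ_def)
  next
    case (3 w)
    obtain a x b y where w: "w = (a, x, b, y)" by (cases w)
    from 3 have h: "odd a" "odd x" "odd b" "odd y" "a * x + b * y = 2 * N" by (auto simp: w LQ_def)
    then have "n - a * x = b * y" "a > 0" "b > 0" using N odd_pos by auto
    then show ?case by (simp add: w)
  next
    case (4 w)
    obtain a x b y where w: "w = (a, x, b, y)" by (cases w)
    from 4 have h: "odd a" "odd x" "odd b" "odd y" "a * x + b * y = 2 * N" by (auto simp: w LQ_def)
    then have "n - a * x = b * y" "a * x \<le> n" using N by auto
    then show ?case using h by (simp add: w)
  next
    case (5 w) then show ?case by auto
  qed
  finally show ?thesis using True N by (simp add: liouville_odd)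
qed

section \<open>Sums of eight squares\<close>

lemma sums_pseries_pos: "pseries F a \<Longrightarrow> 0 < q \<Longrightarrow> q < 1 \<Longrightarrow> (\<lambda>n. a n * q ^ n) sums F q"
  by (simp add: pseries_def)

lemma euler_deriv_power:
  fixes q :: real
  assumes q: "0 < q" "q < 1" and m: "m > 0"
  obtains E' where "((\<lambda>q. euler (q ^ m)) has_real_derivative E') (at q)"
    "(\<lambda>n. (if m dvd n then (if n div m = 0 then 0 else real (sig 1 (n div m))) else 0) * q ^ n)
        sums (- (q * E' / euler (q ^ m)) / real m)"
proof -
  obtain E' where E: "(euler has_real_derivative E') (at (q ^ m))"
    "(\<lambda>n. (if n = 0 then 0 else real (sig 1 n)) * (q ^ m) ^ n) sums (- (q ^ m * E'
        / euler (q ^ m)))"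
    using euler_log_deriv unit_pow(1,2)[OF q m] by blast
  have "((\<lambda>q. q ^ m) has_real_derivative (real m * q ^ (m - 1))) (at q)"
    by (auto intro!: derivative_eq_intros)
  from DERIV_chain2[OF E(1) this] have d: "((\<lambda>q. euler (q ^ m)) has_real_derivative (E' * (real m
      * q ^ (m - 1)))) (at q)" .
  have "q ^ m = q * q ^ (m - 1)" using m by (cases m) auto
  then have "- (q ^ m * E' / euler (q ^ m)) = - (q * (E' * (real m * q ^ (m - 1)))
      / euler (q ^ m)) / real m"
    using m by (simp add: field_simps)
  then show ?thesis using that[OF d] sums_subst_power[OF E(2) m] by simp
qed

text \<open>The logarithmic derivative of \<open>lamb\<close> is computed twice:
  \<open>lamb_deriv\<close> gives \<open>thA (- q) ^ 4 / q\<close>, and the eta quotient gives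
  divisor sums. This is the odd case of Jacobi's four squares theorem.\<close>

lemma thA4_odd_coeff:
  assumes a: "pseries (\<lambda>q. thA q ^ 4) a" and n: "odd n"
  shows "a n = 8 * real (sig 1 n)"
proof -
  define L where "L m n = (if m dvd n then (if n div m
      = 0 then 0 else real (sig 1 (n div m))) else 0)" for m n :: nat
  \<comment> \<open>The logarithmic derivatives of \<open>euler (q ^ m)\<close> for m = 1, 2, 4
    enter with weights 8, -24, 16, and each expands as -m times the series of
    \<open>L m\<close>.\<close>
  define b where "b n = (if n = 0 then 1 else 0) + (- 8 * L 1 n + (48 * L 2 n + (- 64 * L 4 n)))"
      for n
  have "(\<lambda>n. b n * q ^ n) sums (thA (- q) ^ 4)" if q: "0 < q" "q < 1" for q
  proof -
    note ED = euler_deriv_power[OF q, folded L_def]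
    obtain E1 where E1: "((\<lambda>q. euler (q ^ 1)) has_real_derivative E1) (at q)" "(\<lambda>n. L 1 n * q ^ n)
        sums (- (q * E1 / euler (q ^ 1)) / real 1)"
      by (rule ED[of 1]) simp_all
    obtain E2 where E2: "((\<lambda>q. euler (q ^ 2)) has_real_derivative E2) (at q)" "(\<lambda>n. L 2 n * q ^ n)
        sums (- (q * E2 / euler (q ^ 2)) / real 2)"
      by (rule ED[of 2]) simp_all
    obtain E4 where E4: "((\<lambda>q. euler (q ^ 4)) has_real_derivative E4) (at q)" "(\<lambda>n. L 4 n * q ^ n)
        sums (- (q * E4 / euler (q ^ 4)) / real 4)"
      by (rule ED[of 4]) simp_all
    define e1 e2 e4 where "e1 = (\<lambda>q::real. euler q)" and "e2 = (\<lambda>q::real. euler (q ^ 2))" and "e4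
        = (\<lambda>q::real. euler (q ^ 4))"
    have pos: "e1 x > 0" "e2 x > 0" "e4 x > 0" if "0 < x" "x < 1" for x
      using that unit_pow[of x] by (simp_all add: e1_def e2_def e4_def euler_pos)
    have d: "(e1 has_real_derivative E1) (at q)" "(e2 has_real_derivative E2) (at q)" "(e4
        has_real_derivative E4) (at q)"
      using E1(1) E2(1) E4(1) by (simp_all add: e1_def e2_def e4_def)
    have ln_lamb: "ln (lamb x) = ln x + (4 * (ln 2 + 2 * ln (e4 x) - ln (e2 x)) - 4 * (5
        * ln (e2 x) - (2 * ln (e1 x) + 2 * ln (e4 x))))"
      if x: "0 < x" "x < 1" for x
    proof -
      have ax: "\<bar>x\<bar> < 1" using x by simp
      have A: "thA x = e2 x ^ 5 / (e1 x ^ 2 * e4 x ^ 2)" and B: "thB x = 2 * e4 x ^ 2 / e2 x"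
        unfolding thA_eta[OF ax] thB_def by (simp_all add: e1_def e2_def e4_def)
      have "ln (thA x) = 5 * ln (e2 x) - (2 * ln (e1 x) + 2 * ln (e4 x))" "ln (thB x) = ln 2 + 2
          * ln (e4 x) - ln (e2 x)"
        unfolding A B using pos[OF x] by (simp_all add: ln_mult ln_div ln_realpow)
      moreover have "ln (lamb x) = ln x + (4 * ln (thB x) - 4 * ln (thA x))"
        unfolding lamb_def using thA_pos[OF ax] thB_pos[OF ax] x
            by (simp add: ln_mult ln_div ln_realpow)
      ultimately show ?thesis by simp
    qed
    have "((\<lambda>x. ln x + (4 * (ln 2 + 2 * ln (e4 x) - ln (e2 x)) - 4 * (5 * ln (e2 x) - (2
        * ln (e1 x) + 2 * ln (e4 x))))) has_real_derivative
       (1 / q + (4 * (2 * (E4 / e4 q) - E2 / e2 q) - 4 * (5 * (E2 / e2 q) - (2 * (E1 / e1 q) + 2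
           * (E4 / e4 q)))))) (at q)"
      using pos[OF q] q by (auto intro!: derivative_eq_intros d simp: algebra_simps)
    then have "((\<lambda>x. ln (lamb x)) has_real_derivative
       (1 / q + (4 * (2 * (E4 / e4 q) - E2 / e2 q) - 4 * (5 * (E2 / e2 q) - (2 * (E1 / e1 q) + 2
           * (E4 / e4 q)))))) (at q)"
      by (rule has_field_derivative_transform_within_open[where S = "{0<..<1}"])
          (use q ln_lamb in auto)
    moreover have "((\<lambda>x. ln (lamb x)) has_real_derivative (1 / lamb q * (lamb q * thA (- q) ^ 4
        / q))) (at q)"
      by (rule DERIV_chain2[OF DERIV_ln_divide[OF lamb_bounds(1)[OF q]] lamb_deriv[OF q]])
    ultimately have "1 / lamb q * (lamb q * thA (- q) ^ 4 / q) = 1 / q + (4 * (2 * (E4 / e4 q)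
        - E2 / e2 q) - 4 * (5 * (E2 / e2 q) - (2 * (E1 / e1 q) + 2 * (E4 / e4 q))))"
      using DERIV_unique by blast
    then have "thA (- q) ^ 4 / q = 1 / q + (4 * (2 * (E4 / e4 q) - E2 / e2 q) - 4 * (5 * (E2
        / e2 q) - (2 * (E1 / e1 q) + 2 * (E4 / e4 q))))"
      using lamb_bounds(1)[OF q] by simp
    then have "thA (- q) ^ 4 = q * (1 / q + (4 * (2 * (E4 / e4 q) - E2 / e2 q) - 4 * (5 * (E2
        / e2 q) - (2 * (E1 / e1 q) + 2 * (E4 / e4 q)))))"
      using q by (simp only: divide_eq_eq) (simp add: mult.commute)
    then have t: "thA (- q) ^ 4 = 1 + 8 * (q * E1 / e1 q) - 24 * (q * E2 / e2 q) + 16 * (q * E4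
        / e4 q)"
      using q by (simp add: distrib_left right_diff_distrib mult_ac)
    have "(\<lambda>n. (if n = 0 then 1 else 0) * q ^ n) sums 1"
    proof -
      have "(\<lambda>n. (if n = 0 then 1 else 0) * q ^ n) = (\<lambda>n. if n = 0 then 1 else 0)"
          by (intro ext) simp
      then show ?thesis using sums_single[of 0 "\<lambda>_. 1::real"] by simp
    qed
    then have "(\<lambda>n. (if n = 0 then 1 else 0) * q ^ n + (- 8 * (L 1 n * q ^ n) + (48 * (L 2 n
        * q ^ n) + (- 64) * (L 4 n * q ^ n)))) sums
       (1 + (- 8 * (- (q * E1 / euler (q ^ 1)) / real 1) + (48 * (- (q * E2 / euler (q ^ 2))
           / real 2) + (- 64) * (- (q * E4 / euler (q ^ 4)) / real 4))))"
      by (intro sums_add sums_mult E1 E2 E4)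
    moreover have "(if n = 0 then 1 else 0) * q ^ n + (- 8 * (L 1 n * q ^ n) + (48 * (L 2 n
        * q ^ n) + (- 64) * (L 4 n * q ^ n))) = b n * q ^ n" for n
      by (simp only: b_def distrib_right mult.assoc)
    moreover have "1 + (- 8 * (- (q * E1 / euler (q ^ 1)) / real 1) + (48 * (- (q * E2
        / euler (q ^ 2)) / real 2) + (- 64) * (- (q * E4 / euler (q ^ 4)) / real 4)))
        = thA (- q) ^ 4"
      unfolding t by (simp add: e1_def e2_def e4_def mult_ac)
    ultimately show ?thesis by (simp only:)
  qed
  moreover have "(\<lambda>n. ((-1) ^ n * a n) * q ^ n) sums (thA (- q) ^ 4)" if "0 < q" "q < 1" for q
    using sums_pseries_pos[OF pseries_minus[OF a] that] .
  ultimately have "b = (\<lambda>n. (-1) ^ n * a n)" by (rule powser_unique[of b "\<lambda>q. thA (- q) ^ 4"])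
  then have "b n = - a n" using n by simp
  moreover have "b n = - 8 * real (sig 1 n)"
  proof -
    have "n \<noteq> 0" "\<not> 2 dvd n" "\<not> 4 dvd n" using n odd_pos[OF n] by (auto dest: dvd_trans[of 2 4])
    then show ?thesis by (simp add: b_def L_def)
  qed
  ultimately show ?thesis by simp
qed

text \<open>By \<open>jacobi_quartic\<close>, \<open>q * thB q ^ 4\<close> is twice the odd part of
  \<open>thA q ^ 4\<close>, so odd coefficients alone determine it.\<close>

lemma oddsig_series:
  assumes q: "0 < q" "q < 1"
  shows "(\<lambda>n. real (oddsig n) * q ^ n) sums (q * thB q ^ 4 / 16)"
proof -
  obtain a where a: "pseries (\<lambda>q. thA q ^ 4) a" using pseries_ex_power[OF thA_pseries, of 3] by auto
  have "(\<lambda>n. 1/32 * (a n * q ^ n - (-1) ^ n * a n * q ^ n)) sums (1/32 * (thA q ^ 4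
      - thA (- q) ^ 4))"
    by (intro sums_mult sums_diff sums_pseries_pos[OF a q] sums_pseries_pos[OF pseries_minus[OF a]
        q])
  moreover have "1/32 * (a n * q ^ n - (-1) ^ n * a n * q ^ n) = 1/2 * (real (oddsig n) * q ^ n)"
      for n
    using thA4_odd_coeff[OF a, of n] by (auto simp: oddsig_def)
  ultimately have "(\<lambda>n. 1/2 * (real (oddsig n) * q ^ n)) sums (1/32 * (thA q ^ 4 - thA (- q) ^ 4))"
    by (simp only:)
  from sums_mult[OF this, of 2] show ?thesis using jacobi_quartic[OF q] by simp
qed

text \<open>Liouville's convolution lives on even exponents, hence the nome
  \<open>p = sqrt q\<close>: the square of the series of \<open>oddsig\<close> at p is a series in
  q, and \<open>thB_square\<close> turns \<open>thB p ^ 8\<close> into theta constants at q.\<close>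

lemma tcub_series:
  assumes q: "0 < q" "q < 1"
  shows "(\<lambda>n. real (tcub n) * q ^ n) sums (thA q ^ 4 * (q * thB q ^ 4) / 16)"
proof -
  define p where "p = sqrt q"
  have p: "0 < p" "p < 1" "p\<^sup>2 = q" using q by (auto simp: p_def)
  have sm: "summable (\<lambda>n. norm (real (oddsig n) * p ^ n))"
    using oddsig_series[OF p(1,2)] p by (auto simp: sums_iff)
  have "(\<lambda>n. \<Sum>i\<le>n. (real (oddsig i) * p ^ i) * (real (oddsig (n - i)) * p ^ (n - i))) sums
      ((\<Sum>n. real (oddsig n) * p ^ n) * (\<Sum>n. real (oddsig n) * p ^ n))"
    by (rule Cauchy_product_sums[OF sm sm])
  moreover have "(\<Sum>n. real (oddsig n) * p ^ n) = p * thB p ^ 4 / 16"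
      using oddsig_series[OF p(1,2)] by (simp add: sums_iff)
  moreover have "(\<Sum>i\<le>n. (real (oddsig i) * p ^ i) * (real (oddsig (n - i)) * p ^ (n - i)))
      = (if even n then real (tcub (n div 2)) else 0) * p ^ n" for n
  proof -
    have "(\<Sum>i\<le>n. (real (oddsig i) * p ^ i) * (real (oddsig (n - i)) * p ^ (n - i)))
        = (\<Sum>i\<le>n. real (oddsig i * oddsig (n - i)) * p ^ n)"
      by (intro sum.cong) (auto simp: mult_ac simp flip: power_add)
    also have "\<dots> = real (\<Sum>i\<le>n. oddsig i * oddsig (n - i)) * p ^ n" by (simp add: sum_distrib_right)
    finally show ?thesis unfolding oddsig_conv by simp
  qed
  ultimately have s: "(\<lambda>n. (if even n then real (tcub (n div 2)) else 0) * p ^ n) sums (p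
      * thB p ^ 4 / 16 * (p * thB p ^ 4 / 16))"
    by simp
  have "(\<lambda>n. (\<lambda>n. (if even n then real (tcub (n div 2)) else 0) * p ^ n) (2 * n)) sums (p
      * thB p ^ 4 / 16 * (p * thB p ^ 4 / 16))"
    by (subst sums_mono_reindex) (use s in \<open>auto simp: strict_mono_def dvd_def\<close>)
  then have s': "(\<lambda>n. real (tcub n) * q ^ n) sums (p * thB p ^ 4 / 16 * (p * thB p ^ 4 / 16))"
    by (simp add: power_mult p(3))
  have "p * thB p ^ 4 / 16 * (p * thB p ^ 4 / 16) = p\<^sup>2 * (thB p ^ 2) ^ 4 / 256"
      by (simp add: power2_eq_square power_numeral_reduce)
  also have "\<dots> = thA q ^ 4 * (q * thB q ^ 4) / 16" unfolding thB_square[OF p(1,2)] p(3)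
      by (simp add: power_mult_distrib)
  finally show ?thesis using s' by (simp only:)
qed

text \<open>This rests on \<open>\<theta>(q) \<theta>(-q) = \<theta>(-q^2)^2\<close>, which turns
  \<open>\<theta>(q)^8 - 16 \<Sum> tcub(n) q^n\<close> into \<open>\<theta>(-q^2)^8\<close>.\<close>

lemma thA8_coeff_rec:
  assumes v: "pseries (\<lambda>q. thA q ^ 8) v"
  shows "v n = 16 * real (tcub n) + (if even n then (-1) ^ (n div 2) * v (n div 2) else 0)"
proof -
  have "v = (\<lambda>n. 16 * real (tcub n) + (if 2 dvd n then (-1) ^ (n div 2) * v (n div 2) else 0))"
  proof (rule powser_unique[of _ "\<lambda>q. thA q ^ 8"])
    fix q :: real assume q: "0 < q" "q < 1"
    show "(\<lambda>n. v n * q ^ n) sums thA q ^ 8" by (rule sums_pseries_pos[OF v q])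
    have q2: "0 < q\<^sup>2" "q\<^sup>2 < 1" using unit_pow[OF q, of 2] by simp_all
    have "(\<lambda>n. 16 * (real (tcub n) * q ^ n) + (if 2 dvd n then (-1) ^ (n div 2)
        * v (n div 2) else 0) * q ^ n) sums
       (16 * (thA q ^ 4 * (q * thB q ^ 4) / 16) + thA (- (q\<^sup>2)) ^ 8)"
      by (intro sums_add sums_mult tcub_series q sums_subst_power sums_pseries_pos[OF
          pseries_minus[OF v]] q2) simp
    moreover have "16 * (thA q ^ 4 * (q * thB q ^ 4) / 16) + thA (- (q\<^sup>2)) ^ 8 = thA q ^ 8"
    proof -
      have aq: "\<bar>q\<bar> < 1" using q by simp
      have pw: "(q\<^sup>2)\<^sup>2 = q ^ 4" by (simp flip: power_mult)
      have e: "euler q > 0" "euler (q\<^sup>2) > 0" "euler (q ^ 4) > 0" using aq q unit_pow[OF q]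
          by (simp_all add: euler_pos)
      have "thA (- (q\<^sup>2)) ^ 2 = thA q * thA (- q)"
        unfolding thA_minus thA_eta[OF aq] pw using e
            by (simp add: field_simps power_numeral_reduce)
      then have "thA (- (q\<^sup>2)) ^ 8 = (thA q * thA (- q)) ^ 4"
          using power_mult[of "thA (- (q\<^sup>2))" 2 4] by simp
      then have "thA (- (q\<^sup>2)) ^ 8 = thA q ^ 4 * (thA q ^ 4 - q * thB q ^ 4)"
        using jacobi_quartic[OF q] by (simp add: power_mult_distrib)
      then show ?thesis by (simp add: algebra_simps flip: power_add)
    qed
    ultimately show "(\<lambda>n. (16 * real (tcub n) + (if 2 dvd n then (-1) ^ (n div 2)
        * v (n div 2) else 0)) * q ^ n) sums thA q ^ 8"
      by (simp only: distrib_right mult.assoc)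
  qed
  from fun_cong[OF this, of n] show ?thesis by simp
qed

text \<open>\<open>s3 m n\<close> is \<open>\<sigma>\<^sub>3(n / m)\<close>, for
  \<open>n > 0\<close>.\<close>

definition s3 :: "nat \<Rightarrow> nat \<Rightarrow> real" where "s3 m n = (if m dvd n then real (sig 3 (n div m)) else 0)"

lemma s3_scale: "m > 0 \<Longrightarrow> s3 (m * k) (m * n) = s3 k n" for k m n :: nat
  by (simp add: s3_def)

lemma sum_filter_split:
  assumes "finite S" shows "sum f S = sum f {x \<in> S. P x} + sum f {x \<in> S. \<not> P x}"
proof -
  have "S = {x \<in> S. P x} \<union> {x \<in> S. \<not> P x}" by auto
  then have "sum f S = sum f ({x \<in> S. P x} \<union> {x \<in> S. \<not> P x})" by (rule arg_cong)
  also have "\<dots> = sum f {x \<in> S. P x} + sum f {x \<in> S. \<not> P x}"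
    by (rule sum.union_disjoint) (use assms in auto)
  finally show ?thesis .
qed

lemma tcub_eq: assumes "n > 0" shows "real (tcub n) = s3 1 n - s3 2 n"
proof -
  have fin: "finite {d. d dvd n}" using assms by simp
  have "sig 3 n = tcub n + (\<Sum>d | d dvd n \<and> even (n div d). d ^ 3)"
    using sum_filter_split[OF fin, of "\<lambda>d. d ^ 3" "\<lambda>d. odd (n div d)"]
    unfolding sig_def tcub_def mem_Collect_eq not_not .
  moreover have "real (\<Sum>d | d dvd n \<and> even (n div d). d ^ 3) = s3 2 n"
  proof (cases "even n")
    case True
    then obtain m where m: "n = 2 * m" by auto
    have "{d. d dvd n \<and> even (n div d)} = {d. d dvd m}"
    proof safe
      fix d assume d: "d dvd n" "even (n div d)"
      then obtain k where "n = d * k" by auto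
      then have "even k" using d assms by auto
      then show "d dvd m" using \<open>n = d * k\<close> m by auto
    next
      fix d assume "d dvd m"
      then obtain k where k: "m = d * k" by auto
      then show "d dvd n" "even (n div d)" using assms m by auto
    qed
    then show ?thesis using m by (simp add: s3_def sig_def)
  next
    case False
    have "{d. d dvd n \<and> even (n div d)} = {}" using False
        by auto (metis dvd_div_mult_self dvd_mult2)
    then show ?thesis using False by (simp only: s3_def sum.empty) simp
  qed
  ultimately show ?thesis by (simp add: s3_def)
qed

text \<open>Even divisors of n are the doubled divisors of \<open>n / 2\<close>, so
  \<open>s3 1 n - 8 * s3 2 n\<close> sums cubes of odd divisors only; these are the same for k and
  \<open>2 * k\<close>.\<close>

lemma s3_double: assumes "k > 0" shows "s3 1 (2 * k) = 9 * s3 1 k - 8 * s3 2 k"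
proof -
  have fin: "finite {d. d dvd n}" if "n > 0" for n :: nat using that by simp
  have odd_part: "real (\<Sum>d | d dvd n \<and> odd d. d ^ 3) = s3 1 n - 8 * s3 2 n" if n: "n > 0"
      for n :: nat
  proof -
    have "sig 3 n = (\<Sum>d | d dvd n \<and> odd d. d ^ 3) + (\<Sum>d | d dvd n \<and> even d. d ^ 3)"
      using sum_filter_split[OF fin[OF n], of "\<lambda>d. d ^ 3" odd]
      unfolding sig_def mem_Collect_eq not_not .
    moreover have "real (\<Sum>d | d dvd n \<and> even d. d ^ 3) = 8 * s3 2 n"
    proof (cases "even n")
      case True
      then obtain m where m: "n = 2 * m" by auto
      have "(\<Sum>d | d dvd n \<and> even d. d ^ 3) = (\<Sum>d | d dvd m. (2 * d) ^ 3)"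
        by (rule sum.reindex_bij_witness[of _ "\<lambda>d. 2 * d" "\<lambda>d. d div 2"]) (auto simp: m)
      then show ?thesis using m by (simp add: s3_def sig_def power_mult_distrib sum_distrib_left)
    next
      case False
      then have "{d. d dvd n \<and> even d} = {}" by (auto dest: dvd_trans)
      then show ?thesis using False by (simp only: s3_def sum.empty) simp
    qed
    ultimately show ?thesis by (simp add: s3_def)
  qed
  have "{d. d dvd 2 * k \<and> odd d} = {d. d dvd k \<and> odd d}"
    by (auto simp: coprime_dvd_mult_right_iff)
  then have "s3 1 (2 * k) - 8 * s3 2 (2 * k) = s3 1 k - 8 * s3 2 k"
    using odd_part[of k] odd_part[of "2 * k"] assms by simp
  moreover have "s3 2 (2 * k) = s3 1 k" using s3_scale[of 2 1 k] by simp
  ultimately show ?thesis by simp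
qed

text \<open>Strong induction through \<open>thA8_coeff_rec\<close>, which halves n. If
  \<open>n / 2\<close> is odd, the sign in the recursion is negative and the higher terms vanish; if
  it is even, the discrepancy is exactly \<open>s3_double\<close>.\<close>

theorem eight_squares:
  assumes v: "pseries (\<lambda>q. thA q ^ 8) v" and n: "n > 0"
  shows "v n = 16 * (s3 1 n - 2 * s3 2 n + 16 * s3 4 n)"
  using n
proof (induction n rule: less_induct)
  case (less n)
  show ?case
  proof (cases "even n")
    case False
    then have "s3 2 n = 0" "s3 4 n = 0" by (auto simp: s3_def dest: dvd_trans[of 2 4])
    then show ?thesis using thA8_coeff_rec[OF v, of n] tcub_eq[OF less.prems] False by simp
  next
    case True
    then obtain m where m: "n = 2 * m" by auto
    then have m0: "m > 0" "m < n" using less.prems by auto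
    have r: "v n = 16 * (s3 1 n - s3 2 n) + (-1) ^ m * (16 * (s3 1 m - 2 * s3 2 m + 16 * s3 4 m))"
      using thA8_coeff_rec[OF v, of n] tcub_eq[OF less.prems] less.IH[OF m0(2,1)] m by simp
    have sc: "s3 2 n = s3 1 m" "s3 4 n = s3 2 m" unfolding m
        using s3_scale[of 2 1 m] s3_scale[of 2 2 m] by simp_all
    show ?thesis
    proof (cases "even m")
      case False
      then have "s3 2 m = 0" "s3 4 m = 0" by (auto simp: s3_def dest: dvd_trans[of 2 4])
      then show ?thesis using r sc False by simp
    next
      case True
      then obtain k where k: "m = 2 * k" by auto
      then have "k > 0" using m0 by simp
      have "s3 2 m = s3 1 k" "s3 4 m = s3 2 k" unfolding k
          using s3_scale[of 2 1 k] s3_scale[of 2 2 k] by simp_all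
      then have "s3 1 m = 9 * s3 2 m - 8 * s3 4 m" using s3_double[OF \<open>k > 0\<close>] k by simp
      then show ?thesis using r sc True by simp
    qed
  qed
qed

section \<open>Algebra on the genus two curve\<close>

text \<open>In this section \<open>m\<close> stands for
  \<open>\<theta>(q)^2 / \<theta>(q^7)^2\<close> and \<open>k\<close> for
  \<open>(\<eta>(2z) / \<eta>(14z))^2 / m\<close>. Both are units on the curve; the involution
  \<open>y \<mapsto> -y\<close> exchanges \<open>\<alpha>\<close> and \<open>\<beta>\<close> and
  takes \<open>m\<close> to \<open>-7 / m\<close> and \<open>k\<close> to
  \<open>1 / k\<close>.\<close>

lemma curve_y:
  fixes al be t s p :: real
  assumes ts: "s = 1 - t" "p = t * s" "0 < t" "0 < s"
    and prod: "al * be = t ^ 8" "(1 - al) * (1 - be) = s ^ 8" and gt: "be < al"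
  obtains y where "y > 0" "y\<^sup>2 = (2 - p) * (2 - 5 * p + 4 * p\<^sup>2)"
    "2 * al = (1 + t ^ 8 - s ^ 8) + 4 * p * (1 - p) * y" "2 * be = (1 + t ^ 8 - s ^ 8) - 4 * p
        * (1 - p) * y"
proof -
  \<comment> \<open>\<alpha> and \<beta> are the roots of a quadratic with sum
    \<open>1 + t ^ 8 - s ^ 8\<close> and product \<open>t ^ 8\<close>. Its discriminant is
    \<open>(4 * p * (1 - p)) ^ 2\<close> times a cubic in p, and y is the square root of that
    cubic.\<close>
  define y where "y = (al - be) / (4 * p * (1 - p))"
  have p0: "p > 0" using ts by simp
  have "p < 1"
  proof -
    have "t * s < 1 * 1" by (rule mult_strict_mono) (use ts in auto)
    then show ?thesis using ts by simp
  qed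
  then have d: "4 * p * (1 - p) > 0" using p0 by simp
  have sm: "al + be = 1 + t ^ 8 - s ^ 8" using prod by (simp add: algebra_simps)
  have df: "al - be = 4 * p * (1 - p) * y" unfolding y_def using d
    by (metis less_irrefl nonzero_mult_div_cancel_left times_divide_eq_right)
  have "(4 * p * (1 - p)) ^ 2 * y\<^sup>2 = (al - be) ^ 2" unfolding df by (simp add: power_mult_distrib)
  also have "\<dots> = (al + be) ^ 2 - 4 * (al * be)" by (simp add: power2_eq_square algebra_simps)
  also have "\<dots> = (1 + t ^ 8 - s ^ 8) ^ 2 - 4 * t ^ 8" unfolding sm prod by simp
  also have "\<dots> = (4 * p * (1 - p)) ^ 2 * ((2 - p) * (2 - 5 * p + 4 * p\<^sup>2))"
    unfolding ts(1,2) by algebra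
  finally have "y\<^sup>2 = (2 - p) * (2 - 5 * p + 4 * p\<^sup>2)" using p0 \<open>p < 1\<close> by simp
  moreover have "y > 0" unfolding y_def using d gt by (intro divide_pos_pos) auto
  ultimately show ?thesis using that sm df by simp
qed

text \<open>The hypothesis determines m only up to sign. The candidate \<open>2 * y + g\<close>
  satisfies the same relation modulo the curve equation, and its product with its conjugate is 7;
  together with \<open>y > 0\<close> this forces it to be positive.\<close>

lemma curve_m:
  fixes al be t s p y m :: real
  assumes ts: "s = 1 - t" "p = t * s" and y: "y > 0" "y\<^sup>2 = (2 - p) * (2 - 5 * p + 4 * p\<^sup>2)"
    and al: "2 * al = (1 + t ^ 8 - s ^ 8) + 4 * p * (1 - p) * y" and be: "2 * be = (1 + t ^ 8
        - s ^ 8) - 4 * p * (1 - p) * y"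
    and gt: "be < al" and m: "m > 0" "m\<^sup>2 * (al - t) = 7 * (t - be)"
  shows "m = 2 * y + (2 * t - 1) * (3 - 2 * p)" "7 / m = 2 * y - (2 * t - 1) * (3 - 2 * p)"
proof -
  define g where "g = (2 * t - 1) * (3 - 2 * p)"
  have nm: "(2 * y + g) * (2 * y - g) = 7"
  proof -
    have "(2 * y + g) * (2 * y - g) = 4 * y\<^sup>2 - g ^ 2" by (simp add: power2_eq_square algebra_simps)
    also have "\<dots> = 7" unfolding y(2) g_def ts by (simp add: algebra_simps power_numeral_reduce)
    finally show ?thesis .
  qed
  have pos: "2 * y + g > 0"
  proof (rule ccontr)
    assume "\<not> 2 * y + g > 0"
    then have "2 * y + g \<le> 0" "2 * y - g \<ge> 0" using y(1) by linarith+
    then have "(2 * y + g) * (2 * y - g) \<le> 0" by (rule mult_nonpos_nonneg)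
    then show False using nm by simp
  qed
  have "2 * ((2 * y + g) ^ 2 * (al - t) - 7 * (t - be)) = (2 * y + g) ^ 2 * (2 * al - 2 * t) - 7
      * (2 * t - 2 * be)"
    by (simp add: algebra_simps)
  \<comment> \<open>The second factor is the exact quotient of the relation by the curve
    equation.\<close>
  also have "\<dots> = (y\<^sup>2 - (2 - p) * (2 - 5 * p + 4 * p\<^sup>2)) * (4 * (1 + t ^ 8 - s ^ 8 - 2 * t) + 16
      * g * p * (1 - p) + 16 * p * (1 - p) * y)"
    unfolding al be g_def ts by algebra
  also have "\<dots> = 0" using y(2) by simp
  finally have "(2 * y + g) ^ 2 * (al - t) = m\<^sup>2 * (al - t)" using m(2) by simp
  moreover have "al \<noteq> t"
  proof
    assume "al = t" then have "be = t" using m(2) by simp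
    then show False using gt \<open>al = t\<close> by simp
  qed
  ultimately have "(2 * y + g) ^ 2 = m\<^sup>2" by simp
  then have e: "m = 2 * y + g" using pos m(1) power2_eq_imp_eq less_imp_le by metis
  moreover from nm have "7 / m = 2 * y - g"
    unfolding e[symmetric] using m(1) by (metis nonzero_mult_div_cancel_left less_irrefl)
  ultimately show "m = 2 * y + (2 * t - 1) * (3 - 2 * p)" "7 / m = 2 * y - (2 * t - 1) * (3 - 2
      * p)"
    by (simp_all only: g_def)
qed

text \<open>On the curve, \<open>p * (2 * p * k) ^ 3 = 8 * (al * (1 - al))\<close>, and the right
  side is p times the cube of a linear function of y. Real cube roots are unique; the conjugate
  linear function gives the inverse of k, since their product is \<open>(2 * p) ^ 2\<close>.\<close>

lemma curve_k:
  fixes al t s p y k :: real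
  assumes ts: "s = 1 - t" "p = t * s" "p > 0" and y: "y\<^sup>2 = (2 - p) * (2 - 5 * p + 4 * p\<^sup>2)"
    and al: "2 * al = (1 + t ^ 8 - s ^ 8) + 4 * p * (1 - p) * y"
    and k: "k > 0" "k ^ 3 * p ^ 4 = al * (1 - al)"
  shows "2 * p * k = (2 - 7 * p + 4 * p\<^sup>2) + (1 - 2 * t) * y" "2 * p / k = (2 - 7 * p + 4 * p\<^sup>2)
      - (1 - 2 * t) * y"
proof -
  define P Q where "P = 2 - 7 * p + 4 * p\<^sup>2" and "Q = 1 - 2 * t"
  define F where "F = (2 - p) * (2 - 5 * p + 4 * p\<^sup>2)"
  have F: "y\<^sup>2 = F" using y by (simp add: F_def)
  define S D where "S = 1 + t ^ 8 - s ^ 8" and "D = 4 * p * (1 - p)"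
  \<comment> \<open>The two components, free of y and linear in y, of
    \<open>p * (P + Q * y) ^ 3 = 2 * (S + D * y) * (2 - (S + D * y))\<close>, after \<open>F\<close>
    replaces the square of y.\<close>
  have 1: "p * (P ^ 3 + 3 * P * Q\<^sup>2 * F) = 2 * (S * (2 - S) - D\<^sup>2 * F)"
    unfolding P_def Q_def F_def S_def D_def ts by algebra
  have 2: "p * (3 * P\<^sup>2 * Q + Q ^ 3 * F) = 2 * (D * (2 - 2 * S))"
    unfolding P_def Q_def F_def S_def D_def ts by algebra
  have "p * (P + Q * y) ^ 3 = p * (P ^ 3 + 3 * P * Q\<^sup>2 * y\<^sup>2) + p * (3 * P\<^sup>2 * Q + Q ^ 3 * y\<^sup>2) * y"
    by algebra
  also have "\<dots> = 2 * (S * (2 - S) - D\<^sup>2 * y\<^sup>2) + 2 * (D * (2 - 2 * S)) * y" unfolding F 1 2 by simp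
  also have "\<dots> = 2 * (S + D * y) * (2 - (S + D * y))" by algebra
  also have "S + D * y = 2 * al" using al by (simp add: S_def D_def)
  finally have "p * (P + Q * y) ^ 3 = 8 * (al * (1 - al))" by simp
  also have "\<dots> = p * (2 * p * k) ^ 3" unfolding k(2)[symmetric]
      by (simp add: power_mult_distrib power_numeral_reduce)
  finally have "(P + Q * y) ^ 3 = (2 * p * k) ^ 3" using ts(3) by simp
  then have e: "P + Q * y = 2 * p * k" by (metis odd_real_root_power_cancel odd_numeral)
  have "(P + Q * y) * (P - Q * y) = P\<^sup>2 - Q\<^sup>2 * y\<^sup>2" by (simp add: power2_eq_square algebra_simps)
  also have "\<dots> = (2 * p) ^ 2" unfolding F P_def Q_def F_def ts(1,2) by algebra
  finally have "(2 * p * k) * (P - Q * y) = (2 * p) ^ 2" unfolding e .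
  then have "k * (P - Q * y) = 2 * p" using ts(3) by (simp add: power2_eq_square)
  then show "2 * p * k = (2 - 7 * p + 4 * p\<^sup>2) + (1 - 2 * t) * y" "2 * p / k = (2 - 7 * p + 4
      * p\<^sup>2) - (1 - 2 * t) * y"
    using e k(1) by (simp_all only: P_def Q_def) (metis nonzero_mult_div_cancel_left less_irrefl)
qed

text \<open>The theta identity divided by its left side, with denominators cleared. The variables
  \<open>al2\<close>, \<open>be2\<close>, \<open>mub\<close>, \<open>K\<close>, \<open>Kb\<close>
  stand for 2\<alpha>, 2\<beta>, \<open>7 / m\<close>, \<open>2 * p * k\<close>,
  \<open>2 * p / k\<close>, all polynomial in t and y.\<close>

lemma curve_final:
  fixes t s p y al2 be2 mu mub K Kb :: real
  assumes ts: "s = 1 - t" "p = t * s" and y: "y\<^sup>2 = (2 - p) * (2 - 5 * p + 4 * p\<^sup>2)"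
    and al2: "al2 = (1 + t ^ 8 - s ^ 8) + 4 * p * (1 - p) * y" and be2: "be2 = (1 + t ^ 8 - s ^ 8)
        - 4 * p * (1 - p) * y"
    and mu: "mu = 2 * y + (2 * t - 1) * (3 - 2 * p)" and mub: "mub = 2 * y - (2 * t - 1) * (3 - 2
        * p)"
    and K: "K = (2 - 7 * p + 4 * p\<^sup>2) + (1 - 2 * t) * y" and Kb: "Kb = (2 - 7 * p + 4 * p\<^sup>2) - (1
        - 2 * t) * y"
  shows "350 * p = 7 * p * (mu\<^sup>2 + mub\<^sup>2) - 928 * s ^ 6 * t * p - 2688 * s ^ 4 * t\<^sup>2 * p + 140
      * t\<^sup>2 * (2 - al2) * Kb
    + 284 * t\<^sup>2 * (2 - be2) * K + 144 * s\<^sup>2 * t ^ 4 * mub * Kb + 840 * s\<^sup>2 * K * be2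
    + (- 72 * s\<^sup>2 + 768 * s\<^sup>2 * t + 384 * s * t\<^sup>2) * p * be2 * mub" (is "?L = ?R")
proof -
  define D Q where "D = 4 * p * (1 - p)" and "Q = 1 - 2 * t"
  \<comment> \<open>Every summand is at most quadratic in y. The cofactor collects the coefficients
    of the square of y term by term; the part linear in y cancels.\<close>
  have "?R - ?L = (y\<^sup>2 - (2 - p) * (2 - 5 * p + 4 * p\<^sup>2)) * (56 * p + 140 * t\<^sup>2 * D * Q + 284
      * t\<^sup>2 * D * Q - 288 * s\<^sup>2 * t ^ 4 * Q
     - 840 * s\<^sup>2 * Q * D - 2 * (- 72 * s\<^sup>2 + 768 * s\<^sup>2 * t + 384 * s * t\<^sup>2) * p * D)"
    unfolding al2 be2 mu mub K Kb D_def Q_def ts by algebra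
  also have "\<dots> = 0" using y by simp
  finally show ?thesis by simp
qed

text \<open>Identities between monomials in positive reals become linear after writing each factor
  as an exponential.\<close>

lemmas exp_norm = mult_exp_exp exp_diff[symmetric] exp_of_nat_mult[symmetric]

text \<open>Multiplication by 350 clears the denominators 50, 175, 25 and 5. The coefficients stay
  split into those of \<open>curve_final\<close> and the powers of 2, sometimes times 7, that its
  normalised variables contribute.\<close>

lemma rescale:
  fixes x :: real
  assumes "350 = 7 * (x + 49 * x') - 928 * (2 * u1) - 2688 * (4 * u2) + 140 * (16 * u3) + 284
      * (16 * u4) + 144 * (224 * u5)
    + 840 * (64 * u6) + (- 16128 * u7 + 344064 * u8 + 344064 * u9)"
  shows "z = 1/50 * (z * x) + 49/50 * (z * x') - 928/175 * (z * u1) - 768/25 * (z * u2) + 32/5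
      * (z * u3) + 2272/175 * (z * u4)
    + 2304/25 * (z * u5) + 768/5 * (z * u6) - 1152/25 * (z * u7) + 24576/25 * (z * u8 + z * u9)"
  using arg_cong[OF assms, of "\<lambda>w. z * w / 350"] by (simp add: field_simps)

text \<open>The letters a, b, c, A, B, C stand for the eta values at z, 2z, 4z, 7z, 14z, 28z. The
  nine eta quotients have weight 4, so division by \<open>\<theta>(q)^4 \<theta>(q^7)^4\<close>
  leaves functions of weight 0 expressible on the curve.\<close>

lemma eta_identity:
  fixes a b c A B C al be t s :: real
  assumes pos: "a > 0" "b > 0" "c > 0" "A > 0" "B > 0" "C > 0"
    and al: "al = 16 * (a ^ 8 * c ^ 16 / b ^ 24)" "1 - al = a ^ 16 * c ^ 8 / b ^ 24"
    and be: "be = 16 * (A ^ 8 * C ^ 16 / B ^ 24)" "1 - be = A ^ 16 * C ^ 8 / B ^ 24"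
    and t: "t = 2 * (a * c ^ 2 * A * C ^ 2 / (b ^ 3 * B ^ 3))" and s: "s = a ^ 2 * c * A ^ 2 * C
        / (b ^ 3 * B ^ 3)"
    and ts: "t + s = 1" and gt: "be < al"
    and der: "(b ^ 5 / (a ^ 2 * c ^ 2)) ^ 4 * (t - al) = 7 * ((B ^ 5 / (A ^ 2 * C ^ 2)) ^ 4 * (be
        - t))"
  shows "(b ^ 5 / (a ^ 2 * c ^ 2)) ^ 4 * (B ^ 5 / (A ^ 2 * C ^ 2)) ^ 4 =
    1/50 * (b ^ 5 / (a ^ 2 * c ^ 2)) ^ 8 + 49/50 * (B ^ 5 / (A ^ 2 * C ^ 2)) ^ 8
    - 928/175 * (a ^ 5 * A ^ 5 / (b * B)) - 768/25 * (a ^ 2 * b ^ 2 * A ^ 2 * B ^ 2)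
    + 32/5 * (a ^ 6 * B ^ 6 / (b ^ 2 * A ^ 2)) + 2272/175 * (b ^ 6 * A ^ 6 / (a ^ 2 * B ^ 2))
    + 2304/25 * (c ^ 2 * B ^ 4 * C ^ 2) + 768/5 * (b ^ 6 * C ^ 6 / (c ^ 2 * B ^ 2))
    - 1152/25 * (b ^ 4 * C ^ 6 / c ^ 2)
    + 24576/25 * (a * b * A * C ^ 8 / B ^ 3 + b * c * C ^ 9 / B ^ 3)"
proof -
  obtain a' b' c' A' B' C' where l: "a = exp a'" "b = exp b'" "c = exp c'" "A = exp A'" "B
      = exp B'" "C = exp C'"
    using pos exp_total by metis
  define m where "m = (b ^ 5 / (a ^ 2 * c ^ 2)) ^ 2 / (B ^ 5 / (A ^ 2 * C ^ 2)) ^ 2"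
  define k where "k = b ^ 2 / B ^ 2 / m"
  \<comment> \<open>\<open>T\<close> and \<open>be'\<close> are t and \<beta> without their factors
    2 and 16, so they are pure monomials to which the exponential normal form applies.\<close>
  define T where "T = a * c ^ 2 * A * C ^ 2 / (b ^ 3 * B ^ 3)"
  define be' where "be' = A ^ 8 * C ^ 16 / B ^ 24"
  define Z W where "Z = (b ^ 5 / (a ^ 2 * c ^ 2)) ^ 4" and "W = (B ^ 5 / (A ^ 2 * C ^ 2)) ^ 4"
  note ud = m_def k_def T_def be'_def Z_def W_def s l
  have nz: "m > 0" "k > 0" "T > 0" "Z > 0" "W > 0" using pos
      by (auto simp: m_def k_def T_def Z_def W_def)
  have t2: "t = 2 * T" by (simp add: t T_def)
  have mZ: "m\<^sup>2 = Z / W" unfolding ud by (simp add: exp_norm algebra_simps)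
  define p where "p = t * s"
  have s1: "s = 1 - t" using ts by simp
  have pos': "0 < t" "0 < s" using pos by (simp_all add: t s)
  have p0: "p > 0" using pos' by (simp add: p_def)
  have "a ^ 8 * c ^ 16 / b ^ 24 * be' = T ^ 8"
    unfolding ud by (simp add: exp_norm algebra_simps)
  then have prod1: "al * be = t ^ 8" unfolding al(1) be(1) t2 be'_def
      by (simp add: power_mult_distrib)
  have prod2: "(1 - al) * (1 - be) = s ^ 8" unfolding al(2) be(2) ud
      by (simp add: exp_norm algebra_simps)
  obtain y where y: "y > 0" "y\<^sup>2 = (2 - p) * (2 - 5 * p + 4 * p\<^sup>2)"
    "2 * al = (1 + t ^ 8 - s ^ 8) + 4 * p * (1 - p) * y" "2 * be = (1 + t ^ 8 - s ^ 8) - 4 * p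
        * (1 - p) * y"
    using curve_y[OF s1 p_def pos' prod1 prod2 gt] .
  have "m\<^sup>2 * (al - t) = 7 * (t - be)"
    using der nz unfolding mZ Z_def[symmetric] W_def[symmetric] by (simp add: field_simps)
  note M = curve_m[OF s1 p_def y gt nz(1) this]
  have "k ^ 3 * (T * s) ^ 4 = (a ^ 8 * c ^ 16 / b ^ 24) * (a ^ 16 * c ^ 8 / b ^ 24)"
    unfolding ud by (simp add: exp_norm algebra_simps)
  then have "k ^ 3 * p ^ 4 = al * (1 - al)" unfolding al(2) unfolding al(1) p_def t2
      by (simp add: power_mult_distrib)
  note Kk = curve_k[OF s1 p_def p0 y(2,3) nz(2) this]
  note fin = curve_final[OF s1 p_def y(2,3,4) M Kk]
  have ZW: "(b ^ 5 / (a ^ 2 * c ^ 2)) ^ 8 = Z * W * m\<^sup>2" "(B ^ 5 / (A ^ 2 * C ^ 2)) ^ 8 = Z * W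
      / m\<^sup>2"
    unfolding ud by (simp_all add: exp_norm algebra_simps)
  have X1: "a ^ 5 * A ^ 5 / (b * B) = Z * W * (s ^ 6 * T)"
    unfolding ud by (simp add: exp_norm algebra_simps)
  have X2: "a ^ 2 * b ^ 2 * A ^ 2 * B ^ 2 = Z * W * (s ^ 4 * T ^ 2)"
    unfolding ud by (simp add: exp_norm algebra_simps)
  have X3: "a ^ 6 * B ^ 6 / (b ^ 2 * A ^ 2) = Z * W * (T ^ 2 * (1 - al) / k)"
    unfolding al(2) ud by (simp add: exp_norm algebra_simps)
  have X4: "b ^ 6 * A ^ 6 / (a ^ 2 * B ^ 2) = Z * W * (T ^ 2 * k * (1 - be))"
    unfolding be(2) ud by (simp add: exp_norm algebra_simps)
  have X5: "c ^ 2 * B ^ 4 * C ^ 2 = Z * W * (s ^ 2 * T ^ 4 / (m * k))"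
    unfolding ud by (simp add: exp_norm algebra_simps)
  have X6: "b ^ 6 * C ^ 6 / (c ^ 2 * B ^ 2) = Z * W * (s ^ 2 * k * be')"
    unfolding ud by (simp add: exp_norm algebra_simps)
  have X7: "b ^ 4 * C ^ 6 / c ^ 2 = Z * W * (s ^ 2 * be' / m)"
    unfolding ud by (simp add: exp_norm algebra_simps)
  have X8: "a * b * A * C ^ 8 / B ^ 3 = Z * W * (s ^ 2 * T * be' / m)"
    unfolding ud by (simp add: exp_norm algebra_simps)
  have X9: "b * c * C ^ 9 / B ^ 3 = Z * W * (s * T ^ 2 * be' / m)"
    unfolding ud by (simp add: exp_norm algebra_simps)
  have beb: "be = 16 * be'" by (simp add: be be'_def)
  have sq: "m\<^sup>2 + (7 / m)\<^sup>2 = m\<^sup>2 + 49 / m\<^sup>2" by (simp add: power_divide)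
  have k1: "2 * p * k = p * (2 * k)" and k2: "2 * p / k = p * (2 / k)" by simp_all
  have "p * 350 = p * (7 * (m\<^sup>2 + 49 / m\<^sup>2) - 928 * s ^ 6 * t - 2688 * s ^ 4 * t\<^sup>2 + 140 * t\<^sup>2
      * (2 - 2 * al) * (2 / k)
    + 284 * t\<^sup>2 * (2 - 2 * be) * (2 * k) + 144 * s\<^sup>2 * t ^ 4 * (7 / m) * (2 / k) + 840 * s\<^sup>2 * (2
        * k) * (2 * be)
    + (- 72 * s\<^sup>2 + 768 * s\<^sup>2 * t + 384 * s * t\<^sup>2) * (2 * be) * (7 / m))"
    using fin unfolding sq k1 k2 by (simp only: algebra_simps)
  then have "350 = 7 * (m\<^sup>2 + 49 / m\<^sup>2) - 928 * s ^ 6 * t - 2688 * s ^ 4 * t\<^sup>2 + 140 * t\<^sup>2 * (2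
      - 2 * al) * (2 / k)
    + 284 * t\<^sup>2 * (2 - 2 * be) * (2 * k) + 144 * s\<^sup>2 * t ^ 4 * (7 / m) * (2 / k) + 840 * s\<^sup>2 * (2
        * k) * (2 * be)
    + (- 72 * s\<^sup>2 + 768 * s\<^sup>2 * t + 384 * s * t\<^sup>2) * (2 * be) * (7 / m)"
    using p0 by (simp only: mult_cancel_left) simp
  moreover have "49 / m\<^sup>2 = 49 * (1 / m\<^sup>2)" "s ^ 6 * t = 2 * (s ^ 6 * T)" "s ^ 4 * t\<^sup>2 = 4
      * (s ^ 4 * T ^ 2)"
    "t\<^sup>2 * (2 - 2 * al) * (2 / k) = 16 * (T ^ 2 * (1 - al) / k)" "t\<^sup>2 * (2 - 2 * be) * (2 * k)
        = 16 * (T ^ 2 * k * (1 - be))"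
    "s\<^sup>2 * t ^ 4 * (7 / m) * (2 / k) = 224 * (s ^ 2 * T ^ 4 / (m * k))" "s\<^sup>2 * (2 * k) * (2 * be)
        = 64 * (s ^ 2 * k * be')"
    unfolding t2 beb by (simp_all add: power_mult_distrib right_diff_distrib left_diff_distrib
        diff_divide_distrib)
  moreover have "(- 72 * s\<^sup>2 + 768 * s\<^sup>2 * t + 384 * s * t\<^sup>2) * (2 * be) * (7 / m) =
     - 16128 * (s ^ 2 * be' / m) + 344064 * (s ^ 2 * T * be' / m) + 344064 * (s * T ^ 2 * be' / m)"
    unfolding t2 beb by (simp add: power_mult_distrib distrib_right add_divide_distrib
        diff_divide_distrib left_diff_distrib)
  ultimately have "350 = 7 * (m\<^sup>2 + 49 * (1 / m\<^sup>2)) - 928 * (2 * (s ^ 6 * T)) - 2688 * (4 * (s ^ 4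
      * T ^ 2))
    + 140 * (16 * (T ^ 2 * (1 - al) / k)) + 284 * (16 * (T ^ 2 * k * (1 - be))) + 144 * (224
        * (s ^ 2 * T ^ 4 / (m * k)))
    + 840 * (64 * (s ^ 2 * k * be'))
    + (- 16128 * (s ^ 2 * be' / m) + 344064 * (s ^ 2 * T * be' / m) + 344064 * (s * T ^ 2 * be'
        / m))"
    by (simp only: mult.assoc)
  note r = rescale[OF this, of "Z * W"]
  have ZW': "(B ^ 5 / (A ^ 2 * C ^ 2)) ^ 8 = Z * W * (1 / m\<^sup>2)" using ZW(2) by simp
  show ?thesis
    unfolding Z_def[symmetric] W_def[symmetric] ZW(1) ZW' X1 X2 X3 X4 X5 X6 X7 X8 X9 by (rule r)
qed

section \<open>The theta identity\<close>

lemma lamb_deriv':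
  assumes q: "0 < q" "q < 1"
  shows "(lamb has_real_derivative (lamb q * (1 - lamb q) * thA q ^ 4 / q)) (at q)"
proof -
  have "thA q \<noteq> 0" using thA_pos[of q] q by simp
  then have "thA (- q) ^ 4 = (1 - lamb q) * thA q ^ 4" unfolding lamb_bounds(3)[OF q] by simp
  then show ?thesis using lamb_deriv[OF q] by (simp add: mult.assoc)
qed

lemma lamb_eta:
  fixes q r :: real
  assumes q: "0 < q" "q < 1" and r: "r > 0" "r ^ 24 = q"
  defines "a \<equiv> r * euler q" and "b \<equiv> r ^ 2 * euler (q ^ 2)" and "c \<equiv> r ^ 4 * euler (q ^ 4)"
  shows "a > 0" "b > 0" "c > 0" "thA q = b ^ 5 / (a ^ 2 * c ^ 2)"
    "lamb q = 16 * (a ^ 8 * c ^ 16 / b ^ 24)" "1 - lamb q = a ^ 16 * c ^ 8 / b ^ 24"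
proof -
  have e: "euler q > 0" "euler (q ^ 2) > 0" "euler (q ^ 4) > 0" using q unit_pow[OF q]
      by (simp_all add: euler_pos)
  then show pos: "a > 0" "b > 0" "c > 0" using r by (simp_all add: a_def b_def c_def)
  have aq: "\<bar>q\<bar> < 1" using q by simp
  show A: "thA q = b ^ 5 / (a ^ 2 * c ^ 2)"
    unfolding thA_eta[OF aq] a_def b_def c_def using e r
        by (simp add: power_mult_distrib field_simps flip: power_mult power_add)
  have A': "thA (- q) = a ^ 2 / b"
    unfolding thA_minus a_def b_def using e r by (simp add: power_mult_distrib)
  \<comment> \<open>\<open>r ^ 6\<close> is the factor \<open>q ^ (1/4)\<close> missing from
    \<open>thB\<close>.\<close>
  have B: "r ^ 6 * thB q = 2 * (c ^ 2 / b)"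
    unfolding thB_def b_def c_def using e r by (simp add: power_mult_distrib field_simps flip:
        power_mult power_add)
  have "q * thB q ^ 4 = (r ^ 6 * thB q) ^ 4" by (simp add: power_mult_distrib r(2) flip: power_mult)
  then have B4: "q * thB q ^ 4 = 16 * (c ^ 2 / b) ^ 4" unfolding B
      by (simp add: power_mult_distrib power_divide)
  obtain a' b' c' where l: "a = exp a'" "b = exp b'" "c = exp c'" using pos exp_total by metis
  have "(c ^ 2 / b) ^ 4 / (b ^ 5 / (a ^ 2 * c ^ 2)) ^ 4 = a ^ 8 * c ^ 16 / b ^ 24"
    unfolding l by (simp add: exp_norm algebra_simps)
  then show "lamb q = 16 * (a ^ 8 * c ^ 16 / b ^ 24)" unfolding lamb_def A B4 by simp
  have "(a ^ 2 / b) ^ 4 / (b ^ 5 / (a ^ 2 * c ^ 2)) ^ 4 = a ^ 16 * c ^ 8 / b ^ 24"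
    unfolding l by (simp add: exp_norm algebra_simps)
  then show "1 - lamb q = a ^ 16 * c ^ 8 / b ^ 24" unfolding lamb_bounds(3)[OF q] A A' .
qed

text \<open>The positive eighth roots t and s, written through \<open>exp\<close> and
  \<open>ln\<close> so that they can be differentiated in q, and also as the eta monomials consumed
  by \<open>eta_identity\<close>.\<close>

lemma modular_roots:
  fixes q r :: real
  assumes q: "0 < q" "q < 1" and r: "r > 0" "r ^ 24 = q"
  shows "exp ((ln (lamb q) + ln (lamb (q ^ 7))) / 8) + exp ((ln (1 - lamb q) + ln (1
      - lamb (q ^ 7))) / 8) = 1"
    and "exp ((ln (lamb q) + ln (lamb (q ^ 7))) / 8) = 2 * ((r * euler q) * (r ^ 4
        * euler (q ^ 4)) ^ 2 * (r ^ 7 * euler (q ^ 7)) * (r ^ 28 * euler (q ^ 28)) ^ 2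
        / ((r ^ 2 * euler (q ^ 2)) ^ 3 * (r ^ 14 * euler (q ^ 14)) ^ 3))"
    and "exp ((ln (1 - lamb q) + ln (1 - lamb (q ^ 7))) / 8) = (r * euler q) ^ 2 * (r ^ 4
        * euler (q ^ 4)) * (r ^ 7 * euler (q ^ 7)) ^ 2 * (r ^ 28 * euler (q ^ 28))
        / ((r ^ 2 * euler (q ^ 2)) ^ 3 * (r ^ 14 * euler (q ^ 14)) ^ 3)"
proof -
  have q7: "0 < q ^ 7" "q ^ 7 < 1" using unit_pow[OF q, of 7] by simp_all
  define a b c A B C where "a = r * euler q" and "b = r ^ 2 * euler (q ^ 2)" and "c = r ^ 4
      * euler (q ^ 4)"
    and "A = r ^ 7 * euler (q ^ 7)" and "B = r ^ 14 * euler (q ^ 14)" and "C = r ^ 28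
        * euler (q ^ 28)"
  have r7: "r ^ 7 > 0" "(r ^ 7) ^ 24 = q ^ 7" using r by (auto simp flip: power_mult)
  have pw: "(r ^ 7) ^ 2 = r ^ 14" "(r ^ 7) ^ 4 = r ^ 28" "(q ^ 7) ^ 2 = q ^ 14" "(q ^ 7) ^ 4
      = q ^ 28" by (simp_all flip: power_mult)
  note L = lamb_eta[OF q r, folded a_def b_def c_def]
  note L7 = lamb_eta[OF q7 r7, unfolded pw, folded A_def B_def C_def]
  obtain a' b' c' A' B' C' where l: "a = exp a'" "b = exp b'" "c = exp c'" "A = exp A'" "B
      = exp B'" "C = exp C'"
    using L(1-3) L7(1-3) exp_total by metis
  have la: "ln (lamb q) = ln 16 + ln (a ^ 8 * c ^ 16 / b ^ 24)" "ln (lamb (q ^ 7)) = ln 16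
      + ln (A ^ 8 * C ^ 16 / B ^ 24)"
    unfolding L(5) L7(5)
    by (rule ln_mult_pos; use L(1-3) L7(1-3) in simp)+
  have l16: "ln 16 = 4 * ln (2::real)" using ln_realpow[of 2 4] by simp
  have 1: "exp ((ln (lamb q) + ln (lamb (q ^ 7))) / 8) = 2 * (a * c ^ 2 * A * C ^ 2 / (b ^ 3
      * B ^ 3))"
  proof -
    have "(ln (lamb q) + ln (lamb (q ^ 7))) / 8 = ln 2 + (a' + 2 * c' + A' + 2 * C' - (3 * b' + 3
        * B'))"
      unfolding la l16 l by (simp add: exp_norm)
    moreover have "a * c ^ 2 * A * C ^ 2 / (b ^ 3 * B ^ 3) = exp (a' + 2 * c' + A' + 2 * C' - (3
        * b' + 3 * B'))"
      unfolding l by (simp add: exp_norm)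
    ultimately show ?thesis by (simp only: exp_add exp_ln zero_less_numeral)
  qed
  have 2: "exp ((ln (1 - lamb q) + ln (1 - lamb (q ^ 7))) / 8) = a ^ 2 * c * A ^ 2 * C / (b ^ 3
      * B ^ 3)"
    unfolding L(6) L7(6) l by (simp add: exp_norm)
  have ee: "euler q > 0" "euler (q ^ 2) > 0" "euler (q ^ 4) > 0" "euler (q ^ 7) > 0" "euler (q ^
      14) > 0" "euler (q ^ 28) > 0"
    using q unit_pow[OF q] by (simp_all add: euler_pos)
  have aq: "\<bar>q\<bar> < 1" "\<bar>q ^ 7\<bar> < 1" using q q7 by simp_all
  have "euler (q ^ 2) ^ 3 / (euler q * euler (q ^ 4)) * (euler (q ^ 14) ^ 3 / (euler (q ^ 7)
      * euler (q ^ 28))) = euler q * euler (q ^ 7) + 2 * q * (euler (q ^ 4) * euler (q ^ 28))"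
    using modular_equation_7[OF q] unfolding euler_minus[OF aq(1)] euler_minus[OF aq(2)] pw .
  then have "euler (q ^ 2) ^ 3 * euler (q ^ 14) ^ 3 = euler q * euler (q ^ 4) * euler (q ^ 7)
      * euler (q ^ 28) * (euler q * euler (q ^ 7) + 2 * q * (euler (q ^ 4) * euler (q ^ 28)))"
    using ee by (simp add: divide_simps mult_ac)
  \<comment> \<open>The eta values on the left need exactly 48 factors r. On the right, 40 go to the
    outer product and 8 to the bracket, where \<open>r ^ 24 = q\<close> turns \<open>2 * q\<close>
    into the missing part of \<open>2 * c * C\<close>.\<close>
  then have "r ^ 48 * (euler (q ^ 2) ^ 3 * euler (q ^ 14) ^ 3) = r ^ 48 * (euler q * euler (q ^ 4)
      * euler (q ^ 7) * euler (q ^ 28) * (euler q * euler (q ^ 7) + 2 * q * (euler (q ^ 4)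
      * euler (q ^ 28))))"
    by (rule arg_cong)
  then have "b ^ 3 * B ^ 3 = a * c * A * C * (a * A + 2 * c * C)"
    unfolding a_def b_def c_def A_def B_def C_def r(2)[symmetric]
    by (simp add: power_mult_distrib algebra_simps flip: power_mult power_add) (simp add:
        power_numeral_reduce algebra_simps)
  then have "2 * (a * c ^ 2 * A * C ^ 2 / (b ^ 3 * B ^ 3)) + a ^ 2 * c * A ^ 2 * C / (b ^ 3
      * B ^ 3) = 1"
  proof -
    have "2 * (a * c ^ 2 * A * C ^ 2 / (b ^ 3 * B ^ 3)) + a ^ 2 * c * A ^ 2 * C / (b ^ 3 * B ^ 3)
        = a * c * A * C * (a * A + 2 * c * C) / (b ^ 3 * B ^ 3)"
      by (simp add: add_divide_distrib power2_eq_square algebra_simps)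
    then show ?thesis using \<open>b ^ 3 * B ^ 3 = _\<close> L(2) L7(2)
        by (metis divide_self mult_pos_pos less_irrefl zero_less_power)
  qed
  then show "exp ((ln (lamb q) + ln (lamb (q ^ 7))) / 8) + exp ((ln (1 - lamb q) + ln (1
      - lamb (q ^ 7))) / 8) = 1"
    unfolding 1 2 by simp
  show "exp ((ln (lamb q) + ln (lamb (q ^ 7))) / 8) = 2 * ((r * euler q) * (r ^ 4
      * euler (q ^ 4)) ^ 2 * (r ^ 7 * euler (q ^ 7)) * (r ^ 28 * euler (q ^ 28)) ^ 2
        / ((r ^ 2 * euler (q ^ 2)) ^ 3 * (r ^ 14 * euler (q ^ 14)) ^ 3))"
    using 1 by (simp only: a_def b_def c_def A_def B_def C_def)
  show "exp ((ln (1 - lamb q) + ln (1 - lamb (q ^ 7))) / 8) = (r * euler q) ^ 2 * (r ^ 4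
      * euler (q ^ 4)) * (r ^ 7 * euler (q ^ 7)) ^ 2 * (r ^ 28 * euler (q ^ 28))
        / ((r ^ 2 * euler (q ^ 2)) ^ 3 * (r ^ 14 * euler (q ^ 14)) ^ 3)"
    using 2 by (simp only: a_def b_def c_def A_def B_def C_def)
qed

text \<open>The modular equation holds on the whole interval, so its derivative vanishes; the chain
  rule for \<open>q ^ 7\<close> produces the factor 7.\<close>

lemma multiplier:
  fixes q :: real
  assumes q: "0 < q" "q < 1"
  defines "t \<equiv> exp ((ln (lamb q) + ln (lamb (q ^ 7))) / 8)"
  shows "thA q ^ 4 * (t - lamb q) = 7 * (thA (q ^ 7) ^ 4 * (lamb (q ^ 7) - t))"
proof -
  have q7: "0 < q ^ 7" "q ^ 7 < 1" using unit_pow[OF q, of 7] by simp_all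
  define l m Z W where "l = lamb q" and "m = lamb (q ^ 7)" and "Z = thA q ^ 4" and "W
      = thA (q ^ 7) ^ 4"
  have b: "0 < l" "l < 1" "0 < m" "m < 1" using lamb_bounds[OF q] lamb_bounds[OF q7]
      by (simp_all add: l_def m_def)
  have dl: "(lamb has_real_derivative (l * (1 - l) * Z / q)) (at q)" using lamb_deriv'[OF q]
      by (simp add: l_def Z_def)
  have "((\<lambda>x. lamb (x ^ 7)) has_real_derivative (lamb (q ^ 7) * (1 - lamb (q ^ 7))
      * thA (q ^ 7) ^ 4 / q ^ 7 * (7 * q ^ 6))) (at q)"
    by (rule DERIV_chain2[where g = "\<lambda>x. x ^ 7" and f = lamb and x
        = q, OF lamb_deriv'[OF q7]]) (auto intro!: derivative_eq_intros)
  also have "lamb (q ^ 7) * (1 - lamb (q ^ 7)) * thA (q ^ 7) ^ 4 / q ^ 7 * (7 * q ^ 6) = 7 * (m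
      * (1 - m) * W / q)"
    using q by (simp add: l_def m_def W_def field_simps power_numeral_reduce)
  finally have dm: "((\<lambda>x. lamb (x ^ 7)) has_real_derivative (7 * (m * (1 - m) * W / q))) (at q)" .
  define s where "s = exp ((ln (1 - l) + ln (1 - m)) / 8)"
  have mr: "exp ((ln (lamb x) + ln (lamb (x ^ 7))) / 8) + exp ((ln (1 - lamb x) + ln (1
      - lamb (x ^ 7))) / 8) = 1"
    if x: "0 < x" "x < 1" for x
    by (rule modular_roots(1)[OF x, of "x powr (1/24)"])
        (use x in \<open>simp_all add: powr_powr flip: powr_realpow\<close>)
  have ts: "t + s = 1" using mr[OF q] by (simp add: t_def s_def l_def m_def)
  let ?G = "\<lambda>x. exp ((ln (lamb x) + ln (lamb (x ^ 7))) / 8) + exp ((ln (1 - lamb x) + ln (1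
      - lamb (x ^ 7))) / 8)"
  have "(?G has_real_derivative
     (t * ((l * (1 - l) * Z / q / l + 7 * (m * (1 - m) * W / q) / m) / 8) + s * ((- (l * (1 - l)
         * Z / q) / (1 - l) + - (7 * (m * (1 - m) * W / q)) / (1 - m)) / 8))) (at q)"
    using b q unfolding t_def s_def l_def m_def
    by (auto intro!: derivative_eq_intros dl[unfolded l_def] dm[unfolded m_def]) (simp add:
        field_simps)
  moreover have "(?G has_real_derivative 0) (at q)"
    by (rule has_field_derivative_transform_within_open[where f = "\<lambda>_. 1" and S = "{0<..<1}"])
        (use q mr in auto)
  ultimately have "t * ((l * (1 - l) * Z / q / l + 7 * (m * (1 - m) * W / q) / m) / 8) + s
      * ((- (l * (1 - l) * Z / q) / (1 - l) + - (7 * (m * (1 - m) * W / q)) / (1 - m)) / 8) = 0"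
    by (rule DERIV_unique)
  moreover have "l * (1 - l) * Z / q / l = (1 - l) * Z / q" "7 * (m * (1 - m) * W / q) / m = 7
      * ((1 - m) * W) / q"
    "- (l * (1 - l) * Z / q) / (1 - l) = - (l * Z) / q" "- (7 * (m * (1 - m) * W / q)) / (1 - m) =
        - (7 * (m * W)) / q"
    using b q by (simp_all add: field_simps)
  ultimately have "t * (((1 - l) * Z / q + 7 * ((1 - m) * W) / q) / 8) + s * ((- (l * Z) / q +
      - (7 * (m * W)) / q) / 8) = 0" by simp
  moreover have "t * (((1 - l) * Z / q + 7 * ((1 - m) * W) / q) / 8) + s * ((- (l * Z) / q + - (7
      * (m * W)) / q) / 8)
     = (t * ((1 - l) * Z + 7 * ((1 - m) * W)) - s * (l * Z + 7 * (m * W))) / (8 * q)"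
    using q by (simp add: field_simps)
  ultimately have "(t * ((1 - l) * Z + 7 * ((1 - m) * W)) - s * (l * Z + 7 * (m * W))) / (8 * q)
      = 0"
    by simp
  then have "t * ((1 - l) * Z + 7 * ((1 - m) * W)) - s * (l * Z + 7 * (m * W)) = 0" using q by simp
  \<comment> \<open>Eliminating s cancels the mixed terms \<open>t * l * Z\<close> and
    \<open>t * m * W\<close> and leaves a relation linear in t.\<close>
  moreover have "s = 1 - t" using ts by simp
  ultimately have "Z * (t - l) = 7 * (W * (m - t))" by (simp add: algebra_simps)
  then show ?thesis by (simp add: l_def m_def Z_def W_def)
qed

text \<open>The value of \<open>eta (m * z)\<close> at the point of the imaginary axis with nome q;
  \<open>powr\<close> is the positive root that the exponential in \<open>eta\<close> takes
  there.\<close>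

definition eta_real :: "real \<Rightarrow> nat \<Rightarrow> real" where
  "eta_real q m = (q powr (1/24)) ^ m * euler (q ^ m)"

theorem theta_identity:
  fixes q :: real
  assumes q: "0 < q" "q < 1"
  shows "thA q ^ 4 * thA (q ^ 7) ^ 4 = 1/50 * thA q ^ 8 + 49/50 * thA (q ^ 7) ^ 8
    - 928/175 * (eta_real q 1 ^ 5 * eta_real q 7 ^ 5 / (eta_real q 2 * eta_real q 14)) - 768/25
        * (eta_real q 1 ^ 2 * eta_real q 2 ^ 2 * eta_real q 7 ^ 2 * eta_real q 14 ^ 2)
    + 32/5 * (eta_real q 1 ^ 6 * eta_real q 14 ^ 6 / (eta_real q 2 ^ 2 * eta_real q 7 ^ 2))
        + 2272/175 * (eta_real q 2 ^ 6 * eta_real q 7 ^ 6 / (eta_real q 1 ^ 2 * eta_real q 14 ^ 2))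
    + 2304/25 * (eta_real q 4 ^ 2 * eta_real q 14 ^ 4 * eta_real q 28 ^ 2) + 768/5
        * (eta_real q 2 ^ 6 * eta_real q 28 ^ 6 / (eta_real q 4 ^ 2 * eta_real q 14 ^ 2))
    - 1152/25 * (eta_real q 2 ^ 4 * eta_real q 28 ^ 6 / eta_real q 4 ^ 2)
    + 24576/25 * (eta_real q 1 * eta_real q 2 * eta_real q 7 * eta_real q 28 ^ 8
        / eta_real q 14 ^ 3 + eta_real q 2 * eta_real q 4 * eta_real q 28 ^ 9 / eta_real q 14 ^ 3)"
proof -
  define r where "r = q powr (1/24)"
  have r: "r > 0" "r ^ 24 = q" using q by (simp_all add: r_def powr_powr flip: powr_realpow)
  define a b c A B C where "a = r * euler q" and "b = r ^ 2 * euler (q ^ 2)" and "c = r ^ 4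
      * euler (q ^ 4)"
    and "A = r ^ 7 * euler (q ^ 7)" and "B = r ^ 14 * euler (q ^ 14)" and "C = r ^ 28
        * euler (q ^ 28)"
  have e: "eta_real q 1 = a" "eta_real q 2 = b" "eta_real q 4 = c" "eta_real q 7
      = A" "eta_real q 14 = B" "eta_real q 28 = C"
    by (simp_all add: eta_real_def r_def a_def b_def c_def A_def B_def C_def)
  have q7: "0 < q ^ 7" "q ^ 7 < 1" using unit_pow[OF q, of 7] by simp_all
  have r7: "r ^ 7 > 0" "(r ^ 7) ^ 24 = q ^ 7" using r by (auto simp flip: power_mult)
  have pw: "(r ^ 7) ^ 2 = r ^ 14" "(r ^ 7) ^ 4 = r ^ 28" "(q ^ 7) ^ 2 = q ^ 14" "(q ^ 7) ^ 4
      = q ^ 28" by (simp_all flip: power_mult)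
  note L = lamb_eta[OF q r, folded a_def b_def c_def]
  note L7 = lamb_eta[OF q7 r7, unfolded pw, folded A_def B_def C_def]
  have "q ^ 7 < q ^ 1" using power_strict_decreasing[of 1 7 q] q by simp
  then have gt: "lamb (q ^ 7) < lamb q" using lamb_mono[of "q ^ 7" q] q q7 by simp
  show ?thesis unfolding e L(4) L7(4)
    by (rule eta_identity[OF L(1-3) L7(1-3) L(5,6) L7(5,6) modular_roots(2)[OF q r, folded a_def
        b_def c_def A_def B_def C_def]
      modular_roots(3)[OF q r, folded a_def b_def c_def A_def B_def C_def] modular_roots(1)[OF q
          r] gt multiplier[OF q, unfolded L(4) L7(4)]])
qed

section \<open>Integral power series on the unit disc\<close>

text \<open>Functions on the unit disc with an integral power series. Integrality has to be tracked
  because \<open>q_coeff\<close> ranges over integer sequences only.\<close>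

definition zfun :: "(complex \<Rightarrow> complex) \<Rightarrow> bool" where
  "zfun f \<longleftrightarrow> (\<exists>F. (\<forall>n. fps_nth F n \<in> \<int>) \<and> fps_conv_radius F \<ge> 1 \<and> (\<forall>w. norm w < 1 \<longrightarrow> f w
      = eval_fps F w))"

lemma zfun_mult:
  assumes "zfun f" "zfun g" shows "zfun (\<lambda>w. f w * g w)"
proof -
  obtain F where F: "\<And>n. fps_nth F n \<in> \<int>" "fps_conv_radius F \<ge> 1" "\<And>w. norm w < 1 \<Longrightarrow> f w
      = eval_fps F w"
    using assms(1) unfolding zfun_def by blast
  obtain G where G: "\<And>n. fps_nth G n \<in> \<int>" "fps_conv_radius G \<ge> 1" "\<And>w. norm w < 1 \<Longrightarrow> g w
      = eval_fps G w"
    using assms(2) unfolding zfun_def by blast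
  have "fps_nth (F * G) n \<in> \<int>" for n unfolding fps_mult_nth by (intro Ints_sum Ints_mult F G)
  moreover have "1 \<le> fps_conv_radius (F * G)"
    using F(2) G(2) fps_conv_radius_mult[of F G] by (meson min.boundedI order_trans)
  moreover have "f w * g w = eval_fps (F * G) w" if w: "norm w < 1" for w
  proof -
    have "ereal (norm w) < fps_conv_radius F" "ereal (norm w) < fps_conv_radius G"
      using w F(2) G(2) by (auto intro: less_le_trans[of _ 1])
    then show ?thesis using F(3)[OF w] G(3)[OF w] by (simp add: eval_fps_mult)
  qed
  ultimately show ?thesis unfolding zfun_def by blast
qed

lemma zfun_power:
  assumes "zfun f" "n > 0" shows "zfun (\<lambda>w. f w ^ n)"
  using assms(2)
proof (induction n rule: nat_induct_non_zero)
  case (Suc n)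
  from zfun_mult[OF assms(1) Suc.IH] show ?case by simp
qed (use assms in simp)

text \<open>Constant term 1 keeps the recursion for the inverse series integral; the absence of
  zeros in the disc keeps its radius of convergence at least 1.\<close>

lemma zfun_inverse:
  assumes "zfun f" "f 0 = 1" "\<And>w. norm w < 1 \<Longrightarrow> f w \<noteq> 0" shows "zfun (\<lambda>w. inverse (f w))"
proof -
  obtain F where F: "\<And>n. fps_nth F n \<in> \<int>" "fps_conv_radius F \<ge> 1" "\<And>w. norm w < 1 \<Longrightarrow> f w
      = eval_fps F w"
    using assms(1) unfolding zfun_def by blast
  have F0: "fps_nth F 0 = 1" using F(3)[of 0] assms(2) by (simp add: eval_fps_at_0)
  have nz: "eval_fps F w \<noteq> 0" if "ereal (norm w) < 1" for w using that F(3)[of w] assms(3)[of w]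
      by simp
  have "fps_nth (inverse F) n \<in> \<int>" for n
  proof (induction n rule: less_induct)
    case (less n)
    show ?case
    proof (cases "n = 0")
      case True then show ?thesis using F0 by simp
    next
      case False
      have "inverse F * F = 1" using F0 by (simp add: inverse_mult_eq_1)
      then have "(\<Sum>i=0..n. fps_nth (inverse F) i * fps_nth F (n - i)) = 0"
        using False by (metis fps_mult_nth fps_one_nth)
      moreover have "{0..n} = insert n {0..<n}" by auto
      ultimately have "fps_nth (inverse F) n = - (\<Sum>i=0..<n. fps_nth (inverse F) i * fps_nth F (n
          - i))"
        using F0 by (simp add: eq_neg_iff_add_eq_0)
      also have "\<dots> \<in> \<int>" by (intro Ints_minus Ints_sum Ints_mult F less) auto
      finally show ?thesis .
    qed
  qed
  moreover have "1 \<le> fps_conv_radius (inverse F)"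
    using fps_conv_radius_inverse[of 1 F, OF nz] F(2) by (meson min.boundedI order_trans order_refl)
  moreover have "inverse (f w) = eval_fps (inverse F) w" if w: "norm w < 1" for w
  proof -
    have "ereal (norm w) < fps_conv_radius F" "ereal (norm w) < 1" using w F(2)
        by (auto intro: less_le_trans[of _ 1])
    then show ?thesis using eval_fps_inverse[of 1 F, OF nz] F(3)[OF w] by simp
  qed
  ultimately show ?thesis unfolding zfun_def by blast
qed

lemma zfunI_sums:
  assumes "\<And>n. a n \<in> \<int>" "\<And>w. norm w < 1 \<Longrightarrow> (\<lambda>n. a n * w ^ n) sums f w"
  shows "zfun f"
proof -
  have "fps_conv_radius (Abs_fps a) \<ge> 1" unfolding fps_conv_radius_def
  proof (rule conv_radius_geI_ex')
    fix r :: real assume "0 < r" "ereal r < 1"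
    then show "summable (\<lambda>n. fps_nth (Abs_fps a) n * of_real r ^ n)"
      using assms(2)[of "of_real r"] by (auto simp: sums_iff)
  qed
  moreover have "f w = eval_fps (Abs_fps a) w" if "norm w < 1" for w
    using assms(2)[OF that] by (simp add: eval_fps_def sums_iff)
  ultimately show ?thesis unfolding zfun_def using assms(1) by (intro exI[of _ "Abs_fps a"]) simp
qed

lemma finite_pent_fibre: "finite {i \<in> UNIV. pent i = n}"
proof (rule finite_subset)
  show "{i \<in> UNIV. pent i = n} \<subseteq> {- int n..int n}"
  proof
    fix i assume "i \<in> {i \<in> UNIV. pent i = n}"
    then have e: "2 * int n = i * (3 * i + 1)" using pent_eq[of i] by simp
    show "i \<in> {- int n..int n}"
    proof (cases "i \<ge> 0")
      case True
      have "i * 2 \<le> i * (3 * i + 1)"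
      proof (cases "i = 0")
        case False then show ?thesis using True by (intro mult_left_mono) auto
      qed simp
      then show ?thesis using e True by auto
    next
      case False
      have "(- i) * 2 \<le> (- i) * (- (3 * i + 1))" by (intro mult_left_mono) (use False in auto)
      then have "(- i) * 2 \<le> 2 * int n" using e by (simp add: algebra_simps)
      then show ?thesis using False by auto
    qed
  qed
qed simp

text \<open>The pentagonal series displays the integer coefficients that the infinite product
  conceals.\<close>

lemma zfun_euler: "m > 0 \<Longrightarrow> zfun (\<lambda>w. euler (w ^ m))"
proof (rule zfunI_sums)
  let ?a = "\<lambda>n. \<Sum>i | i \<in> UNIV \<and> pent i = n. (-1) ^ nat \<bar>i\<bar> :: complex"
  show "(if m dvd n then ?a (n div m) else 0) \<in> \<int>" for n by (auto intro!: Ints_sum Ints_power)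
  fix w :: complex assume "m > 0" "norm w < 1"
  then have "norm (w ^ m) < 1" by (intro norm_power_lt1)
  from has_sum_group_power[OF pentagonal[OF this] finite_pent_fibre]
  show "(\<lambda>n. (if m dvd n then ?a (n div m) else 0) * w ^ n) sums euler (w ^ m)"
    by (rule sums_subst_power) fact
qed

section \<open>Expansions in the nome and their restriction to the imaginary axis\<close>

lemma norm_nome: "Im z > 0 \<Longrightarrow> norm (nome z) < 1"
  by (simp add: nome_def)

lemma nome_imag:
  assumes "0 < q" "q < 1"
  defines "z \<equiv> \<i> * of_real (- ln q / (2 * pi))"
  shows "Im z > 0" "nome z = of_real q"
proof -
  show "Im z > 0" using assms by (simp add: z_def divide_neg_pos)
  have "2 * complex_of_real pi * \<i> * z = of_real (ln q)" by (simp add: z_def field_simps)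
  then show "nome z = of_real q" using assms(1) by (simp add: nome_def exp_of_real)
qed

lemma Re_term: "Re (of_int c * complex_of_real q ^ n) = real_of_int c * q ^ n"
proof -
  have "of_int c * complex_of_real q ^ n = complex_of_real (of_int c * q ^ n)" by simp
  then show ?thesis by (simp only: Re_complex_of_real)
qed

text \<open>Justifies the definite description. Existence: the series of g shifted by
  \<open>k > 0\<close>, which also forces the coefficient at 0 to vanish. Uniqueness: on the
  imaginary axis the nome is real, and real parts reduce to \<open>powser_unique\<close>.\<close>

lemma q_coeff_spec:
  assumes g: "zfun g" and k: "k > 0" and F: "\<And>z. Im z > 0 \<Longrightarrow> F z = nome z ^ k * g (nome z)"
  shows "\<And>z. Im z > 0 \<Longrightarrow> (\<lambda>n. of_int (q_coeff F n) * nome z ^ n) sums F z"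
proof -
  obtain G where G: "\<And>n. fps_nth G n \<in> \<int>" "fps_conv_radius G \<ge> 1" "\<And>w. norm w < 1 \<Longrightarrow> g w
      = eval_fps G w"
    using g unfolding zfun_def by blast
  have "\<exists>b. \<forall>n. fps_nth G n = of_int (b n)" using G(1) by (intro choice) (auto elim!: Ints_cases)
  then obtain b where b: "\<And>n. fps_nth G n = of_int (b n)" by blast
  define a where "a n = (if n < k then 0 else b (n - k))" for n
  let ?P = "\<lambda>a::nat \<Rightarrow> int. a 0 = 0 \<and> (\<forall>z. Im z > 0 \<longrightarrow> (\<lambda>n. of_int (a n) * nome z ^ n) sums F z)"
  have Pa: "?P a"
  proof (intro conjI allI impI)
    show "a 0 = 0" using k by (simp add: a_def)
    fix z assume z: "Im z > 0"
    have "ereal (norm (nome z)) < fps_conv_radius G"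
      using norm_nome[OF z] G(2) by (auto intro: less_le_trans[of _ 1])
    from sums_eval_fps[OF this] have "(\<lambda>n. nome z ^ k * (fps_nth G n * nome z ^ n))
        sums (nome z ^ k * eval_fps G (nome z))"
      by (rule sums_mult)
    also have "(\<lambda>n. nome z ^ k * (fps_nth G n * nome z ^ n)) = (\<lambda>n. of_int (a (n + k))
        * nome z ^ (n + k))"
      by (simp add: a_def b power_add mult_ac)
    also have "nome z ^ k * eval_fps G (nome z) = F z - (\<Sum>i<k. of_int (a i) * nome z ^ i)"
      using F[OF z] G(3)[OF norm_nome[OF z]] by (simp add: a_def)
    finally show "(\<lambda>n. of_int (a n) * nome z ^ n) sums F z" by (subst (asm) sums_iff_shift) simp
  qed
  have "a' = a" if "?P a'" for a'
  proof -
    have "(\<lambda>n. real_of_int (a' n)) = (\<lambda>n. real_of_int (a n))"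
    proof (rule powser_unique[of _ "\<lambda>q. Re (F (\<i> * of_real (- ln q / (2 * pi))))"])
      fix q :: real assume q: "0 < q" "q < 1"
      let ?z = "\<i> * complex_of_real (- ln q / (2 * pi))"
      have *: "(\<lambda>n. real_of_int (c n) * q ^ n) sums Re (F ?z)" if "?P c" for c
      proof -
        have "(\<lambda>n. of_int (c n) * nome ?z ^ n) sums F ?z" using that nome_imag(1)[OF q] by blast
        from sums_Re[OF this] show ?thesis unfolding nome_imag(2)[OF q] Re_term Re_complex_of_real .
      qed
      show "(\<lambda>n. real_of_int (a' n) * q ^ n) sums Re (F ?z)" by (rule *[OF that])
      show "(\<lambda>n. real_of_int (a n) * q ^ n) sums Re (F ?z)" by (rule *[OF Pa])
    qed
    then show ?thesis by (simp add: fun_eq_iff)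
  qed
  then have "?P (q_coeff F)" unfolding q_coeff_def using Pa by (intro theI[of ?P a]) blast+
  then show "\<And>z. Im z > 0 \<Longrightarrow> (\<lambda>n. of_int (q_coeff F n) * nome z ^ n) sums F z" by blast
qed

lemma q_coeff_real:
  assumes g: "zfun g" "k > 0" "\<And>z. Im z > 0 \<Longrightarrow> F z = nome z ^ k * g (nome z)" and q: "0 < q" "q < 1"
    and v: "F (\<i> * of_real (- ln q / (2 * pi))) = of_real v"
  shows "(\<lambda>n. real_of_int (q_coeff F n) * q ^ n) sums v"
proof -
  have "(\<lambda>n. of_int (q_coeff F n) * nome (\<i> * of_real (- ln q / (2 * pi))) ^ n)
      sums complex_of_real v"
    using q_coeff_spec[OF g nome_imag(1)[OF q]] v by simp
  from sums_Re[OF this] show ?thesis unfolding nome_imag(2)[OF q] Re_term Re_complex_of_real .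
qed

section \<open>The eta quotients\<close>

definition e24 :: "complex \<Rightarrow> complex" where "e24 z = exp (2 * of_real pi * \<i> * z / 24)"

lemma e24_pow: "e24 z ^ 24 = nome z"
  by (simp add: e24_def nome_def mult_ac flip: exp_of_nat_mult)

lemma e24_nz: "e24 z \<noteq> 0" by (simp add: e24_def)

lemma eta_scale: "eta (of_nat m * z) = e24 z ^ m * euler (nome z ^ m)"
proof -
  have "exp (2 * of_real pi * \<i> * (of_nat m * z) / 24) = e24 z ^ m"
    by (simp add: e24_def mult_ac flip: exp_of_nat_mult)
  moreover have "nome (of_nat m * z) = nome z ^ m"
    by (simp add: nome_def mult_ac flip: exp_of_nat_mult)
  ultimately show ?thesis by (simp add: eta_def euler_def)
qed

lemma euler_of_real:
  fixes q :: real
  assumes "\<bar>q\<bar> < 1" shows "euler (complex_of_real q) = of_real (euler q)"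
proof (rule LIMSEQ_unique)
  show "qpoch (complex_of_real q) \<longlonglongrightarrow> euler (complex_of_real q)"
      by (rule qpoch_tendsto) (use assms in simp)
  have "(\<lambda>n. complex_of_real (qpoch q n)) \<longlonglongrightarrow> of_real (euler q)"
    by (intro tendsto_of_real qpoch_tendsto) (use assms in simp)
  moreover have "(\<lambda>n. complex_of_real (qpoch q n)) = qpoch (complex_of_real q)"
    by (intro ext) (simp add: qpoch_def)
  ultimately show "qpoch (complex_of_real q) \<longlonglongrightarrow> of_real (euler q)" by simp
qed

lemma eta_imag:
  assumes q: "0 < q" "q < 1" and m: "m > 0"
  shows "eta (of_nat m * (\<i> * of_real (- ln q / (2 * pi)))) = of_real (eta_real q m)"
proof -
  have "2 * complex_of_real pi * \<i> * (\<i> * of_real (- ln q / (2 * pi))) / 24 = of_real (ln q / 24)"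
      by (simp add: field_simps)
  then have "e24 (\<i> * of_real (- ln q / (2 * pi))) = of_real (q powr (1/24))"
    using q by (simp only: e24_def exp_of_real powr_def) simp
  moreover have "euler (complex_of_real q ^ m) = of_real (euler (q ^ m))"
    using euler_of_real[of "q ^ m"] unit_pow(3)[OF q m] by simp
  ultimately show ?thesis unfolding eta_scale nome_imag(2)[OF q] eta_real_def by simp
qed

lemma zfun_divide:
  assumes "zfun f" "zfun g" "g 0 = 1" "\<And>w. norm w < 1 \<Longrightarrow> g w \<noteq> 0" shows "zfun (\<lambda>w. f w / g w)"
  unfolding divide_inverse by (intro zfun_mult zfun_inverse assms)

lemma euler_power_nz:
  fixes w :: "'a::{real_normed_field,banach}"
  shows "norm w < 1 \<Longrightarrow> m > 0 \<Longrightarrow> euler (w ^ m) \<noteq> 0"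
  by (intro euler_nz norm_power_lt1)

text \<open>An eta quotient is \<open>Q (\<lambda>m. eta (m * z))\<close> with a monomial
  \<open>Q\<close>; homogeneity collects the factors \<open>q^(m/24)\<close> of the eta functions
  into \<open>q^k\<close>.\<close>

lemma eta_quotient_series:
  fixes Q :: "(nat \<Rightarrow> complex) \<Rightarrow> complex"
  assumes q: "0 < q" "q < 1" and k: "k > 0"
    and F: "\<And>z. F z = Q (\<lambda>m. eta (of_nat m * z))"
    and zf: "zfun (\<lambda>w. Q (\<lambda>m. euler (w ^ m)))"
    and hom: "\<And>x E. x \<noteq> 0 \<Longrightarrow> (\<And>m. m > 0 \<Longrightarrow> E m \<noteq> 0) \<Longrightarrow> Q (\<lambda>m. x ^ m * E m) = x ^ (24 * k) * Q E"
    and v: "Q (\<lambda>m. eta (of_nat m * (\<i> * of_real (- ln q / (2 * pi))))) = of_real v"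
  shows "(\<lambda>n. real_of_int (q_coeff F n) * q ^ n) sums v"
proof (rule q_coeff_real[OF zf k _ q])
  show "F z = nome z ^ k * Q (\<lambda>m. euler (nome z ^ m))" if "Im z > 0" for z
    unfolding F eta_scale using hom[OF e24_nz euler_power_nz[OF norm_nome[OF that]]]
    by (simp add: power_mult e24_pow)
  show "F (\<i> * of_real (- ln q / (2 * pi))) = of_real v" unfolding F by (rule v)
qed

text \<open>The leading exponent k is the sum of level times exponent over the eta factors, divided
  by 24; here \<open>(5 + 35 - 2 - 14) / 24 = 1\<close>. The eight lemmas that follow differ only in
  this monomial.\<close>

lemma C1_series:
  assumes q: "0 < q" "q < 1"
  shows "(\<lambda>n. real_of_int (q_coeff C1 n) * q ^ n) sums (eta_real q 1 ^ 5 * eta_real q 7 ^ 5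
      / (eta_real q 2 * eta_real q 14))"
proof (rule eta_quotient_series[OF q, where k = 1 and Q = "\<lambda>e. e 1 ^ 5 * e 7 ^ 5 / (e 2
    * e 14)"], goal_cases)
  case 3 show ?case
    by (intro zfun_mult zfun_divide zfun_power zfun_euler) (simp_all add: power_0_left euler_nz
        euler_power_nz)
next
  case (4 x E) then show ?case
    by (simp add: field_simps power_mult_distrib flip: power_mult power_add)
next
  case 5 show ?case
    by (simp only: eta_imag[OF q] zero_less_one zero_less_numeral) simp
qed (simp_all add: C1_def)

lemma C2_series:
  assumes q: "0 < q" "q < 1"
  shows "(\<lambda>n. real_of_int (q_coeff C2 n) * q ^ n) sums (eta_real q 1 ^ 2 * eta_real q 2 ^ 2
      * eta_real q 7 ^ 2 * eta_real q 14 ^ 2)"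
proof (rule eta_quotient_series[OF q, where k = 2 and Q = "\<lambda>e. e 1 ^ 2 * e 2 ^ 2 * e 7 ^ 2
    * e 14 ^ 2"], goal_cases)
  case 3 show ?case
    by (intro zfun_mult zfun_divide zfun_power zfun_euler) (simp_all add: power_0_left euler_nz
        euler_power_nz)
next
  case (4 x E) then show ?case
    by (simp add: field_simps power_mult_distrib flip: power_mult power_add)
next
  case 5 show ?case
    by (simp only: eta_imag[OF q] zero_less_one zero_less_numeral) simp
qed (simp_all add: C2_def)

lemma C3_series:
  assumes q: "0 < q" "q < 1"
  shows "(\<lambda>n. real_of_int (q_coeff C3 n) * q ^ n) sums (eta_real q 1 ^ 6 * eta_real q 14 ^ 6
      / (eta_real q 2 ^ 2 * eta_real q 7 ^ 2))"
proof (rule eta_quotient_series[OF q, where k = 3 and Q = "\<lambda>e. e 1 ^ 6 * e 14 ^ 6 / (e 2 ^ 2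
    * e 7 ^ 2)"], goal_cases)
  case 3 show ?case
    by (intro zfun_mult zfun_divide zfun_power zfun_euler) (simp_all add: power_0_left euler_nz
        euler_power_nz)
next
  case (4 x E) then show ?case
    by (simp add: field_simps power_mult_distrib flip: power_mult power_add)
next
  case 5 show ?case
    by (simp only: eta_imag[OF q] zero_less_one zero_less_numeral) simp
qed (simp_all add: C3_def)

lemma C4_series:
  assumes q: "0 < q" "q < 1"
  shows "(\<lambda>n. real_of_int (q_coeff C4 n) * q ^ n) sums (eta_real q 2 ^ 6 * eta_real q 7 ^ 6
      / (eta_real q 1 ^ 2 * eta_real q 14 ^ 2))"
proof (rule eta_quotient_series[OF q, where k = 1 and Q = "\<lambda>e. e 2 ^ 6 * e 7 ^ 6 / (e 1 ^ 2
    * e 14 ^ 2)"], goal_cases)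
  case 3 show ?case
    by (intro zfun_mult zfun_divide zfun_power zfun_euler) (simp_all add: power_0_left euler_nz
        euler_power_nz)
next
  case (4 x E) then show ?case
    by (simp add: field_simps power_mult_distrib flip: power_mult power_add)
next
  case 5 show ?case
    by (simp only: eta_imag[OF q] zero_less_one zero_less_numeral) simp
qed (simp_all add: C4_def)

lemma C5_series:
  assumes q: "0 < q" "q < 1"
  shows "(\<lambda>n. real_of_int (q_coeff C5 n) * q ^ n) sums (eta_real q 4 ^ 2 * eta_real q 14 ^ 4
      * eta_real q 28 ^ 2)"
proof (rule eta_quotient_series[OF q, where k = 5 and Q = "\<lambda>e. e 4 ^ 2 * e 14 ^ 4
    * e 28 ^ 2"], goal_cases)
  case 3 show ?case
    by (intro zfun_mult zfun_divide zfun_power zfun_euler) (simp_all add: power_0_left euler_nz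
        euler_power_nz)
next
  case (4 x E) then show ?case
    by (simp add: field_simps power_mult_distrib flip: power_mult power_add)
next
  case 5 show ?case
    by (simp only: eta_imag[OF q] zero_less_one zero_less_numeral) simp
qed (simp_all add: C5_def)

lemma C6_series:
  assumes q: "0 < q" "q < 1"
  shows "(\<lambda>n. real_of_int (q_coeff C6 n) * q ^ n) sums (eta_real q 2 ^ 6 * eta_real q 28 ^ 6
      / (eta_real q 4 ^ 2 * eta_real q 14 ^ 2))"
proof (rule eta_quotient_series[OF q, where k = 6 and Q = "\<lambda>e. e 2 ^ 6 * e 28 ^ 6 / (e 4 ^ 2
    * e 14 ^ 2)"], goal_cases)
  case 3 show ?case
    by (intro zfun_mult zfun_divide zfun_power zfun_euler) (simp_all add: power_0_left euler_nz
        euler_power_nz)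
next
  case (4 x E) then show ?case
    by (simp add: field_simps power_mult_distrib flip: power_mult power_add)
next
  case 5 show ?case
    by (simp only: eta_imag[OF q] zero_less_one zero_less_numeral) simp
qed (simp_all add: C6_def)

lemma C7_series:
  assumes q: "0 < q" "q < 1"
  shows "(\<lambda>n. real_of_int (q_coeff C7 n) * q ^ n) sums (eta_real q 2 ^ 4 * eta_real q 28 ^ 6
      / eta_real q 4 ^ 2)"
proof (rule eta_quotient_series[OF q, where k = 7 and Q = "\<lambda>e. e 2 ^ 4 * e 28 ^ 6
    / e 4 ^ 2"], goal_cases)
  case 3 show ?case
    by (intro zfun_mult zfun_divide zfun_power zfun_euler) (simp_all add: power_0_left euler_nz
        euler_power_nz)
next
  case (4 x E) then show ?case
    by (simp add: field_simps power_mult_distrib flip: power_mult power_add)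
next
  case 5 show ?case
    by (simp only: eta_imag[OF q] zero_less_one zero_less_numeral) simp
qed (simp_all add: C7_def)

lemma C8_series:
  assumes q: "0 < q" "q < 1"
  shows "(\<lambda>n. real_of_int (q_coeff C8 n) * q ^ n) sums (eta_real q 1 * eta_real q 2 * eta_real q 7
      * eta_real q 28 ^ 8 / eta_real q 14 ^ 3)"
proof (rule eta_quotient_series[OF q, where k = 8 and Q = "\<lambda>e. e 1 * e 2 * e 7 * e 28 ^ 8
    / e 14 ^ 3"], goal_cases)
  case 3 show ?case
    by (intro zfun_mult zfun_divide zfun_power zfun_euler) (simp_all add: power_0_left euler_nz
        euler_power_nz)
next
  case (4 x E) then show ?case
    by (simp add: field_simps power_mult_distrib flip: power_mult power_add) (simp flip: power_Suc)
next
  case 5 show ?case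
    by (simp only: eta_imag[OF q] zero_less_one zero_less_numeral) simp
qed (simp_all add: C8_def)

lemma C9_series:
  assumes q: "0 < q" "q < 1"
  shows "(\<lambda>n. real_of_int (q_coeff C9 n) * q ^ n) sums (eta_real q 2 * eta_real q 4
      * eta_real q 28 ^ 9 / eta_real q 14 ^ 3)"
proof (rule eta_quotient_series[OF q, where k = 9 and Q = "\<lambda>e. e 2 * e 4 * e 28 ^ 9
    / e 14 ^ 3"], goal_cases)
  case 3 show ?case
    by (intro zfun_mult zfun_divide zfun_power zfun_euler) (simp_all add: power_0_left euler_nz
        euler_power_nz)
next
  case (4 x E) then show ?case
    by (simp add: field_simps power_mult_distrib flip: power_mult power_add)
next
  case 5 show ?case
    by (simp only: eta_imag[OF q] zero_less_one zero_less_numeral) simp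
qed (simp_all add: C9_def)

section \<open>The representation numbers\<close>

lemma finite_eight_fibre:
  "finite {(x1 :: int, x2 :: int, x3 :: int, x4 :: int, x5 :: int, x6 :: int, x7 :: int, x8 :: int).
     int n = x1^2 + x2^2 + x3^2 + x4^2 + 7 * (x5^2 + x6^2 + x7^2 + x8^2)}" (is "finite ?S")
proof (rule finite_subset)
  let ?I = "{- int n..int n}"
  have b: "x \<in> ?I" if "x^2 \<le> int n" for x :: int
    using int_abs_le_square[of x] that by auto
  show "?S \<subseteq> ?I \<times> ?I \<times> ?I \<times> ?I \<times> ?I \<times> ?I \<times> ?I \<times> ?I"
  proof
    fix z assume "z \<in> ?S"
    then obtain x1 x2 x3 x4 x5 x6 x7 x8 where z: "z = (x1, x2, x3, x4, x5, x6, x7, x8)"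
      and e: "int n = x1^2 + x2^2 + x3^2 + x4^2 + 7 * (x5^2 + x6^2 + x7^2 + x8^2)" by auto
    have "x1^2 \<le> int n" "x2^2 \<le> int n" "x3^2 \<le> int n" "x4^2 \<le> int n"
      "x5^2 \<le> int n" "x6^2 \<le> int n" "x7^2 \<le> int n" "x8^2 \<le> int n" unfolding e by simp_all
    then have "x1 \<in> ?I" "x2 \<in> ?I" "x3 \<in> ?I" "x4 \<in> ?I" "x5 \<in> ?I" "x6 \<in> ?I" "x7 \<in> ?I" "x8 \<in> ?I"
      by - (rule b, assumption)+
    then show "z \<in> ?I \<times> ?I \<times> ?I \<times> ?I \<times> ?I \<times> ?I \<times> ?I \<times> ?I" unfolding z by blast
  qed
qed auto

text \<open>The eight theta factors are expanded into one sum over integer 8-tuples with all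
  coefficients 1; collecting by exponent counts the fibres.\<close>

lemma R7_series:
  assumes q: "0 < q" "q < 1"
  shows "(\<lambda>n. real (R7 n) * q ^ n) sums (thA q ^ 4 * thA (q ^ 7) ^ 4)"
proof -
  define f where "f = (\<lambda>x::int. q ^ nat (x\<^sup>2))"
  define g where "g = (\<lambda>x::int. (q ^ 7) ^ nat (x\<^sup>2))"
  have fs: "(f has_sum thA q) UNIV" unfolding f_def by (rule thA_has_sum) (use q in auto)
  have gs: "(g has_sum thA (q ^ 7)) UNIV" unfolding g_def
      by (rule thA_has_sum) (use unit_pow[OF q, of 7] in auto)
  define Q where "Q = (\<lambda>(x1 :: int, x2 :: int, x3 :: int, x4 :: int, x5 :: int, x6 :: int, x7 ::
      int, x8 :: int).
     nat (x1\<^sup>2) + (nat (x2\<^sup>2) + (nat (x3\<^sup>2) + (nat (x4\<^sup>2) + (7 * nat (x5\<^sup>2) + (7 * nat (x6\<^sup>2) + (7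
         * nat (x7\<^sup>2) + 7 * nat (x8\<^sup>2))))))))"
  have "((\<lambda>(x1, y). f x1 * (case y of (x2, y) \<Rightarrow> f x2 * (case y of (x3, y) \<Rightarrow> f x3
      * (case y of (x4, y) \<Rightarrow> f x4 *
     (case y of (x5, y) \<Rightarrow> g x5 * (case y of (x6, y) \<Rightarrow> g x6 * (case y of (x7, x8) \<Rightarrow> g x7
         * g x8))))))) has_sum
     thA q * (thA q * (thA q * (thA q * (thA (q ^ 7) * (thA (q ^ 7) * (thA (q ^ 7)
         * thA (q ^ 7))))))))
     (UNIV \<times> (UNIV \<times> (UNIV \<times> (UNIV \<times> (UNIV \<times> (UNIV \<times> (UNIV \<times> UNIV)))))))"
    by (intro has_sum_times fs gs)
  moreover have "(\<lambda>(x1, y). f x1 * (case y of (x2, y) \<Rightarrow> f x2 * (case y of (x3, y) \<Rightarrow> f x3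
      * (case y of (x4, y) \<Rightarrow> f x4 *
     (case y of (x5, y) \<Rightarrow> g x5 * (case y of (x6, y) \<Rightarrow> g x6 * (case y of (x7, x8) \<Rightarrow> g x7
         * g x8))))))) = (\<lambda>z. 1 * q ^ Q z)"
    by (auto simp: fun_eq_iff f_def g_def Q_def power_add power_mult)
  ultimately have s: "((\<lambda>z. 1 * q ^ Q z) has_sum thA q ^ 4 * thA (q ^ 7) ^ 4) UNIV"
    by (simp add: power4_eq_xxxx mult_ac)
  have fib: "{z \<in> UNIV. Q z = n} = {(x1 :: int, x2 :: int, x3 :: int, x4 :: int, x5 :: int, x6 ::
      int, x7 :: int, x8 :: int).
     int n = x1^2 + x2^2 + x3^2 + x4^2 + 7 * (x5^2 + x6^2 + x7^2 + x8^2)}" for n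
  proof -
    have "Q (x1, x2, x3, x4, x5, x6, x7, x8) = n \<longleftrightarrow> int n = x1^2 + x2^2 + x3^2 + x4^2 + 7 * (x5^2
        + x6^2 + x7^2 + x8^2)"
      for x1 x2 x3 x4 x5 x6 x7 x8
    proof -
      have "int (Q (x1, x2, x3, x4, x5, x6, x7, x8)) = x1^2 + x2^2 + x3^2 + x4^2 + 7 * (x5^2
          + x6^2 + x7^2 + x8^2)"
        by (simp add: Q_def)
      then show ?thesis by (metis of_nat_eq_iff)
    qed
    note Q = this
    have "z \<in> {z \<in> UNIV. Q z = n} \<longleftrightarrow> z \<in> {(x1, x2, x3, x4, x5, x6, x7, x8).
        int n = x1^2 + x2^2 + x3^2 + x4^2 + 7 * (x5^2 + x6^2 + x7^2 + x8^2)}" for z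
    proof -
      obtain x1 x2 x3 x4 x5 x6 x7 x8 where z: "z = (x1, x2, x3, x4, x5, x6, x7, x8)"
          by (metis surj_pair)
      show ?thesis unfolding z by (simp only: mem_Collect_eq prod.case UNIV_I simp_thms Q)
    qed
    then show ?thesis by (rule set_eqI)
  qed
  have "(\<lambda>n. (\<Sum>z | z \<in> UNIV \<and> Q z = n. 1) * q ^ n) sums (thA q ^ 4 * thA (q ^ 7) ^ 4)"
  proof (rule has_sum_group_power[OF s])
    show "finite {z \<in> UNIV. Q z = n}" for n unfolding fib by (rule finite_eight_fibre)
  qed
  then show ?thesis unfolding fib R7_def by simp
qed

lemma sigma3_eq:
  assumes "n > 0" "k > 0" shows "real (sigma3 (real n / real k)) = s3 k n"
proof (cases "k dvd n")
  case True
  then obtain j where j: "n = k * j" by auto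
  then have "j > 0" using assms by auto
  have "real n / real k = real j" using assms by (simp add: j)
  moreover have "real j \<in> \<nat> - {0}" using \<open>j > 0\<close> by auto
  ultimately show ?thesis using assms j by (simp add: sigma3_def s3_def sig_def)
next
  case False
  have "real n / real k \<notin> \<nat>"
  proof
    assume "real n / real k \<in> \<nat>"
    then obtain j where "real n / real k = real j" by (auto elim: Nats_cases)
    then have "real n = real (j * k)" using assms by (simp add: field_simps)
    then have "n = j * k" by (simp only: of_nat_eq_iff)
    then show False using False by simp
  qed
  then show ?thesis using False by (simp add: sigma3_def s3_def)
qed

theorem corollary3p1:
  fixes n :: nat
  assumes "n \<ge> 1"
  shows "real (R7 n) =
      8/25 * real (sigma3 (real n)) - 16/25 * real (sigma3 (real n / 2))
    + 128/25 * real (sigma3 (real n / 4)) + 392/25 * real (sigma3 (real n / 7))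
    - 784/25 * real (sigma3 (real n / 14)) + 6272/25 * real (sigma3 (real n / 28))
    - 928/175 * of_int (q_coeff C1 n) - 768/25 * of_int (q_coeff C2 n)
    + 32/5 * of_int (q_coeff C3 n) + 2272/175 * of_int (q_coeff C4 n)
    + 2304/25 * of_int (q_coeff C5 n) + 768/5 * of_int (q_coeff C6 n)
    - 1152/25 * of_int (q_coeff C7 n)
    + 24576/25 * (of_int (q_coeff C8 n) + of_int (q_coeff C9 n))"
proof -
  obtain v where v: "pseries (\<lambda>q. thA q ^ 8) v" using pseries_ex_power[OF thA_pseries, of 7] by auto
  define w where "w n = (if 7 dvd n then v (n div 7) else 0)" for n
  define h where "h n = 1/50 * v n + 49/50 * w n
    - 928/175 * of_int (q_coeff C1 n) - 768/25 * of_int (q_coeff C2 n)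
    + 32/5 * of_int (q_coeff C3 n) + 2272/175 * of_int (q_coeff C4 n)
    + 2304/25 * of_int (q_coeff C5 n) + 768/5 * of_int (q_coeff C6 n)
    - 1152/25 * of_int (q_coeff C7 n)
    + 24576/25 * (of_int (q_coeff C8 n) + of_int (q_coeff C9 n))" for n
  have "(\<lambda>n. real (R7 n)) = h"
  proof (rule powser_unique[of _ "\<lambda>q. thA q ^ 4 * thA (q ^ 7) ^ 4"])
    fix q :: real assume q: "0 < q" "q < 1"
    show "(\<lambda>n. real (R7 n) * q ^ n) sums (thA q ^ 4 * thA (q ^ 7) ^ 4)" by (rule R7_series[OF q])
    have w: "(\<lambda>n. w n * q ^ n) sums (thA (q ^ 7) ^ 8)"
      unfolding w_def by (rule sums_subst_power[OF sums_pseries_pos[OF v]])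
          (use unit_pow[OF q, of 7] in auto)
    note C = C1_series[OF q] C2_series[OF q] C3_series[OF q]
      C4_series[OF q] C5_series[OF q] C6_series[OF q]
      C7_series[OF q] C8_series[OF q] C9_series[OF q]
    have "(\<lambda>n. 1/50 * (v n * q ^ n) + 49/50 * (w n * q ^ n)
    - 928/175 * (of_int (q_coeff C1 n) * q ^ n) - 768/25 * (of_int (q_coeff C2 n) * q ^ n)
    + 32/5 * (of_int (q_coeff C3 n) * q ^ n) + 2272/175 * (of_int (q_coeff C4 n) * q ^ n)
    + 2304/25 * (of_int (q_coeff C5 n) * q ^ n) + 768/5 * (of_int (q_coeff C6 n) * q ^ n)
    - 1152/25 * (of_int (q_coeff C7 n) * q ^ n)
    + 24576/25 * (of_int (q_coeff C8 n) * q ^ n + of_int (q_coeff C9 n) * q ^ n)) sums (thA q ^ 4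
        * thA (q ^ 7) ^ 4)"
      unfolding theta_identity[OF q]
      by (intro sums_add sums_diff sums_mult C w sums_pseries_pos[OF v q])
    moreover have "1/50 * (v n * q ^ n) + 49/50 * (w n * q ^ n)
    - 928/175 * (of_int (q_coeff C1 n) * q ^ n) - 768/25 * (of_int (q_coeff C2 n) * q ^ n)
    + 32/5 * (of_int (q_coeff C3 n) * q ^ n) + 2272/175 * (of_int (q_coeff C4 n) * q ^ n)
    + 2304/25 * (of_int (q_coeff C5 n) * q ^ n) + 768/5 * (of_int (q_coeff C6 n) * q ^ n)
    - 1152/25 * (of_int (q_coeff C7 n) * q ^ n)
    + 24576/25 * (of_int (q_coeff C8 n) * q ^ n + of_int (q_coeff C9 n) * q ^ n) = h n * q ^ n"
        for n
      by (simp only: h_def distrib_right left_diff_distrib distrib_left mult.assoc)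
    ultimately show "(\<lambda>n. h n * q ^ n) sums (thA q ^ 4 * thA (q ^ 7) ^ 4)" by (simp only:)
  qed
  then have R: "real (R7 n) = h n" by (rule fun_cong)
  have n: "n > 0" using assms by simp
  have vn: "v n = 16 * (s3 1 n - 2 * s3 2 n + 16 * s3 4 n)" by (rule eight_squares[OF v n])
  have wn: "w n = 16 * (s3 7 n - 2 * s3 14 n + 16 * s3 28 n)"
  proof (cases "7 dvd n")
    case True
    then obtain m where m: "n = 7 * m" by auto
    then have "m > 0" using n by simp
    then show ?thesis using eight_squares[OF v, of m] s3_scale[of 7 1 m] s3_scale[of 7 2 m]
        s3_scale[of 7 4 m]
      by (simp add: w_def m)
  next
    case False
    then have "\<not> 14 dvd n" "\<not> 28 dvd n" using dvd_trans[of 7 14 n] dvd_trans[of 7 28 n] by auto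
    then show ?thesis using False by (simp add: w_def s3_def)
  qed
  have "s3 1 n = real (sigma3 (real n))" "s3 2 n = real (sigma3 (real n / 2))" "s3 4 n
      = real (sigma3 (real n / 4))"
    "s3 7 n = real (sigma3 (real n / 7))" "s3 14 n = real (sigma3 (real n / 14))" "s3 28 n
        = real (sigma3 (real n / 28))"
    using sigma3_eq[OF n, of 1] sigma3_eq[OF n, of 2] sigma3_eq[OF n, of 4] sigma3_eq[OF n, of 7]
        sigma3_eq[OF n, of 14] sigma3_eq[OF n, of 28]
    by simp_all
  \<comment> \<open>The divisor sum coefficients are 1, -2, 16 multiplied by
    \<open>16 / 50 = 8 / 25\<close>, and by \<open>49 * 16 / 50 = 392 / 25\<close> for the terms
    with 7.\<close>
  then show ?thesis unfolding R h_def vn wn by (simp add: algebra_simps)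
qed

end
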